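(* Let $\mathcal X$ be a Polish space and let $c:\mathcal X^2\to[0,\infty]$ be a lower semicontinuous function. For each integer $k\ge1$ let $(\rho^{k,x})_{x\in\mathcal X}$ be a measurable kernel of Borel probability measures on $\mathcal X$. Assume that for each $x\in\mathcal X$ the sequence $(\rho^{k,x})_{k\ge1}$ satisfies the large deviation principle in $\mathcal X$ with scale $k$ and the coercive rate function $c(x,\cdot):\mathcal X\to[0,\infty]$. Let $\mu_0,\mu_1\in \mathrm P(\mathcal X)$. For $k\ge 1$ and $\nu\in\mathrm P(\mathcal X)$ consider the problems $$(\mathrm S_{01}^k(\nu))\qquad \tfrac1k H(\pi|\rho^{k,\mu_0})\to\min;\quad \pi\in \mathrm P(\mathcal X^2):\ \pi_0=\mu_0,\ \pi_1=\nu,$$ $$(\mathrm{MK})\qquad \int_{\mathcal X^2}c\,d\pi\to\min;\quad \pi\in \mathrm P(\mathcal X^2):\ \pi_0=\mu_0,\ \pi_1=\mu_1.$$ Then there exists a sequence $(\mu_1^k)_{k\ge1}$ in $\mathrm P(\mathcal X)$ such that $\lim_{k\to\infty}\mu_1^k=\mu_1$ and $$\lim_{k\to\infty}\inf(\mathrm S_{01}^k(\mu_1^k))=\inf(\mathrm{MK})\in[0,\infty].$$ Moreover, let $(\mu_1^k)_{k\ge1}$ be any such sequence and suppose in addition that $\inf(\mathrm{MK})<\infty$. Then for each large enough $k$, $(\mathrm S_{01}^k(\mu_1^k))$ admits a unique solution $\widehat\pi^k\in\mathrm P(\mathcal X^2)$, and any limit point of the sequence $(\widehat\pi^k)$ in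 $\mathrm P(\mathcal X^2)$ is a solution to $(\mathrm{MK})$. In particular, if $(\mathrm{MK})$ admits a unique solution $\widehat\pi\in\mathrm P(\mathcal X^2)$, then $\lim_{k\to\infty}\widehat\pi^k=\widehat\pi$ in $\mathrm P(\mathcal X^2)$.
   Context: For a topological space $E$, $\mathrm P(E)$ is the set of Borel probability measures on $E$ with the narrow topology (weakest topology making $\mu\mapsto\int f\,d\mu$ continuous for all bounded continuous $f$). For $\pi\in\mathrm P(\mathcal X^2)$, $\pi_0,\pi_1$ are its first and second marginals. $\rho^{k,\mu_0}(dx\,dy):=\mu_0(dx)\rho^{k,x}(dy)\in\mathrm P(\mathcal X^2)$. Relative entropy: $H(P|R)=\int\log(dP/dR)\,dP\in[0,\infty]$ if $P\ll R$, and $H(P|R)=\infty$ otherwise. A function $f:E\to(-\infty,\infty]$ on a Hausdorff space is coercive if all its sublevel sets $\{f\le a\}$, $a\in\mathbb R$, are compact. A sequence $(\gamma_k)_{k\ge1}$ of Borel probability measures on a Polish space $E$ satisfies the large deviation principle with scale $k$ and rate function $I:E\to[0,\infty]$ (lower semicontinuous) if for each Borel $A\subset E$, $-\inf_{\mathrm{int} A}I\le\liminf_k\frac1k\log\gamma_k(A)\le\limsup_k\frac1k\log\gamma_k(A)\le-\inf_{\mathrm{cl} A}I$. The infimum over the empty set is $+\infty$; $\inf$ of a problem denotes its minimal value. *)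

theory Defs
  imports "HOL-Probability.Probability"
begin

abbreviation prob_measures :: "'b::topological_space measure set"
  where "prob_measures \<equiv> space (prob_algebra borel)"

definition narrow_topology :: "'b::topological_space measure topology"
  where "narrow_topology = topology_generated_by
    {{\<mu> \<in> prob_measures. (\<integral>x. f x \<partial>\<mu>) \<in> U} | (f :: 'b \<Rightarrow> real) U.
       continuous_on UNIV f \<and> bounded (range f) \<and> open U}"

text \<open>A limit point of a sequence is a cluster point: every neighbourhood contains infinitely many
  terms. The narrow topology of a Polish space is metrizable, so these are exactly the limits of
  convergent subsequences.\<close>
definition seq_limit_point :: "'b topology \<Rightarrow> (nat \<Rightarrow> 'b) \<Rightarrow> 'b \<Rightarrow> bool"
  where "seq_limit_point X s l \<longleftrightarrow>
    l \<in> topspace X \<and> (\<forall>U. openin X U \<and> l \<in> U \<longrightarrow> (\<exists>\<^sub>F k in sequentially. s k \<in> U))"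

definition lower_semicontinuous :: "('b::topological_space \<Rightarrow> ennreal) \<Rightarrow> bool"
  where "lower_semicontinuous f \<longleftrightarrow> (\<forall>a. closed {x. f x \<le> a})"

definition coercive :: "('b::t2_space \<Rightarrow> ennreal) \<Rightarrow> bool"
  where "coercive f \<longleftrightarrow> (\<forall>a::real. compact {x. enn2ereal (f x) \<le> ereal a})"

definition ext_ln :: "real \<Rightarrow> ereal"
  where "ext_ln p = (if p = 0 then -\<infinity> else ereal (ln p))"

definition large_deviation_principle ::
    "(nat \<Rightarrow> 'b::polish_space measure) \<Rightarrow> ('b \<Rightarrow> ennreal) \<Rightarrow> bool"
  where "large_deviation_principle \<gamma> I \<longleftrightarrow> lower_semicontinuous I \<and>
    (\<forall>A\<in>sets borel.
       - enn2ereal (INF x\<in>interior A. I x)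
         \<le> liminf (\<lambda>k. ereal (1 / real k) * ext_ln (measure (\<gamma> k) A)) \<and>
       limsup (\<lambda>k. ereal (1 / real k) * ext_ln (measure (\<gamma> k) A))
         \<le> - enn2ereal (INF x\<in>closure A. I x))"

text \<open>The integral of \<open>log (dP/dR)\<close> is taken as positive part minus negative part in the extended
  reals, because the Bochner integral used in \<open>KL_divergence\<close> is \<open>0\<close> when the integral is
  \<open>\<infinity>\<close>. For probability measures the negative part is always finite. Here
  \<open>entropy_density (exp 1) R P\<close> is the natural logarithm of \<open>dP/dR\<close>.\<close>
definition rel_entropy :: "'b measure \<Rightarrow> 'b measure \<Rightarrow> ereal"
  where "rel_entropy P R =
    (if absolutely_continuous R P
     then enn2ereal (\<integral>\<^sup>+x. ennreal (entropy_density (exp 1) R P x) \<partial>P)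
        - enn2ereal (\<integral>\<^sup>+x. ennreal (- entropy_density (exp 1) R P x) \<partial>P)
     else \<infinity>)"

text \<open>\<open>\<mu>(dx) \<kappa>(x, dy)\<close>\<close>
definition joint_law ::
    "'b::polish_space measure \<Rightarrow> ('b \<Rightarrow> 'b measure) \<Rightarrow> ('b \<times> 'b) measure"
  where "joint_law \<mu> \<kappa> = \<mu> \<bind> (\<lambda>x. \<kappa> x \<bind> (\<lambda>y. return borel (x, y)))"

definition couplings ::
    "'b::polish_space measure \<Rightarrow> 'b measure \<Rightarrow> ('b \<times> 'b) measure set"
  where "couplings \<mu> \<nu> =
    {\<pi> \<in> prob_measures. distr \<pi> borel fst = \<mu> \<and> distr \<pi> borel snd = \<nu>}"

definition S_cost :: "(nat \<Rightarrow> 'b \<Rightarrow> 'b measure) \<Rightarrow> 'b::polish_space measure \<Rightarrow> nat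
    \<Rightarrow> ('b \<times> 'b) measure \<Rightarrow> ereal"
  where "S_cost \<rho> \<mu>\<^sub>0 k \<pi> = ereal (1 / real k) * rel_entropy \<pi> (joint_law \<mu>\<^sub>0 (\<rho> k))"

definition S_inf :: "(nat \<Rightarrow> 'b \<Rightarrow> 'b measure) \<Rightarrow> 'b::polish_space measure \<Rightarrow> nat
    \<Rightarrow> 'b measure \<Rightarrow> ereal"
  where "S_inf \<rho> \<mu>\<^sub>0 k \<nu> = (INF \<pi>\<in>couplings \<mu>\<^sub>0 \<nu>. S_cost \<rho> \<mu>\<^sub>0 k \<pi>)"

definition S_solution :: "(nat \<Rightarrow> 'b \<Rightarrow> 'b measure) \<Rightarrow> 'b::polish_space measure \<Rightarrow> nat
    \<Rightarrow> 'b measure \<Rightarrow> ('b \<times> 'b) measure \<Rightarrow> bool"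
  where "S_solution \<rho> \<mu>\<^sub>0 k \<nu> \<pi> \<longleftrightarrow>
    is_arg_min (S_cost \<rho> \<mu>\<^sub>0 k) (\<lambda>\<pi>. \<pi> \<in> couplings \<mu>\<^sub>0 \<nu>) \<pi>"

definition MK_inf :: "('b \<times> 'b \<Rightarrow> ennreal) \<Rightarrow> 'b::polish_space measure
    \<Rightarrow> 'b measure \<Rightarrow> ennreal"
  where "MK_inf c \<mu>\<^sub>0 \<mu>\<^sub>1 = (INF \<pi>\<in>couplings \<mu>\<^sub>0 \<mu>\<^sub>1. \<integral>\<^sup>+z. c z \<partial>\<pi>)"

definition MK_solution :: "('b \<times> 'b \<Rightarrow> ennreal) \<Rightarrow> 'b::polish_space measure
    \<Rightarrow> 'b measure \<Rightarrow> ('b \<times> 'b) measure \<Rightarrow> bool"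
  where "MK_solution c \<mu>\<^sub>0 \<mu>\<^sub>1 \<pi> \<longleftrightarrow>
    is_arg_min (\<lambda>\<pi>. \<integral>\<^sup>+z. c z \<partial>\<pi>) (\<lambda>\<pi>. \<pi> \<in> couplings \<mu>\<^sub>0 \<mu>\<^sub>1) \<pi>"

lemma topspace_narrow_topology: "topspace narrow_topology = prob_measures"
proof -
  have "\<exists>(f :: 'a \<Rightarrow> real) U. prob_measures = {\<mu> \<in> prob_measures. (\<integral>x. f x \<partial>\<mu>) \<in> U} \<and>
      continuous_on UNIV f \<and> bounded (range f) \<and> open U"
    by (rule exI[of _ "\<lambda>_. 0"], rule exI[of _ UNIV]) auto
  then show ?thesis
    unfolding narrow_topology_def topology_generated_by_topspace by blast
qed

lemma limitin_narrow_topology: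
  fixes \<mu> :: "nat \<Rightarrow> 'b::topological_space measure"
  assumes "\<And>k. \<mu> k \<in> prob_measures" "\<nu> \<in> prob_measures"
  shows "limitin narrow_topology \<mu> \<nu> sequentially \<longleftrightarrow>
    (\<forall>f :: 'b \<Rightarrow> real. continuous_on UNIV f \<and> bounded (range f) \<longrightarrow>
       (\<lambda>k. \<integral>x. f x \<partial>\<mu> k) \<longlonglongrightarrow> (\<integral>x. f x \<partial>\<nu>))" (is "?L \<longleftrightarrow> ?R")
proof
  assume L: ?L
  show ?R
  proof (intro allI impI topological_tendstoI)
    fix f :: "'b \<Rightarrow> real" and U
    assume f: "continuous_on UNIV f \<and> bounded (range f)" and U: "open U" "(\<integral>x. f x \<partial>\<nu>) \<in> U"
    have "openin narrow_topology {\<mu> \<in> prob_measures. (\<integral>x. f x \<partial>\<mu>) \<in> U}"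
      unfolding narrow_topology_def by (rule topology_generated_by_Basis) (use f U in blast)
    with L U assms(2) show "\<forall>\<^sub>F k in sequentially. (\<integral>x. f x \<partial>\<mu> k) \<in> U"
      unfolding limitin_def by (auto elim!: allE eventually_mono)
  qed
next
  assume R: ?R
  have "\<forall>\<^sub>F k in sequentially. \<mu> k \<in> V" if "openin narrow_topology V" "\<nu> \<in> V" for V
  proof -
    have "generate_topology_on {{\<mu> \<in> prob_measures. (\<integral>x. f x \<partial>\<mu>) \<in> U} | (f :: 'b \<Rightarrow> real) U.
       continuous_on UNIV f \<and> bounded (range f) \<and> open U} V"
      using that(1) by (simp add: narrow_topology_def openin_topology_generated_by_iff)
    then show ?thesis using that(2)
    proof induction
      case (Basis S)
      then obtain f :: "'b \<Rightarrow> real" and U where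
        S: "S = {\<mu> \<in> prob_measures. (\<integral>x. f x \<partial>\<mu>) \<in> U}"
        and f: "continuous_on UNIV f" "bounded (range f)" and U: "open U" by blast
      have "(\<lambda>k. \<integral>x. f x \<partial>\<mu> k) \<longlonglongrightarrow> (\<integral>x. f x \<partial>\<nu>)" using R f by blast
      from topological_tendstoD[OF this U] Basis.prems show ?case
        using assms(1) by (auto simp: S)
    next
      case (UN K)
      then obtain S where S: "S \<in> K" "\<nu> \<in> S" by blast
      then have "\<forall>\<^sub>F k in sequentially. \<mu> k \<in> S" using UN.IH by blast
      then show ?case by (rule eventually_mono) (use S in blast)
    qed (auto simp: eventually_conj_iff)
  qed
  then show ?L using assms(2) by (simp add: limitin_def topspace_narrow_topology)
qed

lemma joint_law_in_prob_measures:
  fixes \<mu> :: "'b::polish_space measure"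
  assumes \<mu>: "\<mu> \<in> prob_measures" and \<kappa>: "\<kappa> \<in> borel \<rightarrow>\<^sub>M prob_algebra borel"
  shows "joint_law \<mu> \<kappa> \<in> prob_measures"
proof -
  note [measurable] = \<kappa>
  have "(\<lambda>x::'b. \<kappa> x \<bind> (\<lambda>y. return borel (x, y)))
      \<in> borel \<rightarrow>\<^sub>M prob_algebra (borel :: ('b \<times> 'b) measure)"
    unfolding borel_prod[symmetric]
    by (intro measurable_bind_prob_space2[where N = borel]) measurable
  then have "(\<lambda>M. M \<bind> (\<lambda>x. \<kappa> x \<bind> (\<lambda>y. return borel (x, y))))
      \<in> prob_algebra borel \<rightarrow>\<^sub>M prob_algebra (borel :: ('b \<times> 'b) measure)"
    by (intro measurable_bind_prob_space2[where N = borel]) measurable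
  from measurable_space[OF this \<mu>] show ?thesis
    by (simp add: joint_law_def)
qed

end

theory Submission
  imports Defs "HOL-Real_Asymp.Real_Asymp"
begin

text \<open>The scaled entropies \<open>\<pi> \<mapsto> H(\<pi>|\<rho>\<^sup>k\<^sup>,\<^sup>\<mu>\<^sup>0) / k\<close> converge to \<open>\<pi> \<mapsto> \<integral>c d\<pi>\<close> in the sense of Gamma-convergence
  on the couplings with first marginal \<open>\<mu>\<^sub>0\<close>.

  Lower bound: for a bounded Lipschitz function \<open>0 \<le> \<phi> \<le> c\<close> the Donsker--Varadhan inequality applied to
  \<open>k \<phi>(x, y) - log \<integral>exp(k \<phi>(x, z)) \<rho>\<^sup>k\<^sup>,\<^sup>x(dz)\<close> gives \<open>H(\<pi>|\<rho>\<^sup>k\<^sup>,\<^sup>\<mu>\<^sup>0) / k \<ge> \<integral>\<phi> d\<pi> - o(1)\<close> uniformly in \<open>\<pi>\<close>, by the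
  large deviation upper bound, and \<open>c\<close> is a supremum of such \<open>\<phi>\<close>. Upper bound: draw \<open>(x, y) \<sim> \<pi>\<close> and then
  resample the second coordinate from \<open>\<rho>\<^sup>k\<^sup>,\<^sup>x\<close> conditioned on a small ball around \<open>y\<close>; by the large deviation
  lower bound the entropic cost is at most about \<open>k c(x, y)\<close>. Compactness of couplings with convergent marginals
  (Prokhorov) turns these bounds into convergence of infima and of minimizers. For fixed \<open>k\<close>, uniform convexity
  of \<open>t log t\<close> makes every minimizing sequence of densities Cauchy in \<open>L\<^sup>1\<close>, hence existence and
  uniqueness.\<close>

section \<open>Relative entropy\<close>

text \<open>The large deviation principle holds for each \<open>x\<close> separately, with no
  uniformity in \<open>x\<close>, and both bounds are built around this. In the lower bound the
  normaliser of the test function depends on \<open>x\<close> alone, so all couplings with first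
  marginal \<open>\<mu>\<^sub>0\<close> see the same error, which vanishes by dominated convergence.
  The normaliser also makes the exponential moment equal to 1, where \<open>log\<close> and its
  linear upper bound agree, so the weakened duality inequality loses nothing. In the upper bound the
  predicted mass around \<open>y\<close> is reached only from some \<open>k\<close> on that depends
  on \<open>(x, y)\<close>. Pairs for which it is not yet reached are left unconditioned; for each
  fixed radius their \<pi>-mass tends to 0, and a diagonal choice lets the radius shrink with
  \<open>k\<close>. Resampling moves the second marginal, which is why the target marginal has to
  vary with \<open>k\<close>. Existence at fixed \<open>k\<close> rests on a midpoint inequality for
  \<open>ent\<close> with a free parameter \<tau>: being linear in the convexity gap, it integrates
  directly and replaces a Pinsker-type estimate.\<close>

text \<open>The affine part integrates to \<open>0\<close> against a density but makes the integrand nonnegative, so that the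
  relative entropy is a plain nonnegative integral.\<close>

definition ent :: "real \<Rightarrow> real" where "ent t = t * ln t - t + 1"

section \<open>Scalar inequalities for \<open>ent\<close>\<close>

lemma borel_measurable_ent [measurable]: "ent \<in> borel_measurable borel"
  unfolding ent_def by measurable

text \<open>Fenchel-Young inequality for the dual pair \<open>ent t\<close> and
  \<open>exp s - 1\<close>, with equality at \<open>t = exp s\<close>. It is the source of every
  duality bound below.\<close>

lemma ent_ge_line:
  assumes "0 \<le> t"
  shows "s * t - exp s + 1 \<le> ent t"
proof (cases "t = 0")
  case False
  then have t: "0 < t" using assms by simp
  have "t * (1 + (s - ln t)) \<le> t * exp (s - ln t)"
    using t by (intro mult_left_mono exp_ge_add_one_self) auto
  also have "\<dots> = exp s" using t by (simp add: exp_diff)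
  finally show ?thesis by (simp add: ent_def algebra_simps)
qed (simp add: ent_def)

lemma ent_nonneg: "0 \<le> t \<Longrightarrow> 0 \<le> ent t"
  using ent_ge_line[of t 0] by simp

lemma continuous_on_ent: "continuous_on {0..} ent"
proof -
  have "continuous (at t within {0..}) (\<lambda>t::real. t * ln t)" if "0 \<le> t" for t
  proof (cases "t = 0")
    case True
    have "((\<lambda>t::real. t * ln t) \<longlongrightarrow> 0) (at_right 0)" by real_asymp
    then show ?thesis using True
      by (simp add: continuous_within at_within_Ici_at_right)
  next
    case False
    then show ?thesis by (intro continuous_intros) auto
  qed
  then have "continuous_on {0..} (\<lambda>t::real. t * ln t)"
    by (auto simp: continuous_on_eq_continuous_within)
  then have "continuous_on {0..} (\<lambda>t::real. t * ln t - t + 1)"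
    by (rule continuous_on_add[OF continuous_on_diff]) (auto intro: continuous_intros)
  then show ?thesis unfolding ent_def[abs_def] .
qed

text \<open>Applying \<open>ln x \<le> x - 1\<close> to \<open>1 / t\<close> itself would only give
  nonnegativity. Applied to \<open>1 / sqrt t\<close> it is doubled by
  \<open>ln t = 2 * ln (sqrt t)\<close> and leaves the square of \<open>1 - sqrt t\<close>, which is
  at least a quarter of the square of \<open>1 - t\<close>.\<close>

lemma ent_ge_quadratic:
  assumes "0 \<le> t" "t \<le> 1"
  shows "(1 - t)\<^sup>2 / 4 \<le> ent t"
proof (cases "t = 0")
  case False
  define r where "r = sqrt t"
  have r: "0 < r" "r \<le> 1" "t = r\<^sup>2" using assms False by (auto simp: r_def)
  have "1 - 1 / r \<le> ln r" using ln_le_minus_one[of "1 / r"] r by (simp add: ln_div)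
  then have "r\<^sup>2 * (1 - 1 / r) \<le> r\<^sup>2 * ln r" by (intro mult_left_mono) auto
  moreover have "r\<^sup>2 * (1 - 1 / r) = r\<^sup>2 - r" using r by (simp add: power2_eq_square right_diff_distrib)
  ultimately have "r\<^sup>2 - r \<le> r\<^sup>2 * ln r" by simp
  moreover have "ln t = 2 * ln r" using r by (simp add: ln_realpow)
  ultimately have 1: "(1 - r)\<^sup>2 \<le> ent t" unfolding ent_def r(3)
    by (simp add: r(3) power2_eq_square algebra_simps)
  have "(1 - t)\<^sup>2 = (1 - r)\<^sup>2 * (1 + r)\<^sup>2" unfolding r(3) by (simp add: power2_eq_square algebra_simps)
  also have "\<dots> \<le> (1 - r)\<^sup>2 * 2\<^sup>2" using r by (intro mult_left_mono power_mono) auto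
  finally show ?thesis using 1 by simp
qed (simp add: ent_def)

text \<open>Quantitative convexity. The natural estimate bounds the square of the distance by the
  gap; weighting with \<tau> makes it linear in both terms, so it can be integrated against a
  reference measure without further work.\<close>

lemma ent_midpoint_gap:
  assumes "0 \<le> a" "0 \<le> b" "0 < \<tau>"
  shows "\<bar>a - b\<bar> \<le> \<tau> * (a + b) + 8 / \<tau> * ((ent a + ent b) / 2 - ent ((a + b) / 2))"
proof -
  have *: "\<bar>a - b\<bar> \<le> \<tau> * (a + b) + 8 / \<tau> * ((ent a + ent b) / 2 - ent ((a + b) / 2))"
    if ab: "0 \<le> b" "b \<le> a" for a b
  proof (cases "a = 0")
    case True
    then show ?thesis using ab by (simp add: ent_def)
  next
    case False
    define m where "m = (a + b) / 2"
    have m: "0 < m" "b \<le> m" and a: "0 < a" using ab False by (auto simp: m_def)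
    have ma: "a = 2 * m - b" unfolding m_def by (simp add: field_simps)
    have aln: "a * ln a = a * ln (a / m) + a * ln m" using a m by (simp add: ln_div algebra_simps)
    have bln: "b * ln b = b * ln (b / m) + b * ln m"
      using ab m by (cases "b = 0") (auto simp: ln_div algebra_simps)
    have "(ent a + ent b) / 2 - ent m = (a * ln a + b * ln b) / 2 - m * ln m"
      by (simp add: ent_def ma field_simps)
    also have "\<dots> = (a * ln (a / m) + b * ln (b / m)) / 2"
      unfolding aln bln by (simp add: ma field_simps)
    \<comment> \<open>The affine part of \<open>ent\<close> may be inserted because
      \<open>a / m + b / m = 2\<close>. This normalises the midpoint to 1.\<close>
    also have "\<dots> = m / 2 * (ent (a / m) + ent (b / m))"
      using m by (simp add: ent_def ma field_simps)
    finally have D: "(ent a + ent b) / 2 - ent m = m / 2 * (ent (a / m) + ent (b / m))" .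
    \<comment> \<open>Only the smaller point lies in the range of \<open>ent_ge_quadratic\<close>;
      the nonnegative contribution of \<open>a / m\<close> is dropped, which costs no more than a
      constant since \<open>a\<close> and \<open>b\<close> are symmetric about
      \<open>m\<close>.\<close>
    define u where "u = 1 - b / m"
    have u: "0 \<le> u" using m by (simp add: u_def)
    have "u\<^sup>2 / 4 \<le> ent (b / m)"
      unfolding u_def using ab m by (intro ent_ge_quadratic) auto
    moreover have "0 \<le> ent (a / m)" using a m by (intro ent_nonneg) auto
    ultimately have "m / 2 * (u\<^sup>2 / 4) \<le> (ent a + ent b) / 2 - ent m"
      unfolding D using m by (intro mult_left_mono) auto
    then have "8 / \<tau> * (m / 2 * (u\<^sup>2 / 4)) \<le> 8 / \<tau> * ((ent a + ent b) / 2 - ent m)"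
      using assms(3) by (intro mult_left_mono) auto
    moreover have "\<bar>a - b\<bar> = 2 * m * u" using m ab by (simp add: u_def ma field_simps)
    \<comment> \<open>The arithmetic-geometric mean inequality with weight \<tau>. The constant 8
      cancels the factor 1/2 from the perspective form and the 1/4 from the quadratic bound.\<close>
    moreover have "2 * m * u \<le> \<tau> * (a + b) + 8 / \<tau> * (m / 2 * (u\<^sup>2 / 4))"
    proof -
      have "0 \<le> (\<tau> - u)\<^sup>2" by simp
      then have "2 * u * \<tau> \<le> \<tau> * \<tau> + u\<^sup>2" by (simp add: power2_eq_square algebra_simps)
      then have "2 * u \<le> \<tau> + u\<^sup>2 / \<tau>" using assms(3) by (simp add: field_simps power2_eq_square)
      then have "m * (2 * u) \<le> m * (\<tau> + u\<^sup>2 / \<tau>)" using m by (intro mult_left_mono) auto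
      moreover have "m * \<tau> \<le> \<tau> * (a + b)" using assms(3) m by (simp add: ma)
      ultimately show ?thesis by (simp add: algebra_simps)
    qed
    ultimately show ?thesis unfolding m_def[symmetric] by linarith
  qed
  show ?thesis
  proof (cases "b \<le> a")
    case True then show ?thesis using * assms by blast
  next
    case False then show ?thesis using *[of a b] assms by (simp add: abs_minus_commute add.commute)
  qed
qed

text \<open>A negative gap would make the right side of \<open>ent_midpoint_gap\<close> negative for
  small \<tau>, although it bounds an absolute value.\<close>

lemma ent_midpoint_convex:
  assumes "0 \<le> a" "0 \<le> b"
  shows "ent ((a + b) / 2) \<le> (ent a + ent b) / 2"
proof (rule ccontr)
  define D where "D = ent ((a + b) / 2) - (ent a + ent b) / 2"
  define w where "w = a + b + 1"
  assume "\<not> ?thesis"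
  then have D: "0 < D" by (simp add: D_def)
  have w: "0 < w" using assms by (simp add: w_def)
  \<comment> \<open>Solves \<open>t^2 * w = 8 * D\<close>. The summand 1 in \<open>w\<close> keeps
    the quotient defined when \<open>a + b = 0\<close> and makes the contradiction strict.\<close>
  define t where "t = sqrt (8 * D / w)"
  have s: "0 < 8 * D / w" using D w by (intro divide_pos_pos) auto
  then have t: "0 < t" "t\<^sup>2 = 8 * D / w" by (auto simp: t_def)
  have "0 \<le> t * (a + b) + 8 / t * (- D)"
    using ent_midpoint_gap[OF assms t(1)] by (simp add: D_def)
  then have "0 \<le> t * (t * (a + b) + 8 / t * (- D))" using t by (intro mult_nonneg_nonneg) auto
  also have "\<dots> = t\<^sup>2 * (a + b) - 8 * D" using t(1) by (simp add: power2_eq_square algebra_simps)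
  also have "8 * D = t\<^sup>2 * w" unfolding t(2) using w by simp
  finally have "t\<^sup>2 \<le> 0" by (simp add: w_def algebra_simps)
  then show False using t(1) by simp
qed

text \<open>The definition subtracts a negative part from a positive part. Since \<open>f\<close>
  has integral 1, the extra terms \<open>- f + 1\<close> in \<open>ent f\<close> cancel, and the
  subtraction is legitimate because the negative part is finite.\<close>

lemma rel_entropy_density:
  assumes R: "prob_space R" and f[measurable]: "f \<in> borel_measurable R" and f0: "\<And>x. 0 \<le> f x"
    and P: "prob_space (density R (\<lambda>x. ennreal (f x)))"
  shows "rel_entropy (density R (\<lambda>x. ennreal (f x))) R = enn2ereal (\<integral>\<^sup>+x. ennreal (ent (f x)) \<partial>R)"
proof -
  interpret R: prob_space R by fact
  let ?P = "density R (\<lambda>x. ennreal (f x))"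
  have ac: "absolutely_continuous R ?P"
    by (rule absolutely_continuousI_density) simp
  have "AE x in R. ennreal (f x) = RN_deriv R ?P x"
    by (rule R.RN_deriv_unique) auto
  then have ed: "AE x in R. entropy_density (exp 1) R ?P x = ln (f x)"
  proof (rule eventually_mono)
    fix x assume a: "ennreal (f x) = RN_deriv R ?P x"
    show "entropy_density (exp 1) R ?P x = ln (f x)"
      unfolding entropy_density_def comp_def a[symmetric] using f0 by (simp add: log_def)
  qed
  define I where "I = (\<integral>\<^sup>+x. ennreal (ent (f x)) \<partial>R)"
  define N where "N = (\<integral>\<^sup>+x. ennreal (f x) * ennreal (- ln (f x)) \<partial>R)"
  define Q where "Q = (\<integral>\<^sup>+x. ennreal (f x) * ennreal (ln (f x)) \<partial>R)"
  have one: "(\<integral>\<^sup>+x. ennreal (f x) \<partial>R) = 1"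
    using prob_space.emeasure_space_1[OF P] by (simp add: emeasure_density cong: nn_integral_cong)
  \<comment> \<open>The pointwise identity behind the integral formula, written with sums only,
    because truncated subtraction in \<open>ennreal\<close> would not be additive.\<close>
  have id: "ennreal (ent t) + ennreal t + ennreal t * ennreal (- ln t) = ennreal t * ennreal (ln t) + 1"
    if "0 \<le> t" for t :: real
  proof (cases "0 \<le> ln t")
    case True
    then have "ennreal (- ln t) = 0" by (simp add: ennreal_neg)
    moreover have "ennreal (ent t) + ennreal t = ennreal (t * ln t) + ennreal 1"
      using that ent_nonneg[OF that] True by (subst (1 2) ennreal_plus[symmetric]) (auto simp: ent_def)
    moreover have "ennreal (t * ln t) = ennreal t * ennreal (ln t)" using that True by (rule ennreal_mult)
    ultimately show ?thesis by simp
  next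
    case False
    then have "ennreal (ln t) = 0" by (simp add: ennreal_neg)
    moreover have "ennreal (ent t) + ennreal t + ennreal (t * (- ln t)) = ennreal 1"
    proof -
      have "0 \<le> t * (- ln t)" using that False by (intro mult_nonneg_nonneg) auto
      then show ?thesis
        using that ent_nonneg[OF that] by (simp flip: ennreal_plus del: mult_minus_right add: ent_def)
    qed
    moreover have "ennreal (t * (- ln t)) = ennreal t * ennreal (- ln t)"
      using that False by (intro ennreal_mult) auto
    ultimately show ?thesis by simp
  qed
  \<comment> \<open>Where \<open>ln t\<close> is negative, the identity writes 1 as a sum of
    nonnegative terms containing \<open>t * (- ln t)\<close>. Finiteness of \<open>N\<close> is what
    rules out a difference of two infinities.\<close>
  have N1: "N \<le> 1"
  proof -
    have "ennreal t * ennreal (- ln t) \<le> 1" if "0 \<le> t" for t :: real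
    proof (cases "0 \<le> ln t")
      case False
      then have "ennreal (ln t) = 0" by (simp add: ennreal_neg)
      then have "ennreal (ent t) + ennreal t + ennreal t * ennreal (- ln t) = 1" using id[OF that] by simp
      moreover have "ennreal t * ennreal (- ln t) \<le> ennreal (ent t) + ennreal t + ennreal t * ennreal (- ln t)"
        by (rule add_increasing) auto
      ultimately show ?thesis by simp
    qed (simp add: ennreal_neg)
    then have "N \<le> (\<integral>\<^sup>+x. 1 \<partial>R)" unfolding N_def using f0 by (intro nn_integral_mono) auto
    then show ?thesis by (simp add: R.emeasure_space_1)
  qed
  have "I + 1 + N = Q + 1"
  proof -
    have "I + 1 + N = (\<integral>\<^sup>+x. ennreal (ent (f x)) + ennreal (f x) + ennreal (f x) * ennreal (- ln (f x)) \<partial>R)"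
    proof -
      have "(\<integral>\<^sup>+x. ennreal (ent (f x)) + ennreal (f x) + ennreal (f x) * ennreal (- ln (f x)) \<partial>R)
          = (\<integral>\<^sup>+x. ennreal (ent (f x)) + ennreal (f x) \<partial>R) + N"
        unfolding N_def by (rule nn_integral_add) auto
      also have "(\<integral>\<^sup>+x. ennreal (ent (f x)) + ennreal (f x) \<partial>R) = I + (\<integral>\<^sup>+x. ennreal (f x) \<partial>R)"
        unfolding I_def by (rule nn_integral_add) auto
      finally show ?thesis unfolding one by simp
    qed
    also have "\<dots> = (\<integral>\<^sup>+x. ennreal (f x) * ennreal (ln (f x)) + 1 \<partial>R)"
      using id f0 by (intro nn_integral_cong) auto
    also have "\<dots> = Q + 1"
      unfolding Q_def by (subst nn_integral_add) (auto simp: R.emeasure_space_1)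
    finally show ?thesis .
  qed
  then have "1 + (I + N) = 1 + Q" by (simp add: ac_simps)
  then have Q: "Q = I + N" by (simp add: ennreal_add_left_cancel)
  have em: "(\<lambda>x. ennreal (entropy_density (exp 1) R ?P x)) \<in> borel_measurable R"
    by (rule measurable_compose[OF measurable_entropy_density measurable_ennreal])
  have "(\<lambda>x. - entropy_density (exp 1) R ?P x) \<in> borel_measurable R"
    by (rule borel_measurable_uminus[OF measurable_entropy_density])
  then have em': "(\<lambda>x. ennreal (- entropy_density (exp 1) R ?P x)) \<in> borel_measurable R"
    by (rule measurable_compose[OF _ measurable_ennreal])
  have fm: "(\<lambda>x. ennreal (f x)) \<in> borel_measurable R" by simp
  have p1: "(\<integral>\<^sup>+x. ennreal (entropy_density (exp 1) R ?P x) \<partial>?P) = Q"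
  proof -
    have "(\<integral>\<^sup>+x. ennreal (entropy_density (exp 1) R ?P x) \<partial>?P)
        = (\<integral>\<^sup>+x. ennreal (f x) * ennreal (entropy_density (exp 1) R ?P x) \<partial>R)"
      by (rule nn_integral_density[OF fm em])
    also have "\<dots> = Q"
      unfolding Q_def by (rule nn_integral_cong_AE, use ed in eventually_elim) (simp only:)
    finally show ?thesis .
  qed
  have p2: "(\<integral>\<^sup>+x. ennreal (- entropy_density (exp 1) R ?P x) \<partial>?P) = N"
  proof -
    have "(\<integral>\<^sup>+x. ennreal (- entropy_density (exp 1) R ?P x) \<partial>?P)
        = (\<integral>\<^sup>+x. ennreal (f x) * ennreal (- entropy_density (exp 1) R ?P x) \<partial>R)"
      by (rule nn_integral_density[OF fm em'])
    also have "\<dots> = N"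
      unfolding N_def by (rule nn_integral_cong_AE, use ed in eventually_elim) (simp only:)
    finally show ?thesis .
  qed
  obtain n where n: "N = ennreal n" "0 \<le> n" using N1 by (cases N) (auto simp: top_unique)
  have "enn2ereal Q = enn2ereal I + ereal n"
    unfolding Q by (simp add: plus_ennreal.rep_eq n enn2ereal_ennreal)
  then have "enn2ereal Q - enn2ereal N = enn2ereal I"
    unfolding n(1) enn2ereal_ennreal[OF n(2)] by (cases "enn2ereal I") auto
  then show ?thesis
    unfolding rel_entropy_def p1 p2 using ac by (simp add: I_def)
qed

lemma absolutely_continuous_obtain_density:
  assumes R: "prob_space R" and P: "prob_space P" and S: "sets P = sets R"
    and ac: "absolutely_continuous R P"
  obtains f where "f \<in> borel_measurable R" "\<And>x. (0::real) \<le> f x" "P = density R (\<lambda>x. ennreal (f x))"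
proof -
  interpret R: prob_space R by fact
  interpret P: prob_space P by fact
  have fin: "AE x in R. RN_deriv R P x \<noteq> \<infinity>"
    by (rule R.RN_deriv_finite[OF _ ac S]) unfold_locales
  have "density R (\<lambda>x. ennreal (enn2real (RN_deriv R P x))) = density R (RN_deriv R P)"
    by (rule density_cong) (use fin in \<open>auto elim!: eventually_mono simp: top.not_eq_extremum\<close>)
  also have "\<dots> = P" by (rule R.density_RN_deriv[OF ac S])
  finally show ?thesis by (intro that[of "\<lambda>x. enn2real (RN_deriv R P x)"]) auto
qed

lemma rel_entropy_finite_obtain_density:
  assumes R: "prob_space R" and P: "prob_space P" and S: "sets P = sets R"
    and fin: "rel_entropy P R \<noteq> \<infinity>"
  obtains f where "f \<in> borel_measurable R" "\<And>x. (0::real) \<le> f x" "P = density R (\<lambda>x. ennreal (f x))"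
    "rel_entropy P R = enn2ereal (\<integral>\<^sup>+x. ennreal (ent (f x)) \<partial>R)"
proof -
  have "absolutely_continuous R P" using fin unfolding rel_entropy_def by presburger
  from absolutely_continuous_obtain_density[OF R P S this]
  obtain f where f: "f \<in> borel_measurable R" "\<And>x. (0::real) \<le> f x" "P = density R (\<lambda>x. ennreal (f x))"
    by blast
  show ?thesis using that[OF f] rel_entropy_density[OF R f(1,2)] P f(3) by simp
qed

lemma rel_entropy_nonneg:
  assumes "prob_space R" "prob_space P" "sets P = sets R"
  shows "0 \<le> rel_entropy P R"
proof (cases "rel_entropy P R = \<infinity>")
  case False
  from rel_entropy_finite_obtain_density[OF assms this] show ?thesis by (metis enn2ereal_nonneg)
qed simp

text \<open>The Donsker--Varadhan lower bound, with \<open>log (\<integral>exp \<psi> dR)\<close> replaced by its upper bound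
  \<open>(\<integral>exp \<psi> dR) - 1\<close>.\<close>

lemma rel_entropy_ge:
  assumes R: "prob_space R" and P: "prob_space P" and S: "sets P = sets R"
    and \<psi>[measurable]: "\<psi> \<in> borel_measurable R" and B: "\<And>x. \<bar>\<psi> x\<bar> \<le> B"
  shows "ereal ((\<integral>x. \<psi> x \<partial>P) - (\<integral>x. exp (\<psi> x) \<partial>R) + 1) \<le> rel_entropy P R"
proof (cases "rel_entropy P R = \<infinity>")
  case False
  interpret R: prob_space R by fact
  interpret P: prob_space P by fact
  obtain f where f[measurable]: "f \<in> borel_measurable R" and f0: "\<And>x. (0::real) \<le> f x"
    and Pf: "P = density R (\<lambda>x. ennreal (f x))"
    and H: "rel_entropy P R = enn2ereal (\<integral>\<^sup>+x. ennreal (ent (f x)) \<partial>R)"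
    using rel_entropy_finite_obtain_density[OF R P S False] by metis
  have \<psi>P: "integrable P \<psi>"
    using B S by (intro P.integrable_const_bound[of _ B]) (auto cong: measurable_cong_sets)
  then have i1: "integrable R (\<lambda>x. f x * \<psi> x)"
    unfolding Pf by (subst (asm) integrable_real_density) (use f0 in auto)
  have e1: "(\<integral>x. \<psi> x \<partial>P) = (\<integral>x. f x * \<psi> x \<partial>R)"
    unfolding Pf by (subst integral_real_density) (use f0 in auto)
  have i2: "integrable R (\<lambda>x. exp (\<psi> x))"
  proof (rule R.integrable_const_bound[of _ "exp B"])
    show "AE x in R. norm (exp (\<psi> x)) \<le> exp B"
      using B by (auto simp: abs_le_iff)
  qed simp
  \<comment> \<open>This is the left side of \<open>ent_ge_line\<close> at \<open>t = f x\<close>,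
    \<open>s = \<psi> x\<close>. Its positive part is still below \<open>ent (f x)\<close>, which
    allows the passage to a nonnegative integral.\<close>
  let ?g = "\<lambda>x. f x * \<psi> x - exp (\<psi> x) + 1"
  have ig: "integrable R ?g" using i1 i2 by auto
  have "(\<integral>x. \<psi> x \<partial>P) - (\<integral>x. exp (\<psi> x) \<partial>R) + 1 = (\<integral>x. ?g x \<partial>R)"
    unfolding e1 using i1 i2 by (simp add: R.prob_space)
  also have "\<dots> \<le> (\<integral>x. max 0 (?g x) \<partial>R)"
    using ig by (intro integral_mono) auto
  finally have "ennreal ((\<integral>x. \<psi> x \<partial>P) - (\<integral>x. exp (\<psi> x) \<partial>R) + 1) \<le> ennreal (\<integral>x. max 0 (?g x) \<partial>R)"
    by (rule ennreal_leI)
  also have "\<dots> = (\<integral>\<^sup>+x. ennreal (max 0 (?g x)) \<partial>R)"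
    using ig by (intro nn_integral_eq_integral[symmetric]) auto
  also have "\<dots> \<le> (\<integral>\<^sup>+x. ennreal (ent (f x)) \<partial>R)"
    using ent_ge_line[OF f0] ent_nonneg[OF f0]
    by (intro nn_integral_mono ennreal_leI) (auto simp: mult.commute)
  finally have "enn2ereal (ennreal ((\<integral>x. \<psi> x \<partial>P) - (\<integral>x. exp (\<psi> x) \<partial>R) + 1)) \<le> rel_entropy P R"
    unfolding H by (simp add: less_eq_ennreal.rep_eq)
  moreover have "ereal ((\<integral>x. \<psi> x \<partial>P) - (\<integral>x. exp (\<psi> x) \<partial>R) + 1)
      \<le> enn2ereal (ennreal ((\<integral>x. \<psi> x \<partial>P) - (\<integral>x. exp (\<psi> x) \<partial>R) + 1))"
    by (simp add: ennreal.rep_eq max_def)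
  ultimately show ?thesis by (rule order_trans[rotated])
qed simp

text \<open>Data processing inequality. A test function \<open>\<psi>\<close> on the image gives the
  test function \<open>\<psi>\<close> composed with \<open>T\<close> upstairs, so
  \<open>rel_entropy_ge\<close> transfers. The optimal choice is the logarithm of the image density;
  since it is unbounded it is truncated, and Fatou's lemma removes the truncation.\<close>

lemma rel_entropy_distr_le:
  assumes R: "prob_space R" and Q: "prob_space Q" and S: "sets Q = sets R"
    and T[measurable]: "T \<in> measurable R N"
  shows "rel_entropy (distr Q N T) (distr R N T) \<le> rel_entropy Q R"
proof (cases "rel_entropy Q R = \<infinity>")
  case False
  interpret R: prob_space R by fact
  interpret Q: prob_space Q by fact
  have TQ[measurable]: "T \<in> measurable Q N" using T S by (simp cong: measurable_cong_sets)
  let ?Q = "distr Q N T" and ?R = "distr R N T"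
  have pQ: "prob_space ?Q" and pR: "prob_space ?R"
    by (auto intro: Q.prob_space_distr R.prob_space_distr)
  interpret R': prob_space ?R by fact
  interpret Q': prob_space ?Q by fact
  have acQ: "absolutely_continuous R Q" using False unfolding rel_entropy_def by presburger
  have sp: "space Q = space R" using S by (rule sets_eq_imp_space_eq)
  have "absolutely_continuous ?R ?Q"
    unfolding absolutely_continuous_def
  proof
    fix A assume A: "A \<in> null_sets ?R"
    then have AN: "A \<in> sets N" by auto
    have "T -` A \<inter> space R \<in> null_sets R"
      using A AN by (auto simp: null_sets_def emeasure_distr)
    then have "T -` A \<inter> space R \<in> null_sets Q" using acQ by (auto simp: absolutely_continuous_def)
    then show "A \<in> null_sets ?Q" using AN sp by (auto simp: null_sets_def emeasure_distr)
  qed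
  from absolutely_continuous_obtain_density[OF pR pQ _ this]
  obtain g where g[measurable]: "g \<in> borel_measurable ?R" and g0: "\<And>x. (0::real) \<le> g x"
    and Qg: "?Q = density ?R (\<lambda>x. ennreal (g x))" by auto
  have gN[measurable]: "g \<in> borel_measurable N" using g by simp
  have H: "rel_entropy ?Q ?R = enn2ereal (\<integral>\<^sup>+x. ennreal (ent (g x)) \<partial>?R)"
    using rel_entropy_density[OF pR g g0] pQ unfolding Qg by simp
  \<comment> \<open>The logarithm of \<open>g\<close>, cut off at \<open>n\<close> and
    \<open>- n\<close>. At zeros of \<open>g\<close> the value has to be \<open>- n\<close>,
    standing for minus infinity: then the integrand below is \<open>1 - exp (- n)\<close>, which
    tends to \<open>ent 0 = 1\<close>.\<close>
  define \<psi> where "\<psi> n x = (if g x = 0 then - real n else max (- real n) (min (real n) (ln (g x))))" for n x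
  have \<psi>_m[measurable]: "\<psi> n \<in> borel_measurable N" for n
    unfolding \<psi>_def by measurable
  have \<psi>_b: "\<bar>\<psi> n x\<bar> \<le> real n" for n x by (auto simp: \<psi>_def)
  define t where "t n x = g x * \<psi> n x - exp (\<psi> n x) + 1" for n x
  \<comment> \<open>Needed for Fatou. Where the truncation is active, replacing \<open>g x\<close>
    by \<open>exp (\<psi> n x)\<close> only lowers the product with \<open>\<psi> n x\<close>, and
    what remains is \<open>ent (exp (\<psi> n x))\<close>.\<close>
  have t0: "0 \<le> t n x" for n x
  proof -
    have ent_exp: "ent (exp s) = exp s * s - exp s + 1" for s by (simp add: ent_def)
    consider "g x = 0" | "0 < g x" "ln (g x) < - real n" | "0 < g x" "real n < ln (g x)"
      | "0 < g x" "- real n \<le> ln (g x)" "ln (g x) \<le> real n" using g0[of x] by linarith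
    then show ?thesis
    proof cases
      case 1 then show ?thesis by (simp add: t_def \<psi>_def)
    next
      case 2
      then have p: "\<psi> n x = - real n" by (auto simp: \<psi>_def)
      have "exp (ln (g x)) \<le> exp (- real n)" using 2 by (subst exp_le_cancel_iff) simp
      then have "g x \<le> exp (- real n)" using 2 by simp
      then have "exp (- real n) * (- real n) \<le> g x * (- real n)"
        by (intro mult_right_mono_neg) auto
      then show ?thesis using ent_nonneg[OF exp_ge_zero, of "- real n"] unfolding t_def p ent_exp by linarith
    next
      case 3
      then have p: "\<psi> n x = real n" by (auto simp: \<psi>_def)
      have "exp (real n) \<le> exp (ln (g x))" using 3 by (subst exp_le_cancel_iff) simp
      then have "exp (real n) \<le> g x" using 3 by simp
      then have "exp (real n) * real n \<le> g x * real n" by (intro mult_right_mono) auto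
      then show ?thesis using ent_nonneg[OF exp_ge_zero, of "real n"] unfolding t_def p ent_exp by linarith
    next
      case 4
      then have p: "\<psi> n x = ln (g x)" by (auto simp: \<psi>_def)
      show ?thesis using ent_nonneg[OF g0, of x] 4 unfolding t_def p by (simp add: ent_def)
    qed
  qed
  have lim: "(\<lambda>n. ennreal (t n x)) \<longlonglongrightarrow> ennreal (ent (g x))" for x
  proof (rule tendsto_ennrealI, cases "g x = 0")
    case True
    have "(\<lambda>n. 1 - exp (- real n)) \<longlonglongrightarrow> 1" by real_asymp
    then show "(\<lambda>n. t n x) \<longlonglongrightarrow> ent (g x)" using True by (simp add: t_def \<psi>_def ent_def)
  next
    case False
    then have gp: "0 < g x" using g0[of x] by simp
    obtain k :: nat where k: "\<bar>ln (g x)\<bar> \<le> real k" using real_arch_simple by blast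
    show "(\<lambda>n. t n x) \<longlonglongrightarrow> ent (g x)"
    proof (rule tendsto_eventually, rule eventually_sequentiallyI[of k])
      fix n assume "k \<le> n"
      then have "\<bar>ln (g x)\<bar> \<le> real n" using k by linarith
      then have "\<psi> n x = ln (g x)" using False by (auto simp: \<psi>_def)
      then show "t n x = ent (g x)" using gp by (simp add: t_def ent_def)
    qed
  qed
  have bound: "enn2ereal (\<integral>\<^sup>+x. ennreal (t n x) \<partial>?R) \<le> rel_entropy Q R" for n
  proof -
    have ipsi: "integrable ?Q (\<psi> n)"
      using \<psi>_b by (intro Q'.integrable_const_bound[of _ "real n"]) auto
    have i1: "integrable ?R (\<lambda>x. g x * \<psi> n x)"
      using ipsi unfolding Qg by (subst (asm) integrable_real_density) (use g0 in auto)
    have i2: "integrable ?R (\<lambda>x. exp (\<psi> n x))"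
    proof (rule R'.integrable_const_bound[of _ "exp (real n)"])
      show "AE x in ?R. norm (exp (\<psi> n x)) \<le> exp (real n)"
        using \<psi>_b by (auto simp: abs_le_iff)
    qed simp
    have e1: "(\<integral>x. \<psi> n x \<partial>?Q) = (\<integral>x. g x * \<psi> n x \<partial>?R)"
      unfolding Qg by (subst integral_real_density) (use g0 in auto)
    have "(\<integral>\<^sup>+x. ennreal (t n x) \<partial>?R) = ennreal (\<integral>x. t n x \<partial>?R)"
      using i1 i2 t0 by (intro nn_integral_eq_integral) (auto simp: t_def)
    also have "(\<integral>x. t n x \<partial>?R) = (\<integral>x. \<psi> n x \<partial>?Q) - (\<integral>x. exp (\<psi> n x) \<partial>?R) + 1"
      unfolding e1 t_def using i1 i2 by (simp add: R'.prob_space[simplified])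
    also have "\<dots> = (\<integral>x. \<psi> n (T x) \<partial>Q) - (\<integral>x. exp (\<psi> n (T x)) \<partial>R) + 1"
      by (simp add: integral_distr)
    finally have e: "(\<integral>\<^sup>+x. ennreal (t n x) \<partial>?R) = ennreal ((\<integral>x. \<psi> n (T x) \<partial>Q) - (\<integral>x. exp (\<psi> n (T x)) \<partial>R) + 1)" .
    have "ereal ((\<integral>x. \<psi> n (T x) \<partial>Q) - (\<integral>x. exp (\<psi> n (T x)) \<partial>R) + 1) \<le> rel_entropy Q R"
      by (rule rel_entropy_ge[OF R Q S _ \<psi>_b]) simp
    then show ?thesis unfolding e
      using rel_entropy_nonneg[OF R Q S] by (simp add: ennreal.rep_eq max_def)
  qed
  have "(\<integral>\<^sup>+x. ennreal (ent (g x)) \<partial>?R) = (\<integral>\<^sup>+x. liminf (\<lambda>n. ennreal (t n x)) \<partial>?R)"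
    using lim by (intro nn_integral_cong) (metis lim_imp_Liminf sequentially_bot)
  also have "\<dots> \<le> liminf (\<lambda>n. \<integral>\<^sup>+x. ennreal (t n x) \<partial>?R)"
    by (rule nn_integral_liminf) (auto simp: t_def)
  also have "\<dots> \<le> e2ennreal (rel_entropy Q R)"
  proof (rule order_trans[OF Liminf_mono[where g="\<lambda>_. e2ennreal (rel_entropy Q R)"]])
    show "\<forall>\<^sub>F n in sequentially. (\<integral>\<^sup>+x. ennreal (t n x) \<partial>?R) \<le> e2ennreal (rel_entropy Q R)"
      using bound rel_entropy_nonneg[OF R Q S]
      by (intro always_eventually allI) (simp add: less_eq_ennreal.rep_eq enn2ereal_e2ennreal)
  qed (simp add: Liminf_const)
  finally show ?thesis
    unfolding H using rel_entropy_nonneg[OF R Q S] by (simp add: less_eq_ennreal.rep_eq enn2ereal_e2ennreal)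
qed simp

section \<open>Existence and uniqueness of entropy minimizers\<close>

lemma prob_density_integrable:
  assumes "prob_space (density R (\<lambda>x. ennreal (f x)))" "f \<in> borel_measurable R" "\<And>x. 0 \<le> f x"
  shows "integrable R f" "(\<integral>x. f x \<partial>R) = 1"
proof -
  have one: "(\<integral>\<^sup>+x. ennreal (f x) \<partial>R) = 1"
    using prob_space.emeasure_space_1[OF assms(1)] assms(2) by (simp add: emeasure_density cong: nn_integral_cong)
  show i: "integrable R f" using one assms by (intro integrableI_nonneg) auto
  have "ennreal (\<integral>x. f x \<partial>R) = 1" using nn_integral_eq_integral[OF i] one assms(3) by simp
  then show "(\<integral>x. f x \<partial>R) = 1" by simp
qed

lemma measure_density_real:
  fixes u :: "'b \<Rightarrow> real"
  assumes A: "A \<in> sets R" and u: "integrable R u" "\<And>x. 0 \<le> u x"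
  shows "measure (density R (\<lambda>x. ennreal (u x))) A = (\<integral>x. indicator A x * u x \<partial>R)"
proof -
  have [measurable]: "u \<in> borel_measurable R" "A \<in> sets R" using u A by auto
  have "emeasure (density R (\<lambda>x. ennreal (u x))) A = (\<integral>\<^sup>+x. ennreal (indicator A x * u x) \<partial>R)"
    by (subst emeasure_density) (auto intro!: nn_integral_cong simp: indicator_def)
  also have "\<dots> = ennreal (\<integral>x. indicator A x * u x \<partial>R)"
    using u integrable_mult_indicator[OF A u(1)] by (intro nn_integral_eq_integral) (auto simp: indicator_def)
  finally show ?thesis
    unfolding measure_def using u by (simp add: integral_nonneg_AE)
qed

text \<open>The integral of \<open>ent_midpoint_gap\<close>; the term with \<tau> integrates to
  \<open>2 * \<tau>\<close> because both densities have mass 1. With \<open>h\<close> the infimum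
  over a midpoint-convex class, it says that two near-minimizers are close in L1.\<close>

lemma density_L1_gap:
  assumes R: "prob_space R"
    and f[measurable]: "f \<in> borel_measurable R" and f0: "\<And>x. (0::real) \<le> f x"
    and g[measurable]: "g \<in> borel_measurable R" and g0: "\<And>x. (0::real) \<le> g x"
    and Pf: "prob_space (density R (\<lambda>x. ennreal (f x)))" and Pg: "prob_space (density R (\<lambda>x. ennreal (g x)))"
    and Pm: "prob_space (density R (\<lambda>x. ennreal ((f x + g x) / 2)))"
    and Hf: "rel_entropy (density R (\<lambda>x. ennreal (f x))) R \<le> ereal a"
    and Hg: "rel_entropy (density R (\<lambda>x. ennreal (g x))) R \<le> ereal b"
    and Hm: "ereal h \<le> rel_entropy (density R (\<lambda>x. ennreal ((f x + g x) / 2))) R"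
    and \<tau>: "0 < \<tau>"
  shows "integrable R (\<lambda>x. \<bar>f x - g x\<bar>)"
    "(\<integral>x. \<bar>f x - g x\<bar> \<partial>R) \<le> 2 * \<tau> + 8 / \<tau> * ((a + b) / 2 - h)"
proof -
  have ent_int: "integrable R (\<lambda>x. ent (f x)) \<and> (\<integral>x. ent (f x) \<partial>R) \<le> a"
    if [measurable]: "f \<in> borel_measurable R" and f0: "\<And>x. 0 \<le> f x"
      and Pf: "prob_space (density R (\<lambda>x. ennreal (f x)))"
      and Hf: "rel_entropy (density R (\<lambda>x. ennreal (f x))) R \<le> ereal a" for f a
  proof -
    have e: "enn2ereal (\<integral>\<^sup>+x. ennreal (ent (f x)) \<partial>R) \<le> ereal a"
      using Hf rel_entropy_density[OF R that(1) f0 Pf] by simp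
    then have "(\<integral>\<^sup>+x. ennreal (ent (f x)) \<partial>R) \<noteq> \<infinity>" by auto
    then have i: "integrable R (\<lambda>x. ent (f x))"
      using ent_nonneg[OF f0] by (intro integrableI_nonneg) (auto simp: top.not_eq_extremum)
    have "0 \<le> (\<integral>x. ent (f x) \<partial>R)" using ent_nonneg[OF f0] by (intro integral_nonneg_AE) auto
    then have "(\<integral>x. ent (f x) \<partial>R) \<le> a"
      using e unfolding nn_integral_eq_integral[OF i AE_I2[OF ent_nonneg[OF f0]]]
      by (simp add: enn2ereal_ennreal)
    with i show ?thesis by simp
  qed
  let ?m = "\<lambda>x. (f x + g x) / 2"
  have m0: "0 \<le> ?m x" for x using f0[of x] g0[of x] by simp
  note F = ent_int[OF f f0 Pf Hf] and G = ent_int[OF g g0 Pg Hg]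
  have im: "integrable R (\<lambda>x. ent (?m x))"
  proof (rule Bochner_Integration.integrable_bound)
    show "integrable R (\<lambda>x. (ent (f x) + ent (g x)) / 2)" using F G by auto
    show "AE x in R. norm (ent (?m x)) \<le> norm ((ent (f x) + ent (g x)) / 2)"
      using ent_midpoint_convex[OF f0 g0] ent_nonneg[OF m0] by (intro AE_I2) (smt (verit) real_norm_def)
  qed simp
  have h: "h \<le> (\<integral>x. ent (?m x) \<partial>R)"
  proof -
    have "0 \<le> (\<integral>x. ent (?m x) \<partial>R)" using ent_nonneg[OF m0] by (intro integral_nonneg_AE) auto
    then show ?thesis
      using Hm rel_entropy_density[OF R _ m0 Pm]
        nn_integral_eq_integral[OF im AE_I2[OF ent_nonneg[OF m0]]]
      by (simp add: enn2ereal_ennreal)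
  qed
  note If = prob_density_integrable[OF Pf f f0] and Ig = prob_density_integrable[OF Pg g g0]
  show i: "integrable R (\<lambda>x. \<bar>f x - g x\<bar>)" using If Ig by auto
  have "(\<integral>x. \<bar>f x - g x\<bar> \<partial>R)
      \<le> (\<integral>x. \<tau> * (f x + g x) + 8 / \<tau> * ((ent (f x) + ent (g x)) / 2 - ent (?m x)) \<partial>R)"
    using ent_midpoint_gap[OF f0 g0 \<tau>] i If Ig F G im by (intro integral_mono) auto
  also have "\<dots> = \<tau> * ((\<integral>x. f x \<partial>R) + (\<integral>x. g x \<partial>R)) + 8 / \<tau> * (((\<integral>x. ent (f x) \<partial>R) + (\<integral>x. ent (g x) \<partial>R)) / 2 - (\<integral>x. ent (?m x) \<partial>R))"
    using If(1) Ig(1) F G im by simp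
  also have "\<dots> \<le> \<tau> * 2 + 8 / \<tau> * ((a + b) / 2 - h)"
  proof (intro add_mono mult_left_mono)
    show "((\<integral>x. ent (f x) \<partial>R) + (\<integral>x. ent (g x) \<partial>R)) / 2 - (\<integral>x. ent (?m x) \<partial>R) \<le> (a + b) / 2 - h"
      using conjunct2[OF F] conjunct2[OF G] h by (simp add: field_simps)
  qed (use \<tau> If(2) Ig(2) in auto)
  finally show "(\<integral>x. \<bar>f x - g x\<bar> \<partial>R) \<le> 2 * \<tau> + 8 / \<tau> * ((a + b) / 2 - h)" by simp
qed

text \<open>The class enters only through midpoints and setwise limits of densities, two operations
  that linear constraints on the measures of sets respect. L1 closeness of near-minimizers gives
  both a limit density and uniqueness.\<close>

lemma rel_entropy_minimizer:
  fixes K :: "'a measure set"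
  assumes R: "prob_space R"
    and K: "\<And>P. P \<in> K \<Longrightarrow> prob_space P" "\<And>P. P \<in> K \<Longrightarrow> sets P = sets R"
    and mid: "\<And>f g. f \<in> borel_measurable R \<Longrightarrow> g \<in> borel_measurable R \<Longrightarrow> (\<And>x. (0::real) \<le> f x) \<Longrightarrow> (\<And>x. (0::real) \<le> g x)
      \<Longrightarrow> density R (\<lambda>x. ennreal (f x)) \<in> K \<Longrightarrow> density R (\<lambda>x. ennreal (g x)) \<in> K
      \<Longrightarrow> density R (\<lambda>x. ennreal ((f x + g x) / 2)) \<in> K"
    and closed: "\<And>f g. (\<And>n::nat. f n \<in> borel_measurable R) \<Longrightarrow> g \<in> borel_measurable R
      \<Longrightarrow> (\<And>n x. (0::real) \<le> f n x) \<Longrightarrow> (\<And>x. (0::real) \<le> g x) \<Longrightarrow> (\<And>n. density R (\<lambda>x. ennreal (f n x)) \<in> K)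
      \<Longrightarrow> (\<And>A. A \<in> sets R \<Longrightarrow> (\<lambda>n. measure (density R (\<lambda>x. ennreal (f n x))) A) \<longlonglongrightarrow> measure (density R (\<lambda>x. ennreal (g x))) A)
      \<Longrightarrow> prob_space (density R (\<lambda>x. ennreal (g x)))
      \<Longrightarrow> density R (\<lambda>x. ennreal (g x)) \<in> K"
    and fin: "(INF P\<in>K. rel_entropy P R) < \<infinity>"
  shows "\<exists>!P. P \<in> K \<and> rel_entropy P R = (INF P\<in>K. rel_entropy P R)"
proof -
  interpret R: prob_space R by fact
  define h where "h = (INF P\<in>K. rel_entropy P R)"
  have "0 \<le> h" unfolding h_def using rel_entropy_nonneg[OF R] K by (intro INF_greatest) auto
  then obtain hr where hr: "h = ereal hr" using fin unfolding h_def[symmetric] by (cases h) auto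
  have h_le: "ereal hr \<le> rel_entropy P R" if "P \<in> K" for P
    unfolding hr[symmetric] h_def using that by (rule INF_lower)
  have gap: "integrable R (\<lambda>x. \<bar>f x - g x\<bar>) \<and>
      (\<integral>x. \<bar>f x - g x\<bar> \<partial>R) \<le> 2 * \<tau> + 8 / \<tau> * ((a + b) / 2 - hr)"
    if f: "f \<in> borel_measurable R" "\<And>x. (0::real) \<le> f x" and g: "g \<in> borel_measurable R" "\<And>x. (0::real) \<le> g x"
      and Kf: "density R (\<lambda>x. ennreal (f x)) \<in> K" and Kg: "density R (\<lambda>x. ennreal (g x)) \<in> K"
      and H: "rel_entropy (density R (\<lambda>x. ennreal (f x))) R \<le> ereal a"
        "rel_entropy (density R (\<lambda>x. ennreal (g x))) R \<le> ereal b" and "0 < \<tau>" for f g a b \<tau>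
  proof -
    have m: "density R (\<lambda>x. ennreal ((f x + g x) / 2)) \<in> K" by (rule mid[OF f(1) g(1) f(2) g(2) Kf Kg])
    show ?thesis
      using density_L1_gap[OF R f g K(1)[OF Kf] K(1)[OF Kg] K(1)[OF m] H h_le[OF m] \<open>0 < \<tau>\<close>] by simp
  qed
  have dens: "\<exists>f. f \<in> borel_measurable R \<and> (\<forall>x. (0::real) \<le> f x) \<and> P = density R (\<lambda>x. ennreal (f x))"
    if P: "P \<in> K" and nf: "rel_entropy P R \<noteq> \<infinity>" for P
    by (rule rel_entropy_finite_obtain_density[OF R K(1)[OF P] K(2)[OF P] nf]) blast
  have unique: "P = Q" if P: "P \<in> K" "rel_entropy P R = h" and Q: "Q \<in> K" "rel_entropy Q R = h" for P Q
  proof -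
    obtain f where f: "f \<in> borel_measurable R" "\<And>x. (0::real) \<le> f x" "P = density R (\<lambda>x. ennreal (f x))"
      using dens[OF P(1)] P(2) hr by auto
    obtain g where g: "g \<in> borel_measurable R" "\<And>x. (0::real) \<le> g x" "Q = density R (\<lambda>x. ennreal (g x))"
      using dens[OF Q(1)] Q(2) hr by auto
    \<comment> \<open>For two exact minimizers the gap term vanishes, and \<tau> remains free to
      tend to 0.\<close>
    have G: "integrable R (\<lambda>x. \<bar>f x - g x\<bar>) \<and> (\<integral>x. \<bar>f x - g x\<bar> \<partial>R) \<le> 2 * \<tau>" if "0 < \<tau>" for \<tau>
    proof -
      have "rel_entropy (density R (\<lambda>x. ennreal (f x))) R \<le> ereal hr"
        "rel_entropy (density R (\<lambda>x. ennreal (g x))) R \<le> ereal hr"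
        using P(2) Q(2) hr unfolding f(3) g(3) by simp_all
      from gap[OF f(1,2) g(1,2) P(1)[unfolded f(3)] Q(1)[unfolded g(3)] this that] show ?thesis by simp
    qed
    have "(\<integral>x. \<bar>f x - g x\<bar> \<partial>R) \<le> 0"
    proof (rule field_le_epsilon)
      fix e :: real assume "0 < e"
      then show "(\<integral>x. \<bar>f x - g x\<bar> \<partial>R) \<le> 0 + e" using G[of "e / 2"] by simp
    qed
    moreover have "0 \<le> (\<integral>x. \<bar>f x - g x\<bar> \<partial>R)" by simp
    ultimately have "(\<integral>x. \<bar>f x - g x\<bar> \<partial>R) = 0" by simp
    then have "AE x in R. \<bar>f x - g x\<bar> = 0"
      using G[of 1] by (subst (asm) integral_nonneg_eq_0_iff_AE) auto
    then show ?thesis unfolding f(3) g(3) using f g by (intro density_cong) auto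
  qed
  \<comment> \<open>The excess \<open>(1/4)^n\<close> is matched with
    \<open>\<tau> = (1/2)^n\<close>: both terms of the gap estimate are then of order
    \<open>(1/2)^n\<close>, so the L1 increments are summable and the sequence converges almost
    everywhere without passing to a subsequence.\<close>
  have "\<exists>P\<in>K. rel_entropy P R < ereal (hr + (1/4)^n)" for n :: nat
    using INF_less_iff[of "\<lambda>P. rel_entropy P R" K "ereal (hr + (1/4)^n)"] unfolding h_def[symmetric] hr by simp
  then obtain P where P: "\<And>n. P n \<in> K" "\<And>n::nat. rel_entropy (P n) R < ereal (hr + (1/4)^n)" by metis
  have "\<exists>f. f \<in> borel_measurable R \<and> (\<forall>x. (0::real) \<le> f x) \<and> P n = density R (\<lambda>x. ennreal (f x))" for n
    by (rule dens[OF P(1)]) (use P(2)[of n] in auto)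
  then obtain f where f: "\<And>n. f n \<in> borel_measurable R" "\<And>n x. (0::real) \<le> f n x"
    and Pf: "\<And>n. P n = density R (\<lambda>x. ennreal (f n x))" by metis
  note [measurable] = f(1)
  have Kf: "density R (\<lambda>x. ennreal (f n x)) \<in> K" for n using P(1) Pf by metis
  have Hf: "rel_entropy (density R (\<lambda>x. ennreal (f n x))) R \<le> ereal (hr + (1/4)^n)" for n
    using P(2)[of n] unfolding Pf by simp
  define d where "d n x = f (Suc n) x - f n x" for n x
  have [measurable]: "d n \<in> borel_measurable R" for n unfolding d_def by measurable
  have D: "integrable R (\<lambda>x. norm (d n x))" "(\<integral>x. norm (d n x) \<partial>R) \<le> 10 * (1/2)^n" for n
  proof -
    let ?t = "(1/2)^n :: real"
    have G: "integrable R (\<lambda>x. \<bar>f (Suc n) x - f n x\<bar>) \<and> (\<integral>x. \<bar>f (Suc n) x - f n x\<bar> \<partial>R)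
        \<le> 2 * ?t + 8 / ?t * ((hr + (1/4)^Suc n + (hr + (1/4)^n)) / 2 - hr)"
      by (rule gap[OF f f Kf Kf Hf Hf]) simp
    have "8 / ?t * ((hr + (1/4)^Suc n + (hr + (1/4)^n)) / 2 - hr) \<le> 8 / ?t * (1/4)^n"
      by (intro mult_left_mono) (auto simp: field_simps)
    also have "\<dots> = 8 * ?t"
    proof -
      have "(1/4::real)^n = ?t * ?t" by (simp flip: power_mult_distrib)
      then show ?thesis by simp
    qed
    finally show "integrable R (\<lambda>x. norm (d n x))" "(\<integral>x. norm (d n x) \<partial>R) \<le> 10 * (1/2)^n"
      using G by (auto simp: d_def)
  qed
  have "(\<integral>\<^sup>+x. (\<Sum>n. ennreal (norm (d n x))) \<partial>R) = (\<Sum>n. \<integral>\<^sup>+x. ennreal (norm (d n x)) \<partial>R)"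
    by (rule nn_integral_suminf) simp
  also have "\<dots> = (\<Sum>n. ennreal (\<integral>x. norm (d n x) \<partial>R))"
    by (intro suminf_cong nn_integral_eq_integral D) auto
  also have "\<dots> \<le> (\<Sum>n. ennreal (10 * (1/2)^n))"
    by (intro suminf_le ennreal_leI D) auto
  also have "\<dots> < \<infinity>"
  proof -
    have "summable (\<lambda>n. 10 * (1/2::real)^n)" by (intro summable_mult summable_geometric) simp
    then show ?thesis by (simp add: suminf_ennreal2)
  qed
  finally have Wfin: "(\<integral>\<^sup>+x. (\<Sum>n. ennreal (norm (d n x))) \<partial>R) < \<infinity>" .
  then have "AE x in R. (\<Sum>n. ennreal (norm (d n x))) \<noteq> \<infinity>"
    by (intro nn_integral_noteq_infinite) auto
  then have sm: "AE x in R. summable (\<lambda>n. norm (d n x))"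
    by eventually_elim (rule summable_suminf_not_top, auto)
  \<comment> \<open>A common integrable majorant of all \<open>f n\<close>, obtained by
    telescoping.\<close>
  define w where "w x = f 0 x + (\<Sum>n. norm (d n x))" for x
  have Wi: "integrable R (\<lambda>x. \<Sum>n. norm (d n x))"
  proof (rule integrableI_nonneg)
    have "(\<integral>\<^sup>+x. ennreal (\<Sum>n. norm (d n x)) \<partial>R) = (\<integral>\<^sup>+x. (\<Sum>n. ennreal (norm (d n x))) \<partial>R)"
      using sm by (intro nn_integral_cong_AE) (auto elim!: eventually_mono simp: suminf_ennreal2)
    then show "(\<integral>\<^sup>+x. ennreal (\<Sum>n. norm (d n x)) \<partial>R) < \<infinity>" using Wfin by simp
    show "AE x in R. 0 \<le> (\<Sum>n. norm (d n x))" using sm by (auto elim!: eventually_mono intro!: suminf_nonneg)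
  qed simp
  have wi: "integrable R w"
    unfolding w_def using Wi prob_density_integrable(1)[OF K(1)[OF Kf[of 0]] f] by auto
  \<comment> \<open>The maximum with 0 gives a nonnegative representative everywhere; off the
    convergence set \<open>lim\<close> is arbitrary.\<close>
  define g where "g x = max 0 (lim (\<lambda>n. f n x))" for x
  have [measurable]: "g \<in> borel_measurable R" unfolding g_def by measurable
  have g0: "0 \<le> g x" for x by (simp add: g_def)
  have fsum: "f n x = f 0 x + (\<Sum>i<n. d i x)" for n x
    by (induction n) (auto simp: d_def)
  have conv: "AE x in R. (\<lambda>n. f n x) \<longlonglongrightarrow> g x" and dom: "AE x in R. \<forall>n. norm (f n x) \<le> w x"
  proof -
    show "AE x in R. (\<lambda>n. f n x) \<longlonglongrightarrow> g x" using sm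
    proof eventually_elim
      fix x assume "summable (\<lambda>n. norm (d n x))"
      then have "summable (\<lambda>n. d n x)" by (rule summable_norm_cancel)
      then have "(\<lambda>n. f 0 x + (\<Sum>i<n. d i x)) \<longlonglongrightarrow> f 0 x + (\<Sum>n. d n x)"
        by (intro tendsto_intros summable_LIMSEQ)
      then have l: "(\<lambda>n. f n x) \<longlonglongrightarrow> f 0 x + (\<Sum>n. d n x)" by (simp flip: fsum)
      then have "0 \<le> f 0 x + (\<Sum>n. d n x)" by (rule LIMSEQ_le_const) (use f in auto)
      then show "(\<lambda>n. f n x) \<longlonglongrightarrow> g x" using l limI[OF l] by (simp add: g_def)
    qed
    show "AE x in R. \<forall>n. norm (f n x) \<le> w x" using sm
    proof eventually_elim
      fix x assume s: "summable (\<lambda>n. norm (d n x))"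
      show "\<forall>n. norm (f n x) \<le> w x"
      proof
        fix n
        have "norm (f n x) \<le> norm (f 0 x) + norm (\<Sum>i<n. d i x)"
          by (subst fsum) (rule norm_triangle_ineq)
        also have "norm (\<Sum>i<n. d i x) \<le> (\<Sum>i<n. norm (d i x))" by (rule norm_sum)
        also have "\<dots> \<le> (\<Sum>n. norm (d n x))" using s by (intro sum_le_suminf) auto
        finally show "norm (f n x) \<le> w x" using f(2) by (simp add: w_def)
      qed
    qed
  qed
  have gi: "integrable R g"
    by (rule integrable_dominated_convergence[OF _ _ wi conv]) (use dom in \<open>auto elim: eventually_mono\<close>)
  have fi: "integrable R (f n)" for n
    by (rule prob_density_integrable(1)[OF K(1)[OF Kf] f])
  have lim: "(\<lambda>n. measure (density R (\<lambda>x. ennreal (f n x))) A) \<longlonglongrightarrow> measure (density R (\<lambda>x. ennreal (g x))) A"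
    if A[measurable]: "A \<in> sets R" for A
    unfolding measure_density_real[OF A fi f(2)] measure_density_real[OF A gi g0]
  proof (rule integral_dominated_convergence[OF _ _ wi])
    show "AE x in R. (\<lambda>n. indicator A x * f n x) \<longlonglongrightarrow> indicator A x * g x"
      using conv by eventually_elim (intro tendsto_intros)
    show "AE x in R. norm (indicator A x * f n x) \<le> w x" for n
      using dom
    proof eventually_elim
      fix x assume *: "\<forall>n. norm (f n x) \<le> w x"
      have "norm (indicator A x * f n x) \<le> norm (f n x)" by (simp add: indicator_def)
      then show "norm (indicator A x * f n x) \<le> w x" using * order_trans by blast
    qed
  qed auto
  have pg: "prob_space (density R (\<lambda>x. ennreal (g x)))"
  proof (rule prob_spaceI)
    have "measure (density R (\<lambda>x. ennreal (g x))) (space R) = 1"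
    proof (rule LIMSEQ_unique[OF lim])
      have "measure (density R (\<lambda>x. ennreal (f n x))) (space R) = 1" for n
        using prob_space.prob_space[OF K(1)[OF Kf[of n]]] by simp
      then show "(\<lambda>n. measure (density R (\<lambda>x. ennreal (f n x))) (space R)) \<longlonglongrightarrow> 1" by simp
    qed simp
    then show "emeasure (density R (\<lambda>x. ennreal (g x))) (space (density R (\<lambda>x. ennreal (g x)))) = 1"
      by (cases "emeasure (density R (\<lambda>x. ennreal (g x))) (space R)") (auto simp: measure_def)
  qed
  have gK: "density R (\<lambda>x. ennreal (g x)) \<in> K"
    by (rule closed[OF f(1) _ f(2) g0 Kf lim pg]) auto
  \<comment> \<open>Lower semicontinuity of the entropy along the sequence: Fatou's lemma, using
    that \<open>ent\<close> is nonnegative and continuous up to 0.\<close>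
  have "rel_entropy (density R (\<lambda>x. ennreal (g x))) R \<le> ereal hr"
  proof -
    have "(\<integral>\<^sup>+x. ennreal (ent (g x)) \<partial>R) = (\<integral>\<^sup>+x. liminf (\<lambda>n. ennreal (ent (f n x))) \<partial>R)"
    proof (rule nn_integral_cong_AE, use conv in eventually_elim)
      fix x assume "(\<lambda>n. f n x) \<longlonglongrightarrow> g x"
      then have "(\<lambda>n. ent (f n x)) \<longlonglongrightarrow> ent (g x)"
        by (intro continuous_on_tendsto_compose[OF continuous_on_ent]) (use f(2) g0 in auto)
      then have "(\<lambda>n. ennreal (ent (f n x))) \<longlonglongrightarrow> ennreal (ent (g x))" by (rule tendsto_ennrealI)
      then show "ennreal (ent (g x)) = liminf (\<lambda>n. ennreal (ent (f n x)))"
        by (metis lim_imp_Liminf sequentially_bot)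
    qed
    also have "\<dots> \<le> liminf (\<lambda>n. \<integral>\<^sup>+x. ennreal (ent (f n x)) \<partial>R)"
      by (rule nn_integral_liminf) simp
    also have "\<dots> \<le> liminf (\<lambda>n. ennreal (hr + (1/4)^n))"
    proof (rule Liminf_mono, rule always_eventually, rule allI)
      fix n
      have "enn2ereal (\<integral>\<^sup>+x. ennreal (ent (f n x)) \<partial>R) \<le> ereal (hr + (1/4)^n)"
        using Hf[of n] rel_entropy_density[OF R f K(1)[OF Kf]] by simp
      also have "\<dots> \<le> enn2ereal (ennreal (hr + (1/4)^n))" by (simp add: ennreal.rep_eq max_def)
      finally show "(\<integral>\<^sup>+x. ennreal (ent (f n x)) \<partial>R) \<le> ennreal (hr + (1/4)^n)"
        by (simp add: less_eq_ennreal.rep_eq)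
    qed
    also have "\<dots> = ennreal hr"
    proof (rule lim_imp_Liminf)
      have "(\<lambda>n. hr + (1/4)^n) \<longlonglongrightarrow> hr + 0" by (intro tendsto_intros LIMSEQ_realpow_zero) auto
      then show "(\<lambda>n. ennreal (hr + (1/4)^n)) \<longlonglongrightarrow> ennreal hr" by (intro tendsto_ennrealI) simp
    qed simp
    finally have "enn2ereal (\<integral>\<^sup>+x. ennreal (ent (g x)) \<partial>R) \<le> enn2ereal (ennreal hr)"
      by (simp add: less_eq_ennreal.rep_eq)
    then show ?thesis
      using rel_entropy_density[OF R _ g0 pg] \<open>0 \<le> h\<close> hr by (simp add: enn2ereal_ennreal)
  qed
  then have "rel_entropy (density R (\<lambda>x. ennreal (g x))) R = h"
    using h_le[OF gK] hr by simp
  then show ?thesis unfolding h_def[symmetric] using gK unique by blast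
qed

section \<open>Narrow convergence and lower semicontinuity\<close>

text \<open>The approximants are the infimal convolutions of \<open>min n g\<close> with
  \<open>n\<close> times the distance (Pasch-Hausdorff envelopes). The cut-off at \<open>n\<close>
  makes them real-valued and bounded even where \<open>g\<close> is infinite; the slope
  \<open>n\<close> supplies the Lipschitz constant.\<close>

lemma lower_semicontinuous_Lipschitz_approx:
  fixes g :: "'b::metric_space \<Rightarrow> ennreal"
  assumes g: "lower_semicontinuous g"
  obtains \<phi> :: "nat \<Rightarrow> 'b \<Rightarrow> real"
  where "\<And>n x. 0 \<le> \<phi> n x" "\<And>n x. \<phi> n x \<le> real n" "\<And>n. (real n)-lipschitz_on UNIV (\<phi> n)"
    and "\<And>x. incseq (\<lambda>n. \<phi> n x)" "\<And>x. (SUP n. ennreal (\<phi> n x)) = g x"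
proof -
  define h where "h n y = enn2real (min (of_nat n) (g y))" for n y
  define \<phi> where "\<phi> n x = (INF y. h n y + real n * dist x y)" for n x
  have h_eq: "ennreal (h n y) = min (of_nat n) (g y)" for n y
    unfolding h_def by (intro ennreal_enn2real) (auto simp: min_less_iff_disj ennreal_of_nat_eq_real_of_nat)
  have h0: "0 \<le> h n y" for n y
    by (simp add: h_def)
  have hn: "h n y \<le> real n" for n y
  proof -
    have "ennreal (h n y) \<le> ennreal (real n)"
      unfolding h_eq by (simp add: ennreal_of_nat_eq_real_of_nat)
    then show ?thesis by (simp add: ennreal_le_iff)
  qed
  have bdd: "bdd_below (range (\<lambda>y. h n y + real n * dist x y))" for n x
    using h0 by (intro bdd_belowI[of _ 0]) auto
  have \<phi>_le: "\<phi> n x \<le> h n y + real n * dist x y" for n x y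
    unfolding \<phi>_def by (rule cINF_lower[OF bdd]) simp
  have \<phi>_ge: "(\<And>y. a \<le> h n y + real n * dist x y) \<Longrightarrow> a \<le> \<phi> n x" for a n x
    unfolding \<phi>_def by (rule cINF_greatest) auto
  have \<phi>_h: "\<phi> n x \<le> h n x" for n x
    using \<phi>_le[of n x x] by simp
  have 1: "0 \<le> \<phi> n x" for n x
    using h0 by (intro \<phi>_ge) auto
  have 2: "\<phi> n x \<le> real n" for n x
    using \<phi>_h[of n x] hn[of n x] by simp
  have lip: "\<phi> n x \<le> \<phi> n z + real n * dist x z" for n x z
  proof -
    have "\<phi> n x - real n * dist x z \<le> h n y + real n * dist z y" for y
    proof -
      have "real n * dist x y \<le> real n * (dist x z + dist z y)"
        by (intro mult_left_mono dist_triangle) auto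
      then show ?thesis using \<phi>_le[of n x y] by (simp add: algebra_simps)
    qed
    from \<phi>_ge[OF this] show ?thesis by simp
  qed
  have 3: "(real n)-lipschitz_on UNIV (\<phi> n)" for n
  proof (rule lipschitz_onI)
    fix x y
    show "dist (\<phi> n x) (\<phi> n y) \<le> real n * dist x y"
      using lip[of n x y] lip[of n y x] by (simp add: dist_real_def abs_le_iff dist_commute)
  qed simp
  have hmono: "h m y \<le> h n y" if "m \<le> n" for m n y
  proof -
    have "(of_nat m :: ennreal) \<le> of_nat n" using that by simp
    then have "min (of_nat m) (g y) \<le> min (of_nat n) (g y)"
      by (rule min.mono) simp
    then have "ennreal (h m y) \<le> ennreal (h n y)" unfolding h_eq .
    then show ?thesis using h0 by (simp add: ennreal_le_iff)
  qed
  have 4: "incseq (\<lambda>n. \<phi> n x)" for x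
  proof (rule incseq_SucI, rule \<phi>_ge)
    fix n y
    have "real n * dist x y \<le> real (Suc n) * dist x y" by (intro mult_right_mono) auto
    then show "\<phi> n x \<le> h (Suc n) y + real (Suc n) * dist x y"
      using \<phi>_le[of n x y] hmono[of n "Suc n" y] by linarith
  qed
  have 5: "(SUP n. ennreal (\<phi> n x)) = g x" for x
  proof (rule antisym)
    show "(SUP n. ennreal (\<phi> n x)) \<le> g x"
    proof (rule SUP_least)
      fix n
      have "ennreal (\<phi> n x) \<le> ennreal (h n x)" by (intro ennreal_leI \<phi>_h)
      also have "\<dots> \<le> g x" unfolding h_eq by simp
      finally show "ennreal (\<phi> n x) \<le> g x" .
    qed
    show "g x \<le> (SUP n. ennreal (\<phi> n x))"
    proof (rule dense_le)
      fix a assume a: "a < g x"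
      then have afin: "a < top" using top.not_eq_extremum by fastforce
      then obtain r where r: "a = ennreal r" "0 \<le> r" by (cases a) auto
      have "open {y. a < g y}"
        using g unfolding lower_semicontinuous_def closed_def by (auto simp: Compl_eq not_le)
      then obtain e where e: "e > 0" "ball x e \<subseteq> {y. a < g y}"
        using a open_contains_ball by blast
      \<comment> \<open>The first condition handles points within \<open>e\<close> of
        \<open>x\<close>, where only the cut-off could push \<open>h n\<close> below
        \<open>r\<close>; the second makes the distance penalty alone reach \<open>r\<close> outside
        this ball.\<close>
      obtain n :: nat where n: "real n \<ge> r" "real n * e \<ge> r"
      proof -
        obtain n :: nat where "real n \<ge> max r (r / e)" using real_arch_simple by blast
        then have "real n \<ge> r" "real n \<ge> r / e" by auto
        then show ?thesis using that e by (auto simp: field_simps)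
      qed
      have "r \<le> \<phi> n x"
      proof (rule \<phi>_ge)
        fix y
        show "r \<le> h n y + real n * dist x y"
        proof (cases "dist x y < e")
          case True
          then have "a < g y" using e(2) by auto
          then have "a \<le> g y" by simp
          moreover have "a \<le> of_nat n" using n(1) by (simp add: r ennreal_of_nat_eq_real_of_nat ennreal_leI)
          ultimately have "ennreal r \<le> ennreal (h n y)" unfolding h_eq r by simp
          then have "r \<le> h n y" using h0 by (simp add: ennreal_le_iff)
          then show ?thesis by (smt (verit) mult_nonneg_nonneg of_nat_0_le_iff zero_le_dist)
        next
          case False
          then have "real n * e \<le> real n * dist x y" by (intro mult_left_mono) auto
          then show ?thesis using n(2) h0[of n y] by linarith
        qed
      qed
      then show "a \<le> (SUP n. ennreal (\<phi> n x))"
        unfolding r by (intro SUP_upper2[of n]) (auto intro: ennreal_leI)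
    qed
  qed
  show ?thesis by (rule that[OF 1 2 3 4 5])
qed

lemma lipschitz_on_borel_measurable:
  fixes f :: "'b::metric_space \<Rightarrow> real"
  assumes "L-lipschitz_on UNIV f"
  shows "f \<in> borel_measurable borel"
  using lipschitz_on_continuous_on[OF assms] by (rule borel_measurable_continuous_onI)

lemma borel_measurable_lower_semicontinuous:
  fixes g :: "'b::topological_space \<Rightarrow> ennreal"
  assumes "lower_semicontinuous g"
  shows "g \<in> borel_measurable borel"
proof (rule borel_measurableI_le)
  fix a
  show "{x \<in> space borel. g x \<le> a} \<in> sets borel"
    using assms unfolding lower_semicontinuous_def by (simp add: borel_closed)
qed

lemma prob_measuresD:
  assumes "\<mu> \<in> prob_measures"
  shows "prob_space \<mu>" "sets \<mu> = sets borel" "space \<mu> = UNIV"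
  using assms by (auto simp: space_prob_algebra dest: sets_eq_imp_space_eq)

lemma prob_measuresI: "prob_space \<mu> \<Longrightarrow> sets \<mu> = sets borel \<Longrightarrow> \<mu> \<in> prob_measures"
  by (simp add: space_prob_algebra)

lemma integrable_bounded_prob:
  fixes f :: "'b::topological_space \<Rightarrow> real"
  assumes "\<mu> \<in> prob_measures" "f \<in> borel_measurable borel" "\<And>x. \<bar>f x\<bar> \<le> B"
  shows "integrable \<mu> f"
proof -
  interpret prob_space \<mu> using assms prob_measuresD by blast
  have "f \<in> borel_measurable \<mu>" using assms(1,2) prob_measuresD(2) measurable_cong_sets by blast
  then show ?thesis using assms(3) by (intro integrable_const_bound[of _ B]) auto
qed

text \<open>Narrow convergence tested on bounded Lipschitz functions only. Coding and resampling
  give explicit error bounds for such functions; \<open>lipschitz_tendsto_continuous\<close>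
  recovers all bounded continuous ones.\<close>

definition lipschitz_tendsto :: "(nat \<Rightarrow> 'b::metric_space measure) \<Rightarrow> 'b measure \<Rightarrow> bool"
  where "lipschitz_tendsto M \<mu> \<longleftrightarrow> (\<forall>f :: 'b \<Rightarrow> real. \<forall>L. L-lipschitz_on UNIV f \<longrightarrow> bounded (range f) \<longrightarrow>
    (\<lambda>n. \<integral>x. f x \<partial>M n) \<longlonglongrightarrow> (\<integral>x. f x \<partial>\<mu>))"

text \<open>Portmanteau inequality. By monotone convergence one bounded Lipschitz minorant of
  \<open>g\<close> already has \<mu>-integral above \<open>a\<close>, and the convergence applies to
  it.\<close>

lemma lsc_nn_integral_lower:
  fixes g :: "'b::metric_space \<Rightarrow> ennreal"
  assumes g: "lower_semicontinuous g"
    and M: "\<And>n. M n \<in> prob_measures" and \<mu>: "\<mu> \<in> prob_measures"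
    and conv: "lipschitz_tendsto M \<mu>"
    and a: "a < (\<integral>\<^sup>+x. g x \<partial>\<mu>)"
  shows "\<forall>\<^sub>F n in sequentially. a < (\<integral>\<^sup>+x. g x \<partial>M n)"
proof -
  obtain \<phi> :: "nat \<Rightarrow> 'b \<Rightarrow> real" where \<phi>: "\<And>n x. 0 \<le> \<phi> n x" "\<And>n x. \<phi> n x \<le> real n"
    "\<And>n. (real n)-lipschitz_on UNIV (\<phi> n)"
    "\<And>x. incseq (\<lambda>n. \<phi> n x)" "\<And>x. (SUP n. ennreal (\<phi> n x)) = g x"
    using lower_semicontinuous_Lipschitz_approx[OF g] by metis
  have meas: "\<phi> n \<in> borel_measurable borel" for n
    using \<phi>(3) by (rule lipschitz_on_borel_measurable)
  have bd: "\<bar>\<phi> n x\<bar> \<le> real n" for n x using \<phi>(1,2)[of n x] by simp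
  have int: "(\<integral>\<^sup>+x. ennreal (\<phi> n x) \<partial>\<nu>) = ennreal (\<integral>x. \<phi> n x \<partial>\<nu>)" if "\<nu> \<in> prob_measures" for n \<nu>
    using \<phi>(1) by (intro nn_integral_eq_integral integrable_bounded_prob[OF that meas bd]) auto
  have "(\<integral>\<^sup>+x. g x \<partial>\<mu>) = (\<integral>\<^sup>+x. (SUP n. ennreal (\<phi> n x)) \<partial>\<mu>)"
    by (simp add: \<phi>)
  also have "\<dots> = (SUP n. \<integral>\<^sup>+x. ennreal (\<phi> n x) \<partial>\<mu>)"
  proof (rule nn_integral_monotone_convergence_SUP)
    show "incseq (\<lambda>i x. ennreal (\<phi> i x))"
      using \<phi>(4) by (auto simp: incseq_def le_fun_def intro!: ennreal_leI)
    show "\<And>i. (\<lambda>x. ennreal (\<phi> i x)) \<in> borel_measurable \<mu>"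
      using meas prob_measuresD(2)[OF \<mu>] by (simp cong: measurable_cong_sets)
  qed
  finally obtain n where n: "a < (\<integral>\<^sup>+x. ennreal (\<phi> n x) \<partial>\<mu>)"
    using a by (auto simp: less_SUP_iff)
  have "bounded (range (\<phi> n))" using bd by (auto simp: bounded_iff)
  then have "(\<lambda>k. \<integral>x. \<phi> n x \<partial>M k) \<longlonglongrightarrow> (\<integral>x. \<phi> n x \<partial>\<mu>)"
    using conv \<phi>(3) unfolding lipschitz_tendsto_def by blast
  then have "(\<lambda>k. ennreal (\<integral>x. \<phi> n x \<partial>M k)) \<longlonglongrightarrow> ennreal (\<integral>x. \<phi> n x \<partial>\<mu>)"
    by (rule tendsto_ennrealI)
  then have "\<forall>\<^sub>F k in sequentially. a < ennreal (\<integral>x. \<phi> n x \<partial>M k)"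
    using n unfolding int[OF \<mu>] by (rule order_tendstoD)
  then show ?thesis
  proof (rule eventually_mono)
    fix k assume "a < ennreal (\<integral>x. \<phi> n x \<partial>M k)"
    also have "\<dots> = (\<integral>\<^sup>+x. ennreal (\<phi> n x) \<partial>M k)" by (rule int[OF M, symmetric])
    also have "\<dots> \<le> (\<integral>\<^sup>+x. g x \<partial>M k)"
      unfolding \<phi>(5)[symmetric] by (intro nn_integral_mono SUP_upper) auto
    finally show "a < (\<integral>\<^sup>+x. g x \<partial>M k)" .
  qed
qed

lemma lower_semicontinuous_continuous:
  fixes f :: "'b::topological_space \<Rightarrow> real"
  assumes "continuous_on UNIV f"
  shows "lower_semicontinuous (\<lambda>x. ennreal (f x))"
  unfolding lower_semicontinuous_def
proof
  fix a :: ennreal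
  show "closed {x. ennreal (f x) \<le> a}"
    by (intro closed_Collect_le continuous_intros continuous_on_ennreal assms)
qed

lemma lower_semicontinuous_indicator:
  assumes "open U"
  shows "lower_semicontinuous (indicator U :: 'b::topological_space \<Rightarrow> ennreal)"
  unfolding lower_semicontinuous_def
proof
  fix a :: ennreal
  have "{x. indicator U x \<le> a} = (if a \<ge> 1 then UNIV else - U)"
    by (auto simp: indicator_def)
  then show "closed {x. indicator U x \<le> a}" using assms by (auto simp: closed_def)
qed

lemma open_emeasure_lower:
  assumes "open (U :: 'b::metric_space set)"
    and M: "\<And>n. M n \<in> prob_measures" and \<mu>: "\<mu> \<in> prob_measures"
    and conv: "lipschitz_tendsto M \<mu>" and a: "a < emeasure \<mu> U"
  shows "\<forall>\<^sub>F n in sequentially. a < emeasure (M n) U"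
proof -
  have U: "U \<in> sets \<nu>" if "\<nu> \<in> prob_measures" for \<nu> :: "'b measure"
    using assms(1) prob_measuresD(2)[OF that] by simp
  have "a < (\<integral>\<^sup>+x. indicator U x \<partial>\<mu>)" using a U[OF \<mu>] by simp
  from lsc_nn_integral_lower[OF lower_semicontinuous_indicator[OF assms(1)] M \<mu> conv this]
  show ?thesis using U[OF M] by simp
qed

text \<open>The portmanteau inequality for constant sequences, used in both directions, identifies
  the masses of open sets, and these form a generating intersection-stable family.\<close>

lemma prob_measures_eqI:
  fixes \<mu> \<nu> :: "'b::metric_space measure"
  assumes \<mu>: "\<mu> \<in> prob_measures" and \<nu>: "\<nu> \<in> prob_measures"
    and eq: "\<And>f :: 'b \<Rightarrow> real. continuous_on UNIV f \<Longrightarrow> bounded (range f) \<Longrightarrow> (\<integral>x. f x \<partial>\<mu>) = (\<integral>x. f x \<partial>\<nu>)"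
  shows "\<mu> = \<nu>"
proof -
  have 1: "lipschitz_tendsto (\<lambda>_. \<mu>') \<nu>'"
    if "\<And>f :: 'b \<Rightarrow> real. continuous_on UNIV f \<Longrightarrow> bounded (range f) \<Longrightarrow> (\<integral>x. f x \<partial>\<mu>') = (\<integral>x. f x \<partial>\<nu>')"
    for \<mu>' \<nu>' :: "'b measure"
    unfolding lipschitz_tendsto_def using that lipschitz_on_continuous_on by fastforce
  have 2: "emeasure \<nu>' U \<le> emeasure \<mu>' U"
    if "\<mu>' \<in> prob_measures" "\<nu>' \<in> prob_measures" "open U"
      "lipschitz_tendsto (\<lambda>_. \<mu>') \<nu>'" for \<mu>' \<nu>' and U :: "'b set"
  proof (rule dense_le)
    fix a assume "a < emeasure \<nu>' U"
    from open_emeasure_lower[OF that(3) that(1) that(2) that(4) this]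
    show "a \<le> emeasure \<mu>' U" by (simp add: less_imp_le)
  qed
  have eqU: "emeasure \<mu> U = emeasure \<nu> U" if "open U" for U
    using 2[OF \<mu> \<nu> that 1[OF eq]] 2[OF \<nu> \<mu> that 1[OF eq[symmetric]]] by (simp add: antisym)
  have fin: "emeasure \<mu> UNIV \<noteq> \<infinity>"
    using prob_measuresD(1,3)[OF \<mu>] prob_space.emeasure_space_1 by fastforce
  show ?thesis
  proof (rule measure_eqI_generator_eq[where E="{S. open S}" and \<Omega>=UNIV and A="\<lambda>_. UNIV"])
    show "Int_stable {S :: 'b set. open S}" by (auto simp: Int_stable_def)
    show "sets \<mu> = sigma_sets UNIV {S. open S}" "sets \<nu> = sigma_sets UNIV {S. open S}"
      using prob_measuresD[OF \<mu>] prob_measuresD[OF \<nu>] by (auto simp: borel_def)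
  qed (use eqU fin in auto)
qed

text \<open>If \<open>B\<close> bounds the absolute value of \<open>f\<close>, then
  \<open>f + B\<close> and \<open>- f + B\<close> are nonnegative and lower semicontinuous; the
  portmanteau inequality for the two gives the lower and the upper estimate.\<close>

lemma lipschitz_tendsto_continuous:
  fixes f :: "'b::metric_space \<Rightarrow> real"
  assumes M: "\<And>n. M n \<in> prob_measures" and \<mu>: "\<mu> \<in> prob_measures"
    and conv: "lipschitz_tendsto M \<mu>"
    and f: "continuous_on UNIV f" "bounded (range f)"
  shows "(\<lambda>n. \<integral>x. f x \<partial>M n) \<longlonglongrightarrow> (\<integral>x. f x \<partial>\<mu>)"
proof -
  obtain B where B: "\<And>x. \<bar>f x\<bar> \<le> B" using f(2) by (auto simp: bounded_iff)
  have fint: "integrable \<nu> h" if "\<nu> \<in> prob_measures" "continuous_on UNIV h" "\<And>x. \<bar>h x\<bar> \<le> C" for \<nu> C and h :: "'b \<Rightarrow> real"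
    using that by (intro integrable_bounded_prob[where B=C] borel_measurable_continuous_onI)
  have low: "\<forall>\<^sub>F n in sequentially. a < (\<integral>x. h x \<partial>M n)"
    if h: "continuous_on UNIV h" "\<And>x. \<bar>h x\<bar> \<le> B" and a: "a < (\<integral>x. h x \<partial>\<mu>)" for h :: "'b \<Rightarrow> real" and a
  proof -
    have eq: "(\<integral>\<^sup>+x. ennreal (h x + B) \<partial>\<nu>) = ennreal ((\<integral>x. h x \<partial>\<nu>) + B)" and ge: "(\<integral>x. h x \<partial>\<nu>) + B \<ge> 0"
      if \<nu>: "\<nu> \<in> prob_measures" for \<nu>
    proof -
      interpret prob_space \<nu> by (rule prob_measuresD[OF \<nu>])
      have i: "integrable \<nu> h" using fint[OF \<nu> h] .
      have pos: "0 \<le> h x + B" for x using h(2)[of x] by auto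
      have "(\<integral>\<^sup>+x. ennreal (h x + B) \<partial>\<nu>) = ennreal (\<integral>x. h x + B \<partial>\<nu>)"
        using i pos by (intro nn_integral_eq_integral) auto
      also have e: "(\<integral>x. h x + B \<partial>\<nu>) = (\<integral>x. h x \<partial>\<nu>) + B" using i by (simp add: prob_space)
      finally show "(\<integral>\<^sup>+x. ennreal (h x + B) \<partial>\<nu>) = ennreal ((\<integral>x. h x \<partial>\<nu>) + B)" .
      show "(\<integral>x. h x \<partial>\<nu>) + B \<ge> 0" unfolding e[symmetric] using pos by (intro integral_nonneg_AE) auto
    qed
    have lsc: "lower_semicontinuous (\<lambda>x. ennreal (h x + B))"
      by (intro lower_semicontinuous_continuous continuous_intros h)
    show ?thesis
    \<comment> \<open>A negative threshold would be truncated to 0 in \<open>ennreal\<close>, so it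
      is treated apart; there the claim is trivial.\<close>
    proof (cases "a + B < 0")
      case True
      then show ?thesis using ge[OF M] by (intro always_eventually allI) (smt (verit))
    next
      case False
      then have "ennreal (a + B) < (\<integral>\<^sup>+x. ennreal (h x + B) \<partial>\<mu>)"
        unfolding eq[OF \<mu>] using a by (intro ennreal_lessI) auto
      from lsc_nn_integral_lower[OF lsc M \<mu> conv this]
      show ?thesis unfolding eq[OF M] using False by (auto simp: ennreal_less_iff elim!: eventually_mono)
    qed
  qed
  show ?thesis
  proof (rule order_tendstoI)
    fix a assume "a < (\<integral>x. f x \<partial>\<mu>)"
    then show "\<forall>\<^sub>F n in sequentially. a < (\<integral>x. f x \<partial>M n)" using low f B by blast
  next
    fix a assume "(\<integral>x. f x \<partial>\<mu>) < a"
    then have "-a < (\<integral>x. - f x \<partial>\<mu>)" by simp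
    from low[OF _ _ this] f B have "\<forall>\<^sub>F n in sequentially. -a < (\<integral>x. - f x \<partial>M n)"
      by (simp add: continuous_on_minus)
    then show "\<forall>\<^sub>F n in sequentially. (\<integral>x. f x \<partial>M n) < a" by simp
  qed
qed

section \<open>Prokhorov's theorem\<close>

instance prod :: (polish_space, polish_space) polish_space ..

section \<open>Weak limits on countable spaces and projective limits\<close>

lemma integral_near_finite_sum:
  fixes N :: "'c measure" and g :: "'c \<Rightarrow> real"
  assumes N: "prob_space N" "sets N = UNIV" and F: "finite F" and B: "\<And>s. \<bar>g s\<bar> \<le> B"
    and e: "measure N (- F) \<le> e"
  shows "\<bar>(\<integral>s. g s \<partial>N) - (\<Sum>s\<in>F. g s * measure N {s})\<bar> \<le> B * e"
proof -
  interpret prob_space N by fact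
  have sp: "space N = UNIV" using sets_eq_imp_space_eq[of N "count_space UNIV"] N(2) by simp
  have gm: "h \<in> borel_measurable N" for h :: "'c \<Rightarrow> real"
    using N(2) by (auto simp: measurable_def sp)
  have g1: "integrable N (\<lambda>s. indicator (-F) s * g s)" using B gm
    by (intro integrable_const_bound[of _ B]) (auto simp: indicator_def intro: order_trans[OF abs_ge_zero])
  have g2: "integrable N (\<lambda>s. indicator F s * g s)" using B gm
    by (intro integrable_const_bound[of _ B]) (auto simp: indicator_def intro: order_trans[OF abs_ge_zero])
  have B0: "0 \<le> B" using B[of undefined] by linarith
  have "(\<integral>s. indicator F s * g s \<partial>N) = (\<integral>s. (\<Sum>x\<in>F. g x * indicator {x} s) \<partial>N)"
  proof (rule Bochner_Integration.integral_cong)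
    fix s
    show "indicator F s * g s = (\<Sum>x\<in>F. g x * indicator {x} s)"
    proof (cases "s \<in> F")
      case True
      then have "(\<Sum>x\<in>F. g x * indicator {x} s) = (\<Sum>x\<in>{s}. g x * indicator {x} s)"
        using F by (intro sum.mono_neutral_right) auto
      then show ?thesis using True by simp
    next
      case False
      then have "(\<Sum>x\<in>F. g x * indicator {x} s) = 0" by (intro sum.neutral) (auto simp: indicator_def)
      then show ?thesis using False by simp
    qed
  qed simp
  also have "\<dots> = (\<Sum>x\<in>F. g x * measure N {x})"
  proof (subst Bochner_Integration.integral_sum)
    show "integrable N (\<lambda>s. g x * indicator {x} s)" for x
      using N(2) by (intro integrable_mult_right integrable_real_indicator) (auto simp: less_top[symmetric])
    show "(\<Sum>x\<in>F. \<integral>s. g x * indicator {x} s \<partial>N) = (\<Sum>x\<in>F. g x * measure N {x})"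
      using N(2) by (simp add: sp)
  qed
  finally have 1: "(\<integral>s. indicator F s * g s \<partial>N) = (\<Sum>x\<in>F. g x * measure N {x})" .
  have "(\<integral>s. g s \<partial>N) = (\<integral>s. indicator F s * g s + indicator (-F) s * g s \<partial>N)"
    by (intro Bochner_Integration.integral_cong) (auto simp: indicator_def)
  also have "\<dots> = (\<integral>s. indicator F s * g s \<partial>N) + (\<integral>s. indicator (-F) s * g s \<partial>N)"
    using g1 g2 by simp
  finally have "(\<integral>s. g s \<partial>N) - (\<Sum>s\<in>F. g s * measure N {s}) = (\<integral>s. indicator (-F) s * g s \<partial>N)"
    unfolding 1 by simp
  also have "\<bar>\<dots>\<bar> \<le> (\<integral>s. \<bar>indicator (-F) s * g s\<bar> \<partial>N)"
    using integral_norm_bound[of N "\<lambda>s. indicator (-F) s * g s"] by simp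
  also have "\<dots> \<le> (\<integral>s. B * indicator (-F) s \<partial>N)"
  proof (rule integral_mono)
    show "integrable N (\<lambda>s. B * indicator (- F) s)"
      using N(2) by (intro integrable_mult_right integrable_real_indicator) (auto simp: less_top[symmetric])
    show "\<And>x. x \<in> space N \<Longrightarrow> \<bar>indicator (- F) x * g x\<bar> \<le> B * indicator (- F) x"
      using B by (auto simp: indicator_def)
  qed (use g1 in auto)
  also have "\<dots> = B * measure N (-F)" using N(2) by (simp add: sp)
  also have "\<dots> \<le> B * e" using e B0 by (rule mult_left_mono)
  finally show ?thesis .
qed

text \<open>The limits of the point masses have total mass at most 1 by Fatou. Tightness prevents
  mass from escaping and gives at least 1. Outside a finite set all measures have small mass, so
  integrals of bounded functions reduce to finite sums.\<close>

lemma tight_countable_limit: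
  fixes M :: "nat \<Rightarrow> 'c::countable measure"
  assumes M: "\<And>n. prob_space (M n)" "\<And>n. sets (M n) = UNIV"
    and lim: "\<And>s. (\<lambda>n. measure (M n) {s}) \<longlonglongrightarrow> p s"
    and tight: "\<And>\<epsilon>. 0 < \<epsilon> \<Longrightarrow> \<exists>F. finite F \<and> (\<forall>n. measure (M n) (- F) \<le> \<epsilon>)"
  obtains Q :: "'c pmf" where
    "\<And>(g :: 'c \<Rightarrow> real) B. (\<And>s. \<bar>g s\<bar> \<le> B) \<Longrightarrow> (\<lambda>n. \<integral>s. g s \<partial>M n) \<longlonglongrightarrow> (\<integral>s. g s \<partial>measure_pmf Q)"
proof -
  have sp: "space (M n) = UNIV" for n
    using sets_eq_imp_space_eq[of "M n" "count_space UNIV"] M(2) by simp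
  have p0: "0 \<le> p s" for s by (rule LIMSEQ_le_const[OF lim]) auto
  have limF: "(\<lambda>n. measure (M n) F) \<longlonglongrightarrow> (\<Sum>s\<in>F. p s)" if "finite F" for F
  proof -
    have "measure (M n) F = (\<Sum>s\<in>F. measure (M n) {s})" for n
      using that M by (intro finite_measure.finite_measure_eq_sum_singleton) (auto simp: prob_space.finite_measure)
    then show ?thesis using lim by (auto intro: tendsto_sum)
  qed
  have compl: "measure (M n) F = 1 - measure (M n) (-F)" for n F
  proof -
    interpret prob_space "M n" by (rule M)
    show ?thesis using prob_compl[of "-F"] M(2) sp by (simp add: Compl_eq_Diff_UNIV Diff_Diff_Int)
  qed
  have le1: "(\<integral>\<^sup>+s. ennreal (p s) \<partial>count_space UNIV) \<le> 1"
  proof -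
    have "(\<integral>\<^sup>+s. ennreal (p s) \<partial>count_space UNIV)
        = (\<integral>\<^sup>+s. liminf (\<lambda>n. ennreal (measure (M n) {s})) \<partial>count_space UNIV)"
      by (intro nn_integral_cong lim_imp_Liminf[symmetric] tendsto_ennrealI lim) auto
    also have "\<dots> \<le> liminf (\<lambda>n. \<integral>\<^sup>+s. ennreal (measure (M n) {s}) \<partial>count_space UNIV)"
      by (rule nn_integral_liminf) simp
    also have "\<dots> = liminf (\<lambda>n. 1)"
    proof -
      have "(\<integral>\<^sup>+s. ennreal (measure (M n) {s}) \<partial>count_space UNIV) = 1" for n
      proof -
        interpret prob_space "M n" by (rule M)
        show ?thesis using emeasure_countable_singleton[of UNIV "M n"] M(2) emeasure_space_1
          by (simp add: sp emeasure_eq_measure)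
      qed
      then show ?thesis by simp
    qed
    also have "\<dots> = 1" by (simp add: Liminf_const)
    finally show ?thesis .
  qed
  have Fge: "1 - \<epsilon> \<le> (\<Sum>s\<in>F. p s)" if F: "finite F" "\<forall>n. measure (M n) (- F) \<le> \<epsilon>" for F \<epsilon>
  proof (rule LIMSEQ_le_const[OF limF[OF F(1)]])
    show "\<exists>N. \<forall>n\<ge>N. 1 - \<epsilon> \<le> measure (M n) F" using F(2) by (subst compl) auto
  qed
  have ge1: "1 \<le> (\<integral>\<^sup>+s. ennreal (p s) \<partial>count_space UNIV)"
  proof (rule ennreal_le_epsilon)
    fix e :: real assume "0 < e"
    then obtain F where F: "finite F" "\<forall>n. measure (M n) (- F) \<le> e" using tight by blast
    have "1 \<le> (\<Sum>s\<in>F. p s) + e" using Fge[OF F] by simp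
    then have "ennreal 1 \<le> ennreal ((\<Sum>s\<in>F. p s) + e)" by (rule ennreal_leI)
    also have "\<dots> = (\<Sum>s\<in>F. ennreal (p s)) + ennreal e"
      using p0 \<open>0 < e\<close> by (simp add: sum_nonneg ennreal_plus sum_ennreal)
    also have "(\<Sum>s\<in>F. ennreal (p s)) = (\<integral>\<^sup>+s. ennreal (p s) \<partial>count_space F)"
      using F(1) by (simp add: nn_integral_count_space_finite)
    also have "\<dots> = (\<integral>\<^sup>+s. ennreal (p s) * indicator F s \<partial>count_space UNIV)"
      by (simp add: nn_integral_count_space_indicator)
    also have "\<dots> \<le> (\<integral>\<^sup>+s. ennreal (p s) \<partial>count_space UNIV)"
      by (intro nn_integral_mono) (auto simp: indicator_def)
    finally show "1 \<le> (\<integral>\<^sup>+s. ennreal (p s) \<partial>count_space UNIV) + ennreal e" by (simp add: add_right_mono)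
  qed
  define Q where "Q = embed_pmf p"
  have Q: "measure (measure_pmf Q) {s} = p s" for s
    unfolding Q_def using le1 ge1 p0 by (simp add: pmf_embed_pmf measure_pmf_single antisym)
  have "(\<lambda>n. \<integral>s. g s \<partial>M n) \<longlonglongrightarrow> (\<integral>s. g s \<partial>measure_pmf Q)"
    if B: "\<And>s. \<bar>g s\<bar> \<le> B" for g :: "'c \<Rightarrow> real" and B
  proof (rule LIMSEQ_I)
    fix r :: real assume r: "0 < r"
    have B0: "0 \<le> B" using B[of undefined] by linarith
    \<comment> \<open>The two tails cost \<open>B * \<epsilon>\<close> each. The summand 2 leaves a
      strict margin and avoids division by 0 when \<open>B = 0\<close>.\<close>
    define \<epsilon> where "\<epsilon> = r / (2 * B + 2)"
    have "(2 * B + 2) * \<epsilon> = r" using B0 by (simp add: \<epsilon>_def)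
    moreover have "0 < \<epsilon>" using r B0 by (simp add: \<epsilon>_def)
    ultimately have \<epsilon>: "0 < \<epsilon>" "B * \<epsilon> + B * \<epsilon> < r" by (auto simp: algebra_simps)
    obtain F where F: "finite F" "\<forall>n. measure (M n) (- F) \<le> \<epsilon>" using tight[OF \<epsilon>(1)] by blast
    have QF: "measure (measure_pmf Q) (- F) \<le> \<epsilon>"
    proof -
      have "measure (measure_pmf Q) F = (\<Sum>s\<in>F. p s)"
        using F(1) Q by (subst measure_measure_pmf_finite) (auto simp: measure_pmf_single)
      then show ?thesis using Fge[OF F] measure_pmf.prob_compl[of F Q] by (simp add: Compl_eq_Diff_UNIV)
    qed
    have QB: "\<bar>(\<integral>s. g s \<partial>measure_pmf Q) - (\<Sum>s\<in>F. g s * p s)\<bar> \<le> B * \<epsilon>"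
      using integral_near_finite_sum[where g=g, OF measure_pmf.prob_space_axioms _ F(1) B QF] Q by simp
    have MB: "\<bar>(\<integral>s. g s \<partial>M n) - (\<Sum>s\<in>F. g s * measure (M n) {s})\<bar> \<le> B * \<epsilon>" for n
      by (rule integral_near_finite_sum[OF M F(1) B]) (use F(2) in blast)
    have "(\<lambda>n. \<Sum>s\<in>F. g s * measure (M n) {s}) \<longlonglongrightarrow> (\<Sum>s\<in>F. g s * p s)"
      by (intro tendsto_sum tendsto_mult tendsto_const lim)
    from LIMSEQ_D[OF this, of "r - (B * \<epsilon> + B * \<epsilon>)"] \<epsilon>(2)
    obtain N where N: "\<And>n. N \<le> n \<Longrightarrow> \<bar>(\<Sum>s\<in>F. g s * measure (M n) {s}) - (\<Sum>s\<in>F. g s * p s)\<bar> < r - (B * \<epsilon> + B * \<epsilon>)"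
      by auto
    show "\<exists>no. \<forall>n\<ge>no. norm ((\<integral>s. g s \<partial>M n) - (\<integral>s. g s \<partial>measure_pmf Q)) < r"
    proof (intro exI allI impI)
      fix n assume "N \<le> n"
      from N[OF this] QB MB[of n] show "norm ((\<integral>s. g s \<partial>M n) - (\<integral>s. g s \<partial>measure_pmf Q)) < r"
        unfolding real_norm_def by linarith
    qed
  qed
  then show ?thesis by (rule that)
qed

lemma pointwise_convergent_subsequence:
  fixes f :: "nat \<Rightarrow> 'c::countable \<Rightarrow> real"
  assumes f: "\<And>n s. 0 \<le> f n s" "\<And>n s. f n s \<le> 1"
  obtains r :: "nat \<Rightarrow> nat" and p where "strict_mono r" "\<And>s. (\<lambda>n. f (r n) s) \<longlonglongrightarrow> p s"
proof -
  let ?P = "\<lambda>i (s :: nat \<Rightarrow> nat). convergent (\<lambda>k. f (s k) (from_nat i))"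
  interpret S: subseqs ?P
  proof (unfold subseqs_def, intro allI impI)
    fix i and s :: "nat \<Rightarrow> nat" assume "strict_mono s"
    have "\<And>k. f (s k) (from_nat i) \<in> {0..1}" using f by simp
    then have "\<exists>l r. strict_mono r \<and> ((\<lambda>k. f (s k) (from_nat i)) \<circ> r) \<longlonglongrightarrow> l"
      using compact_Icc[of "0::real" 1] compact_imp_seq_compact seq_compactE by metis
    then show "\<exists>r'. strict_mono r' \<and> ?P i (s \<circ> r')"
      by (auto simp: convergent_def comp_def)
  qed
  have "convergent (\<lambda>n. f (S.diagseq n) s)" for s
  proof -
    \<comment> \<open>The diagonal sequence is a subsequence of the sequence chosen for
      \<open>s\<close> only from the index after \<open>to_nat s\<close> on; the shift is removed
      afterwards.\<close>
    have "?P (to_nat s) (S.diagseq \<circ> (+) (Suc (to_nat s)))"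
    proof (rule S.diagseq_holds)
      fix r s :: "nat \<Rightarrow> nat" and n assume "strict_mono r" "?P n s"
      from convergent_subseq_convergent[OF this(2) this(1)] show "?P n (s \<circ> r)" by (simp add: comp_def)
    qed
    then obtain L where "(\<lambda>k. f (S.diagseq (k + Suc (to_nat s))) s) \<longlonglongrightarrow> L"
      by (auto simp: convergent_def add.commute)
    then have "(\<lambda>k. f (S.diagseq k) s) \<longlonglongrightarrow> L" by (rule LIMSEQ_offset)
    then show ?thesis by (auto simp: convergent_def)
  qed
  then have "\<forall>s. \<exists>l. (\<lambda>n. f (S.diagseq n) s) \<longlonglongrightarrow> l" by (simp add: convergent_def)
  then obtain p where "\<And>s. (\<lambda>n. f (S.diagseq n) s) \<longlonglongrightarrow> p s" by metis
  then show ?thesis by (rule that[OF S.subseq_diagseq])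
qed

text \<open>Kolmogorov extension for the decoded words. Decoding by \<open>z\<close> letter by
  letter puts the extended law on sequences of points of the space, where a limit of the coordinates
  can be taken.\<close>

lemma consistent_pmfs_sequence_measure:
  fixes Q :: "nat \<Rightarrow> nat list pmf" and z :: "nat \<Rightarrow> 'b::polish_space"
  assumes cons: "\<And>N M. N \<le> M \<Longrightarrow> map_pmf (take N) (Q M) = Q N"
  obtains L :: "(nat \<Rightarrow> 'b) measure" where "prob_space L" "sets L = sets (PiM UNIV (\<lambda>_. borel))"
    "\<And>N. distr L (PiM {..<N} (\<lambda>_. borel)) (\<lambda>\<omega>. restrict \<omega> {..<N})
      = distr (measure_pmf (Q N)) (PiM {..<N} (\<lambda>_. borel)) (\<lambda>s. \<lambda>j\<in>{..<N}. z (s ! j))"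
proof -
  \<comment> \<open>A word length that covers all positions in \<open>J\<close>; inserting 0 keeps
    \<open>Max\<close> meaningful for empty \<open>J\<close>. By consistency any other sufficient
    length gives the same law \<open>W N J\<close>.\<close>
  define b where "b J = Suc (Max (insert 0 J))" for J :: "nat set"
  define W where "W N J = distr (measure_pmf (Q N)) (PiM J (\<lambda>_. borel :: 'b measure)) (\<lambda>s. \<lambda>j\<in>J. z (s ! j))" for N J
  have bJ: "j < b J" if "finite J" "j \<in> J" for j J
    using that by (simp add: b_def less_Suc_eq_le)
  have meas[measurable]: "(\<lambda>s. \<lambda>j\<in>J. z (s ! j)) \<in> measurable (count_space UNIV) (PiM J (\<lambda>_. borel))" for J
    by (auto simp: measurable_count_space_eq1 space_PiM)
  have W_le: "W M J = W N J" if "N \<le> M" "J \<subseteq> {..<N}" for M N J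
  proof -
    have "W N J = distr (distr (measure_pmf (Q M)) (count_space UNIV) (take N)) (PiM J (\<lambda>_. borel)) (\<lambda>s. \<lambda>j\<in>J. z (s ! j))"
      unfolding W_def cons[OF that(1), symmetric] map_pmf_rep_eq ..
    also have "\<dots> = distr (measure_pmf (Q M)) (PiM J (\<lambda>_. borel)) ((\<lambda>s. \<lambda>j\<in>J. z (s ! j)) \<circ> take N)"
      by (rule distr_distr[OF meas]) simp
    also have "(\<lambda>s. \<lambda>j\<in>J. z (s ! j)) \<circ> take N = (\<lambda>s. \<lambda>j\<in>J. z (s ! j))"
      using that(2) by (intro ext) (auto simp: restrict_def subset_eq)
    finally show ?thesis unfolding W_def by (rule sym)
  qed
  have W_b: "W N J = W (b J) J" if "finite J" "J \<subseteq> {..<N}" for N J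
    using W_le[of N "max N (b J)" J] W_le[of "b J" "max N (b J)" J] that bJ[OF that(1)] by auto
  have W_res: "W N J = distr (W N H) (PiM J (\<lambda>_. borel)) (\<lambda>f. restrict f J)" if "J \<subseteq> H" for J H N
  proof -
    have "distr (W N H) (PiM J (\<lambda>_. borel)) (\<lambda>f. restrict f J)
        = distr (measure_pmf (Q N)) (PiM J (\<lambda>_. borel)) ((\<lambda>f. restrict f J) \<circ> (\<lambda>s. \<lambda>j\<in>H. z (s ! j)))"
      unfolding W_def using that by (intro distr_distr measurable_restrict_subset) (auto simp: space_PiM)
    also have "(\<lambda>f. restrict f J) \<circ> (\<lambda>s. \<lambda>j\<in>H. z (s ! j)) = (\<lambda>s. \<lambda>j\<in>J. z (s ! j))"
      using that by (intro ext) (auto simp: restrict_def subset_eq)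
    finally show ?thesis unfolding W_def by (rule sym)
  qed
  interpret pp: polish_projective UNIV "\<lambda>J. W (b J) J"
  proof (unfold polish_projective_def projective_family_def, intro conjI allI impI, goal_cases)
    case (1 J H)
    then have JH: "J \<subseteq> H" "finite H" by auto
    then have fJ: "finite J" by (rule finite_subset)
    have "J \<subseteq> {..<b H}" using JH bJ[OF JH(2)] by auto
    then have "W (b J) J = W (b H) J" by (rule W_b[OF fJ, symmetric])
    then show ?case using W_res[OF JH(1)] by simp
  next
    case (2 J)
    show ?case
      unfolding W_def by (rule measure_pmf.prob_space_distr) (auto simp: space_PiM)
  qed
  have "distr pp.lim (PiM {..<N} (\<lambda>_. borel)) (\<lambda>\<omega>. restrict \<omega> {..<N}) = W N {..<N}" for N
  proof (rule measure_eqI)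
    fix X assume "X \<in> sets (distr pp.lim (PiM {..<N} (\<lambda>_. borel)) (\<lambda>\<omega>. restrict \<omega> {..<N}))"
    then have X: "X \<in> sets (PiM {..<N} (\<lambda>_. borel))" by simp
    have "emeasure (distr pp.lim (PiM {..<N} (\<lambda>_. borel)) (\<lambda>\<omega>. restrict \<omega> {..<N})) X
        = emeasure pp.lim (pp.emb UNIV {..<N} X)"
      using X by (subst emeasure_distr) (auto simp: prod_emb_def space_PiM intro!: measurable_restrict_subset arg_cong2[where f=emeasure] cong: measurable_cong_sets)
    also have "\<dots> = emeasure (W (b {..<N}) {..<N}) X"
      using X by (intro pp.emeasure_lim_emb) auto
    also have "\<dots> = emeasure (W N {..<N}) X" using W_b[of "{..<N}" N] by simp
    finally show "emeasure (distr pp.lim (PiM {..<N} (\<lambda>_. borel)) (\<lambda>\<omega>. restrict \<omega> {..<N})) X = emeasure (W N {..<N}) X" .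
  qed (simp add: W_def)
  then show ?thesis
    by (intro that[OF pp.P.prob_space_axioms pp.sets_lim]) (simp only: W_def)
qed

lemma integral_diff_le_prob:
  fixes g h :: "'b \<Rightarrow> real"
  assumes M: "prob_space M" and g: "integrable M g" and h: "integrable M h"
    and d: "AE x in M. \<bar>g x - h x\<bar> \<le> d"
  shows "\<bar>(\<integral>x. g x \<partial>M) - (\<integral>x. h x \<partial>M)\<bar> \<le> d"
proof -
  interpret prob_space M by fact
  have "\<bar>(\<integral>x. g x \<partial>M) - (\<integral>x. h x \<partial>M)\<bar> = \<bar>\<integral>x. g x - h x \<partial>M\<bar>" using g h by simp
  also have "\<dots> \<le> (\<integral>x. \<bar>g x - h x\<bar> \<partial>M)" using integral_norm_bound[of M "\<lambda>x. g x - h x"] by simp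
  also have "\<dots> \<le> (\<integral>x. d \<partial>M)" using g h d by (intro integral_mono_AE) auto
  also have "\<dots> = d" by (simp add: prob_space)
  finally show ?thesis .
qed

lemma geometric_steps_converge:
  fixes w :: "nat \<Rightarrow> 'b::complete_space"
  assumes w: "\<And>j. dist (w j) (w (Suc j)) \<le> 2 * (1/2)^j"
  shows "w \<longlonglongrightarrow> lim w" "dist (w j) (lim w) \<le> 4 * (1/2)^j"
proof -
  \<comment> \<open>The exact partial sum of the geometric series; the factor
    \<open>1 - (1/2)^k\<close> is what lets the induction close.\<close>
  have step: "dist (w j) (w (j + k)) \<le> 4 * (1/2)^j * (1 - (1/2)^k)" for j k
  proof (induction k)
    case (Suc k)
    have "dist (w j) (w (j + Suc k)) \<le> dist (w j) (w (j + k)) + dist (w (j + k)) (w (Suc (j + k)))"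
      using dist_triangle[of "w j" "w (j + Suc k)" "w (j + k)"] by simp
    also have "\<dots> \<le> 4 * (1/2)^j * (1 - (1/2)^k) + 2 * (1/2)^(j + k)"
      using Suc w[of "j + k"] by linarith
    also have "\<dots> = 4 * (1/2)^j * (1 - (1/2)^Suc k)" by (simp add: power_add algebra_simps)
    finally show ?case .
  qed simp
  have le: "dist (w j) (w n) \<le> 4 * (1/2)^j" if "j \<le> n" for j n
  proof -
    have "dist (w j) (w n) \<le> 4 * (1/2)^j * (1 - (1/2)^(n - j))" using step[of j "n - j"] that by simp
    also have "\<dots> \<le> 4 * (1/2)^j * 1" by (intro mult_left_mono) auto
    finally show ?thesis by simp
  qed
  have "Cauchy w"
  proof (rule metric_CauchyI)
    fix e :: real assume "0 < e"
    then obtain M where M: "(1/2::real)^M < e / 8" using real_arch_pow_inv[of "e / 8" "1/2"] by auto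
    show "\<exists>M. \<forall>m\<ge>M. \<forall>n\<ge>M. dist (w m) (w n) < e"
    proof (intro exI allI impI)
      fix m n assume "M \<le> m" "M \<le> n"
      then have "dist (w m) (w n) \<le> 4 * (1/2)^M + 4 * (1/2)^M"
        using le[of M m] le[of M n] dist_triangle3[of "w m" "w n" "w M"] by linarith
      then show "dist (w m) (w n) < e" using M by simp
    qed
  qed
  then show l: "w \<longlonglongrightarrow> lim w" by (simp add: Cauchy_convergent_iff convergent_LIMSEQ_iff)
  have "(\<lambda>n. dist (w j) (w n)) \<longlonglongrightarrow> dist (w j) (lim w)" by (intro tendsto_intros l)
  then show "dist (w j) (lim w) \<le> 4 * (1/2)^j"
    by (rule LIMSEQ_le_const2) (use le in blast)
qed

text \<open>Total boundedness up to small mass, uniformly in the sequence. On a complete space this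
  is equivalent to tightness, and it mentions no compact sets: finite families of balls combine
  easily in products and relate directly to the index of the nearest dense point.\<close>

definition tight_by_balls :: "(nat \<Rightarrow> 'b::metric_space measure) \<Rightarrow> bool"
  where "tight_by_balls \<mu> \<longleftrightarrow> (\<forall>r>0. \<forall>\<epsilon>>0. \<exists>F. finite F \<and> (\<forall>n. measure (\<mu> n) (- (\<Union>x\<in>F. ball x r)) \<le> \<epsilon>))"

text \<open>A point is encoded by the sequence of indices \<open>a j x\<close> of the first dense point within
  \<open>2^-j\<close>. The laws of the initial segments of this code live on a countable set, where tightness and a
  diagonal argument give limits; the limits are consistent, and the limit measure is the law of the
  point decoded from the Kolmogorov extension.\<close>

theorem tight_by_balls_convergent_subsequence:
  fixes \<mu> :: "nat \<Rightarrow> 'b::polish_space measure"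
  assumes \<mu>: "\<And>n. \<mu> n \<in> prob_measures" and tight: "tight_by_balls \<mu>"
  obtains r \<nu> where "strict_mono r" "\<nu> \<in> prob_measures" "lipschitz_tendsto (\<lambda>n. \<mu> (r n)) \<nu>"
proof -
  obtain D :: "'b set" where D: "countable D" "\<And>X. open X \<Longrightarrow> X \<noteq> {} \<Longrightarrow> \<exists>d\<in>D. d \<in> X"
    by (rule countable_dense_setE) blast
  define z where "z = from_nat_into D"
  have z: "\<exists>i. dist x (z i) < e" if "0 < e" for x e
  proof -
    have "ball x e \<noteq> {}" using that by simp
    then obtain d where "d \<in> D" "d \<in> ball x e" using D(2)[OF open_ball] by metis
    then show ?thesis using from_nat_into_surj[OF D(1)] by (metis mem_ball z_def)
  qed
  have m\<mu>: "f \<in> \<mu> n \<rightarrow>\<^sub>M N" if "f \<in> borel \<rightarrow>\<^sub>M N" for f n and N :: "'x measure"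
    using that prob_measuresD(2)[OF \<mu>] measurable_cong_sets by blast
  have sp[simp]: "space (\<mu> n) = UNIV" for n by (rule prob_measuresD(3)[OF \<mu>])
  have P: "prob_space (\<mu> n)" for n by (rule prob_measuresD(1)[OF \<mu>])
  interpret P: prob_space "\<mu> n" for n by (rule P)
  define a where "a j x = (LEAST i. dist x (z i) < (1/2)^j)" for j x
  have a: "dist x (z (a j x)) < (1/2)^j" for j x
    unfolding a_def by (rule LeastI_ex[OF z]) simp
  have a_le: "a j x \<le> i" if "dist x (z i) < (1/2)^j" for i j x
    unfolding a_def using that by (rule Least_le)
  have am[measurable]: "a j \<in> borel \<rightarrow>\<^sub>M count_space UNIV" for j
    unfolding a_def by measurable
  define b where "b N x = map (\<lambda>j. a j x) [0..<N]" for N x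
  have b_nth: "b N x ! j = a j x" if "j < N" for N j x using that by (simp add: b_def)
  have b_len: "length (b N x) = N" for N x by (simp add: b_def)
  have b_iff: "b N x = s \<longleftrightarrow> length s = N \<and> (\<forall>j\<in>{..<N}. a j x = s ! j)" for N x s
    by (auto simp: list_eq_iff_nth_eq b_def)
  have bm[measurable]: "b N \<in> borel \<rightarrow>\<^sub>M count_space UNIV" for N
  proof (subst measurable_count_space_eq_countable, simp, intro conjI ballI)
    fix s
    have "Measurable.pred borel (\<lambda>x. length s = N \<and> (\<forall>j\<in>{..<N}. a j x = s ! j))" by measurable
    then have "{x. b N x = s} \<in> sets borel" unfolding b_iff by (simp add: pred_def)
    then show "b N -` {s} \<inter> space borel \<in> sets borel" by (simp add: vimage_def)
  qed simp
  define MN where "MN n N = distr (\<mu> n) (count_space UNIV) (b N)" for n N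
  have MN: "prob_space (MN n N)" "sets (MN n N) = UNIV" for n N
    unfolding MN_def by (auto intro!: P.prob_space_distr m\<mu> bm)
  have spMN: "space (MN n N) = UNIV" for n N by (simp add: MN_def)
  have MN_measure: "measure (MN n N) A = measure (\<mu> n) {x. b N x \<in> A}" for n N A
    unfolding MN_def by (subst measure_distr) (auto simp: vimage_def intro: m\<mu> bm)
  have aset: "{x. P (a j x)} \<in> sets borel" for P j
    using measurable_sets[OF am, of "Collect P" j] by (simp add: vimage_def)
  \<comment> \<open>Halving the radius leaves room to replace each ball centre by a nearby dense
    point: every point of the half-size ball around \<open>y\<close> is within
    \<open>(1/2)^j\<close> of \<open>z (i y)\<close>. The sum over \<open>F\<close> serves as a
    crude bound for the maximum of these indices.\<close>
  have a_tight: "\<exists>K. \<forall>n. measure (\<mu> n) {x. K < a j x} \<le> \<epsilon>" if \<epsilon>: "0 < \<epsilon>" for \<epsilon> j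
  proof -
    have "(0::real) < (1/2)^Suc j" by simp
    then obtain F where F: "finite F" "\<And>n. measure (\<mu> n) (- (\<Union>x\<in>F. ball x ((1/2)^Suc j))) \<le> \<epsilon>"
      using tight[unfolded tight_by_balls_def, rule_format, OF _ \<epsilon>, of "(1/2)^Suc j"] by auto
    have "\<forall>x. \<exists>i. dist x (z i) < (1/2)^Suc j" by (intro allI z) simp
    then obtain i where i: "\<And>x. dist x (z (i x)) < (1/2)^Suc j" by metis
    have "{x. (\<Sum>y\<in>F. i y) < a j x} \<subseteq> - (\<Union>x\<in>F. ball x ((1/2)^Suc j))"
    proof
      fix x assume x: "x \<in> {x. (\<Sum>y\<in>F. i y) < a j x}"
      show "x \<in> - (\<Union>x\<in>F. ball x ((1/2)^Suc j))"
      proof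
        assume "x \<in> (\<Union>x\<in>F. ball x ((1/2)^Suc j))"
        then obtain y where y: "y \<in> F" "dist y x < (1/2)^Suc j" by auto
        have "dist x (z (i y)) \<le> dist y x + dist y (z (i y))" by (rule dist_triangle3)
        then have "dist x (z (i y)) < (1/2)^j" using y(2) i[of y] by simp
        then have "a j x \<le> i y" by (rule a_le)
        also have "\<dots> \<le> (\<Sum>y\<in>F. i y)" using y(1) F(1) by (intro member_le_sum) auto
        finally show False using x by simp
      qed
    qed
    moreover have "- (\<Union>x\<in>F. ball x ((1/2)^Suc j)) \<in> sets (\<mu> n)" for n
      unfolding prob_measuresD(2)[OF \<mu>] by (intro borel_comp borel_open open_UN ballI open_ball)
    ultimately have "measure (\<mu> n) {x. (\<Sum>y\<in>F. i y) < a j x} \<le> \<epsilon>" for n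
      using P.finite_measure_mono order_trans[OF _ F(2)] by blast
    then show ?thesis by blast
  qed
  have MN_tight: "\<exists>F. finite F \<and> (\<forall>n. measure (MN n N) (- F) \<le> \<epsilon>)" if \<epsilon>: "0 < \<epsilon>" for \<epsilon> N
  proof -
    have "0 < \<epsilon> / (real N + 1)" using \<epsilon> by simp
    then have "\<forall>j. \<exists>K. \<forall>n. measure (\<mu> n) {x. K < a j x} \<le> \<epsilon> / (real N + 1)" by (intro allI a_tight)
    then obtain K where K: "\<And>j n. measure (\<mu> n) {x. K j < a j x} \<le> \<epsilon> / (real N + 1)" by metis
    define F where "F = {s. set s \<subseteq> {..(\<Sum>j<N. K j)} \<and> length s = N}"
    have "measure (MN n N) (-F) \<le> \<epsilon>" for n
    proof -
      have "{x. b N x \<in> -F} \<subseteq> (\<Union>j<N. {x. K j < a j x})"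
      proof
        fix x assume "x \<in> {x. b N x \<in> -F}"
        then have "\<not> set (b N x) \<subseteq> {..(\<Sum>j<N. K j)}" using b_len by (auto simp: F_def)
        then have "\<exists>j<N. (\<Sum>j<N. K j) < a j x" by (auto simp: b_def subset_iff not_le)
        then obtain j where j: "j < N" "(\<Sum>j<N. K j) < a j x" by blast
        have "K j \<le> (\<Sum>j<N. K j)" using j(1) by (intro member_le_sum) auto
        then have "K j < a j x" using j(2) by linarith
        then show "x \<in> (\<Union>j<N. {x. K j < a j x})" using j(1) by blast
      qed
      then have "measure (\<mu> n) {x. b N x \<in> -F} \<le> measure (\<mu> n) (\<Union>j<N. {x. K j < a j x})"
        using aset by (intro P.finite_measure_mono) (auto simp: prob_measuresD(2)[OF \<mu>])
      also have "\<dots> \<le> (\<Sum>j<N. measure (\<mu> n) {x. K j < a j x})"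
        using aset by (intro P.finite_measure_subadditive_finite) (auto simp: prob_measuresD(2)[OF \<mu>])
      also have "\<dots> \<le> (\<Sum>j<N. \<epsilon> / (real N + 1))" by (intro sum_mono K)
      also have "\<dots> = \<epsilon> * (real N / (real N + 1))" by simp
      also have "\<dots> \<le> \<epsilon> * 1" using \<epsilon> by (intro mult_left_mono) auto
      finally show ?thesis by (simp add: MN_measure)
    qed
    moreover have "finite F" unfolding F_def by (rule finite_lists_length_eq) simp
    ultimately show ?thesis by blast
  qed
  \<comment> \<open>One subsequence for all levels: the countable index set consists of all finite
    words, each tested at its own length.\<close>
  obtain r p where r: "strict_mono r" and p: "\<And>s. (\<lambda>n. measure (\<mu> (r n)) {x. b (length s) x = s}) \<longlonglongrightarrow> p s"
    using pointwise_convergent_subsequence[of "\<lambda>n s. measure (\<mu> n) {x. b (length s) x = s}"] by auto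
  have "\<exists>Q :: nat list pmf. \<forall>(g :: nat list \<Rightarrow> real) B. (\<forall>s. \<bar>g s\<bar> \<le> B)
      \<longrightarrow> (\<lambda>n. \<integral>s. g s \<partial>MN (r n) N) \<longlonglongrightarrow> (\<integral>s. g s \<partial>measure_pmf Q)" for N
  proof -
    have "(\<lambda>n. measure (MN (r n) N) {s}) \<longlonglongrightarrow> (if length s = N then p s else 0)" for s
    proof (cases "length s = N")
      case True
      then show ?thesis using p[of s] by (simp add: MN_measure)
    next
      case False
      then have "{x. b N x = s} = {}" using b_len by auto
      then show ?thesis using False by (simp add: MN_measure)
    qed
    moreover have "\<exists>F. finite F \<and> (\<forall>n. measure (MN (r n) N) (- F) \<le> \<epsilon>)" if "0 < \<epsilon>" for \<epsilon>
      using MN_tight[OF that, of N] by blast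
    ultimately show ?thesis
    proof (rule tight_countable_limit[where M="\<lambda>n. MN (r n) N", OF MN(1) MN(2)])
      fix Q :: "nat list pmf"
      assume H: "\<And>(g :: nat list \<Rightarrow> real) B. (\<And>s. \<bar>g s\<bar> \<le> B)
        \<Longrightarrow> (\<lambda>n. \<integral>s. g s \<partial>MN (r n) N) \<longlonglongrightarrow> (\<integral>s. g s \<partial>measure_pmf Q)"
      show ?thesis
      proof (intro exI allI impI)
        fix g :: "nat list \<Rightarrow> real" and B assume "\<forall>s. \<bar>g s\<bar> \<le> B"
        then show "(\<lambda>n. \<integral>s. g s \<partial>MN (r n) N) \<longlonglongrightarrow> (\<integral>s. g s \<partial>measure_pmf Q)"
          by (intro H[of g B]) simp
      qed
    qed
  qed
  then obtain Q :: "nat \<Rightarrow> nat list pmf" where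
    Q: "\<And>N (g :: nat list \<Rightarrow> real) B. (\<And>s. \<bar>g s\<bar> \<le> B)
      \<Longrightarrow> (\<lambda>n. \<integral>s. g s \<partial>MN (r n) N) \<longlonglongrightarrow> (\<integral>s. g s \<partial>measure_pmf (Q N))" by metis
  have QA: "(\<lambda>n. measure (\<mu> (r n)) {x. b N x \<in> A}) \<longlonglongrightarrow> measure (measure_pmf (Q N)) A" for N A
  proof -
    have lim: "(\<lambda>n. \<integral>s. indicat_real A s \<partial>MN (r n) N) \<longlonglongrightarrow> (\<integral>s. indicat_real A s \<partial>measure_pmf (Q N))"
      by (rule Q[of _ 1]) (simp add: indicator_def)
    have eq: "(\<integral>s. indicat_real A s \<partial>MN n N) = measure (\<mu> n) {x. b N x \<in> A}" for n
      using MN(2)[of n N] by (simp add: MN_measure spMN)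
    show ?thesis using lim unfolding eq by simp
  qed
  \<comment> \<open>Shortening the code of a point yields its shorter code, so the laws are
    consistent before the limit, and single masses carry this over.\<close>
  have cons: "map_pmf (take N) (Q M) = Q N" if "N \<le> M" for N M
  proof (rule pmf_eqI)
    fix s
    have tb: "take N (b M x) = b N x" for x using that by (simp add: b_def take_map)
    have "(\<lambda>n. measure (\<mu> (r n)) {x. b M x \<in> take N -` {s}}) \<longlonglongrightarrow> pmf (map_pmf (take N) (Q M)) s"
      using QA[of M "take N -` {s}"] by (simp add: pmf_map)
    moreover have "(\<lambda>n. measure (\<mu> (r n)) {x. b M x \<in> take N -` {s}}) \<longlonglongrightarrow> pmf (Q N) s"
      using QA[of N "{s}"] by (simp add: tb measure_pmf_single)
    ultimately show "pmf (map_pmf (take N) (Q M)) s = pmf (Q N) s" by (rule LIMSEQ_unique)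
  qed
  have "\<exists>L :: (nat \<Rightarrow> 'b) measure. prob_space L \<and> sets L = sets (PiM UNIV (\<lambda>_. borel)) \<and>
      (\<forall>N. distr L (PiM {..<N} (\<lambda>_. borel)) (\<lambda>\<omega>. restrict \<omega> {..<N})
      = distr (measure_pmf (Q N)) (PiM {..<N} (\<lambda>_. borel)) (\<lambda>s. \<lambda>j\<in>{..<N}. z (s ! j)))"
    by (rule consistent_pmfs_sequence_measure[where Q=Q and z=z], erule cons)
      (intro exI conjI allI, assumption+)
  then obtain L :: "(nat \<Rightarrow> 'b) measure" where L: "prob_space L" "sets L = sets (PiM UNIV (\<lambda>_. borel))"
    and LQ: "\<And>N. distr L (PiM {..<N} (\<lambda>_. borel)) (\<lambda>\<omega>. restrict \<omega> {..<N})
      = distr (measure_pmf (Q N)) (PiM {..<N} (\<lambda>_. borel)) (\<lambda>s. \<lambda>j\<in>{..<N}. z (s ! j))"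
    by (elim exE conjE) (rule that, assumption, assumption, erule spec)
  interpret L: prob_space L by fact
  note [measurable_cong] = L(2)
  have spL[simp]: "space L = UNIV" using sets_eq_imp_space_eq[OF L(2)] by (simp add: space_PiM)
  have proj[measurable]: "(\<lambda>\<omega>. \<omega> j) \<in> L \<rightarrow>\<^sub>M borel" for j by measurable
  have res: "(\<lambda>\<omega>. restrict \<omega> {..<N}) \<in> L \<rightarrow>\<^sub>M PiM {..<N} (\<lambda>_. borel)" for N
    by (intro measurable_restrict) auto
  have dec: "(\<lambda>s. \<lambda>j\<in>{..<N}. z (s ! j)) \<in> measure_pmf (Q N) \<rightarrow>\<^sub>M PiM {..<N} (\<lambda>_. borel)" for N
    by (auto simp: measurable_count_space_eq1 space_PiM)
  have Lj: "(\<integral>\<omega>. f (\<omega> j) \<partial>L) = (\<integral>s. f (z (s ! j)) \<partial>measure_pmf (Q (Suc j)))"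
    if [measurable]: "f \<in> borel_measurable borel" for f :: "'b \<Rightarrow> real" and j
  proof -
    have m: "(\<lambda>\<omega>. f (\<omega> j)) \<in> borel_measurable (PiM {..<Suc j} (\<lambda>_. borel))" by measurable
    have "(\<integral>\<omega>. f (\<omega> j) \<partial>L) = (\<integral>\<omega>. f (\<omega> j) \<partial>distr L (PiM {..<Suc j} (\<lambda>_. borel)) (\<lambda>\<omega>. restrict \<omega> {..<Suc j}))"
      by (subst integral_distr[OF res m]) simp
    also have "\<dots> = (\<integral>s. f (z (s ! j)) \<partial>measure_pmf (Q (Suc j)))"
      unfolding LQ by (subst integral_distr[OF dec m]) simp
    finally show ?thesis .
  qed
  \<comment> \<open>Every genuine code word has this property because both decoded points are close
    to the coded one. On a countable space the masses of all sets converge, so probability 1 passes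
    to the limit law.\<close>
  have AEj: "AE \<omega> in L. dist (\<omega> j) (\<omega> (Suc j)) \<le> 2 * (1/2)^j" for j
  proof -
    let ?N = "Suc (Suc j)"
    let ?A = "{s. dist (z (s ! j)) (z (s ! Suc j)) \<le> 2 * (1/2)^j}"
    have "b ?N x \<in> ?A" for x
    proof -
      have "dist (z (a j x)) (z (a (Suc j) x)) \<le> dist x (z (a j x)) + dist x (z (a (Suc j) x))"
        by (rule dist_triangle3)
      also have "\<dots> \<le> (1/2)^j + (1/2)^Suc j" using a[of x j] a[of x "Suc j"] by linarith
      also have "\<dots> \<le> 2 * (1/2)^j" by simp
      finally show ?thesis by (simp add: b_nth)
    qed
    then have "(\<lambda>n. 1) \<longlonglongrightarrow> measure (measure_pmf (Q ?N)) ?A" using QA[of ?N ?A] P.prob_space by simp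
    then have "measure (measure_pmf (Q ?N)) ?A = 1" by (simp add: LIMSEQ_const_iff)
    then have AEQ: "AE s in measure_pmf (Q ?N). dist (z (s ! j)) (z (s ! Suc j)) \<le> 2 * (1/2)^j"
      using measure_pmf.AE_prob_1 by fastforce
    have ms: "{\<omega> \<in> space (PiM {..<?N} (\<lambda>_. borel :: 'b measure)). dist (\<omega> j) (\<omega> (Suc j)) \<le> 2 * (1/2)^j}
        \<in> sets (PiM {..<?N} (\<lambda>_. borel))" by measurable
    have "AE \<omega> in distr (measure_pmf (Q ?N)) (PiM {..<?N} (\<lambda>_. borel)) (\<lambda>s. \<lambda>j\<in>{..<?N}. z (s ! j)).
        dist (\<omega> j) (\<omega> (Suc j)) \<le> 2 * (1/2)^j"
      by (subst AE_distr_iff[OF dec ms]) (use AEQ in simp)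
    then show ?thesis
      unfolding LQ[symmetric] by (subst (asm) AE_distr_iff[OF res ms]) simp
  qed
  define G where "G = {\<omega> \<in> space L. \<forall>j. dist (\<omega> j) (\<omega> (Suc j)) \<le> 2 * (1/2)^j}"
  have [measurable]: "G \<in> sets L" unfolding G_def by measurable
  have AEG: "AE \<omega> in L. \<omega> \<in> G" using AEj by (simp add: G_def AE_all_countable)
  \<comment> \<open>The decoded point. The value \<open>z 0\<close> is a filler on the null set
    where the coordinates may fail to converge.\<close>
  define Y where "Y \<omega> = (if \<omega> \<in> G then lim \<omega> else z 0)" for \<omega>
  have Ylim: "\<omega> \<longlonglongrightarrow> Y \<omega>" "dist (\<omega> j) (Y \<omega>) \<le> 4 * (1/2)^j" if "\<omega> \<in> G" for \<omega> j
    using geometric_steps_converge[of \<omega>] that by (auto simp: G_def Y_def)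
  have Ym[measurable]: "Y \<in> L \<rightarrow>\<^sub>M borel"
  proof (rule borel_measurable_LIMSEQ_metric)
    fix j
    show "(\<lambda>\<omega>. if \<omega> \<in> G then \<omega> j else z 0) \<in> L \<rightarrow>\<^sub>M borel" by measurable
  next
    fix \<omega> show "(\<lambda>j. if \<omega> \<in> G then \<omega> j else z 0) \<longlonglongrightarrow> Y \<omega>"
      using Ylim(1)[of \<omega>] by (cases "\<omega> \<in> G") (auto simp: Y_def)
  qed
  define \<nu> where "\<nu> = distr L borel Y"
  have \<nu>: "\<nu> \<in> prob_measures"
    unfolding \<nu>_def by (intro prob_measuresI L.prob_space_distr) auto
  have "lipschitz_tendsto (\<lambda>n. \<mu> (r n)) \<nu>"
    unfolding lipschitz_tendsto_def
  proof (intro allI impI)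
    fix f :: "'b \<Rightarrow> real" and C
    assume lip: "C-lipschitz_on UNIV f" and bdd: "bounded (range f)"
    obtain B where B: "\<And>x. \<bar>f x\<bar> \<le> B" using bdd by (auto simp: bounded_iff)
    have fm[measurable]: "f \<in> borel_measurable borel" by (rule lipschitz_on_borel_measurable[OF lip])
    have C0: "0 \<le> C" by (rule lipschitz_on_nonneg[OF lip])
    have lipD: "\<bar>f x - f y\<bar> \<le> C * dist x y" for x y
      using lipschitz_onD[OF lip, of x y] by (simp add: dist_real_def)
    show "(\<lambda>n. \<integral>x. f x \<partial>\<mu> (r n)) \<longlonglongrightarrow> (\<integral>x. f x \<partial>\<nu>)"
    proof (rule LIMSEQ_I)
      fix e :: real assume e: "0 < e"
      \<comment> \<open>The error budget is \<open>C * (1/2)^j\<close> for coding under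
        \<open>\<mu> n\<close> and four times this for replacing the \<open>j\<close>-th coordinate
        by the limit, five in total. The divisor \<open>6 * C + 1\<close> dominates
        \<open>5 * C\<close> and is positive even for \<open>C = 0\<close>.\<close>
      have "0 < e / (6 * C + 1)" using e C0 by simp
      then obtain j where "(1/2::real)^j < e / (6 * C + 1)"
        using real_arch_pow_inv[of "e / (6 * C + 1)" "1/2"] by auto
      then have "(1/2)^j * (6 * C + 1) < e" using C0 by (simp add: pos_less_divide_eq)
      then have j: "5 * (C * (1/2)^j) < e"
      proof -
        have "5 * (C * (1/2::real)^j) \<le> (1/2)^j * (6 * C + 1)" using C0 by (simp add: algebra_simps)
        then show ?thesis using \<open>(1/2)^j * (6 * C + 1) < e\<close> by linarith
      qed
      have 1: "\<bar>(\<integral>x. f x \<partial>\<mu> n) - (\<integral>x. f (z (a j x)) \<partial>\<mu> n)\<bar> \<le> C * (1/2)^j" for n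
      proof (rule integral_diff_le_prob[OF P])
        show "integrable (\<mu> n) f" using B by (intro P.integrable_const_bound[of _ B] m\<mu> fm) auto
        have "(\<lambda>x. f (z (a j x))) \<in> borel_measurable (\<mu> n)"
          by (rule m\<mu>, rule measurable_compose[OF am[of j]]) simp
        then show "integrable (\<mu> n) (\<lambda>x. f (z (a j x)))" using B by (intro P.integrable_const_bound[of _ B]) auto
        have "\<bar>f x - f (z (a j x))\<bar> \<le> C * (1/2)^j" for x
          using lipD[of x "z (a j x)"] mult_left_mono[OF less_imp_le[OF a[of x j]] C0] by linarith
        then show "AE x in \<mu> n. \<bar>f x - f (z (a j x))\<bar> \<le> C * (1/2)^j" by simp
      qed
      have 2: "(\<integral>x. f (z (a j x)) \<partial>\<mu> n) = (\<integral>s. f (z (s ! j)) \<partial>MN n (Suc j))" for n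
        unfolding MN_def by (subst integral_distr[OF m\<mu>[OF bm]]) (auto simp: b_nth)
      have 3: "\<bar>(\<integral>\<omega>. f (\<omega> j) \<partial>L) - (\<integral>x. f x \<partial>\<nu>)\<bar> \<le> 4 * (C * (1/2)^j)"
      proof -
        have "(\<integral>x. f x \<partial>\<nu>) = (\<integral>\<omega>. f (Y \<omega>) \<partial>L)" unfolding \<nu>_def by (rule integral_distr) auto
        moreover have "\<bar>(\<integral>\<omega>. f (\<omega> j) \<partial>L) - (\<integral>\<omega>. f (Y \<omega>) \<partial>L)\<bar> \<le> 4 * (C * (1/2)^j)"
        proof (rule integral_diff_le_prob[OF L(1)])
          show "integrable L (\<lambda>\<omega>. f (\<omega> j))" "integrable L (\<lambda>\<omega>. f (Y \<omega>))"
            using B by (auto intro!: L.integrable_const_bound[of _ B])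
          show "AE \<omega> in L. \<bar>f (\<omega> j) - f (Y \<omega>)\<bar> \<le> 4 * (C * (1/2)^j)" using AEG
          proof eventually_elim
            fix \<omega> assume "\<omega> \<in> G"
            from Ylim(2)[OF this, of j] have "C * dist (\<omega> j) (Y \<omega>) \<le> C * (4 * (1/2)^j)"
              using C0 by (intro mult_left_mono) auto
            then show "\<bar>f (\<omega> j) - f (Y \<omega>)\<bar> \<le> 4 * (C * (1/2)^j)" using lipD[of "\<omega> j" "Y \<omega>"] by simp
          qed
        qed
        ultimately show ?thesis by simp
      qed
      have "(\<lambda>n. \<integral>s. f (z (s ! j)) \<partial>MN (r n) (Suc j)) \<longlonglongrightarrow> (\<integral>s. f (z (s ! j)) \<partial>measure_pmf (Q (Suc j)))"
        by (rule Q[of _ B]) (rule B)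
      then have "(\<lambda>n. \<integral>x. f (z (a j x)) \<partial>\<mu> (r n)) \<longlonglongrightarrow> (\<integral>\<omega>. f (\<omega> j) \<partial>L)"
        by (simp add: 2 Lj)
      from LIMSEQ_D[OF this, of "e - 5 * (C * (1/2)^j)"] j
      obtain no where no: "\<And>n. no \<le> n \<Longrightarrow> \<bar>(\<integral>x. f (z (a j x)) \<partial>\<mu> (r n)) - (\<integral>\<omega>. f (\<omega> j) \<partial>L)\<bar> < e - 5 * (C * (1/2)^j)"
        by auto
      show "\<exists>no. \<forall>n\<ge>no. norm ((\<integral>x. f x \<partial>\<mu> (r n)) - (\<integral>x. f x \<partial>\<nu>)) < e"
      proof (intro exI allI impI)
        fix n assume "no \<le> n"
        from no[OF this] 1[of "r n"] 3 show "norm ((\<integral>x. f x \<partial>\<mu> (r n)) - (\<integral>x. f x \<partial>\<nu>)) < e"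
          unfolding real_norm_def by linarith
      qed
    qed
  qed
  then show ?thesis by (rule that[OF r \<nu>])
qed

text \<open>Finite unions of balls around a dense sequence exhaust the space. One union that is
  large for the limit is large for almost all terms, as it is open; the finitely many remaining
  terms are handled one by one.\<close>

lemma lipschitz_tendsto_tight_by_balls:
  fixes \<mu> :: "nat \<Rightarrow> 'b::polish_space measure"
  assumes \<mu>: "\<And>n. \<mu> n \<in> prob_measures" and \<nu>: "\<nu> \<in> prob_measures"
    and conv: "lipschitz_tendsto \<mu> \<nu>"
  shows "tight_by_balls \<mu>"
  unfolding tight_by_balls_def
proof (intro allI impI)
  fix r \<epsilon> :: real assume r: "0 < r" and \<epsilon>: "0 < \<epsilon>"
  obtain D :: "'b set" where D: "countable D" "\<And>X. open X \<Longrightarrow> X \<noteq> {} \<Longrightarrow> \<exists>d\<in>D. d \<in> X"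
    by (rule countable_dense_setE) blast
  define z where "z = from_nat_into D"
  define U where "U m = (\<Union>i<m. ball (z i) r)" for m :: nat
  have oU: "open (U m)" for m by (auto simp: U_def)
  have Umono: "U m \<subseteq> U n" if "m \<le> n" for m n
    unfolding U_def using that by (intro UN_mono) auto
  have UU: "(\<Union>m. U m) = UNIV"
  proof (intro equalityI subsetI UNIV_I)
    fix x :: 'b
    have "ball x r \<noteq> {}" using r by simp
    then obtain d where "d \<in> D" "d \<in> ball x r" using D(2)[OF open_ball] by metis
    then obtain i where "x \<in> ball (z i) r" using from_nat_into_surj[OF D(1)] by (metis mem_ball z_def dist_commute)
    then show "x \<in> (\<Union>m. U m)" by (auto simp: U_def intro!: exI[of _ "Suc i"])
  qed
  have U_sets: "U m \<in> sets P" if "P \<in> prob_measures" for P m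
    using oU prob_measuresD(2)[OF that] by simp
  have compl: "measure P (- U m) = 1 - measure P (U m)" if "P \<in> prob_measures" for P m
  proof -
    interpret prob_space P by (rule prob_measuresD[OF that])
    show ?thesis using prob_compl[OF U_sets[OF that]] prob_measuresD(3)[OF that] by (simp add: Compl_eq_Diff_UNIV)
  qed
  have single: "\<exists>m. 1 - \<epsilon> < measure P (U m)" if P: "P \<in> prob_measures" for P
  proof -
    interpret prob_space P by (rule prob_measuresD[OF P])
    have "(\<lambda>m. measure P (U m)) \<longlonglongrightarrow> measure P (\<Union>m. U m)"
      using U_sets[OF P] Umono by (intro finite_Lim_measure_incseq) (auto simp: incseq_def)
    then have "(\<lambda>m. measure P (U m)) \<longlonglongrightarrow> 1"
      unfolding UU using prob_space prob_measuresD(3)[OF P] by simp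
    then have "\<forall>\<^sub>F m in sequentially. 1 - \<epsilon> < measure P (U m)" using \<epsilon> by (intro order_tendstoD) auto
    then show ?thesis by (auto simp: eventually_sequentially)
  qed
  obtain m0 where m0: "1 - \<epsilon> < measure \<nu> (U m0)" using single[OF \<nu>] by blast
  have "\<exists>N. \<forall>n\<ge>N. 1 - \<epsilon> < measure (\<mu> n) (U m0)"
  proof (cases "1 - \<epsilon> < 0")
    case True
    then show ?thesis by (intro exI[of _ 0]) (auto intro: less_le_trans[OF _ measure_nonneg])
  next
    case False
    interpret N: prob_space \<nu> by (rule prob_measuresD[OF \<nu>])
    have "ennreal (1 - \<epsilon>) < emeasure \<nu> (U m0)"
      unfolding N.emeasure_eq_measure using m0 False by (intro ennreal_lessI) auto
    from open_emeasure_lower[OF oU \<mu> \<nu> conv this] obtain N where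
      N: "\<And>n. N \<le> n \<Longrightarrow> ennreal (1 - \<epsilon>) < emeasure (\<mu> n) (U m0)" by (auto simp: eventually_sequentially)
    have "1 - \<epsilon> < measure (\<mu> n) (U m0)" if "N \<le> n" for n
    proof -
      interpret M: prob_space "\<mu> n" by (rule prob_measuresD[OF \<mu>])
      show ?thesis using N[OF that] False unfolding M.emeasure_eq_measure by (simp add: ennreal_less_iff)
    qed
    then show ?thesis by blast
  qed
  then obtain N where N: "\<And>n. N \<le> n \<Longrightarrow> 1 - \<epsilon> < measure (\<mu> n) (U m0)" by blast
  have "\<forall>n. \<exists>m. 1 - \<epsilon> < measure (\<mu> n) (U m)" using single[OF \<mu>] by blast
  then obtain m where m: "\<And>n. 1 - \<epsilon> < measure (\<mu> n) (U (m n))" by metis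
  \<comment> \<open>An upper bound for \<open>m0\<close> and all individual thresholds before
    \<open>N\<close>; the unions increase with their index.\<close>
  define K where "K = m0 + (\<Sum>n<N. m n)"
  have "1 - \<epsilon> < measure (\<mu> n) (U K)" for n
  proof -
    interpret M: prob_space "\<mu> n" by (rule prob_measuresD[OF \<mu>])
    have "\<exists>k\<le>K. 1 - \<epsilon> < measure (\<mu> n) (U k)"
    proof (cases "N \<le> n")
      case True then show ?thesis using N by (intro exI[of _ m0]) (auto simp: K_def)
    next
      case False
      then have "m n \<le> (\<Sum>n<N. m n)" by (intro member_le_sum) auto
      then show ?thesis using m by (intro exI[of _ "m n"]) (auto simp: K_def)
    qed
    then obtain k where k: "k \<le> K" "1 - \<epsilon> < measure (\<mu> n) (U k)" by blast
    have "measure (\<mu> n) (U k) \<le> measure (\<mu> n) (U K)"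
      using Umono[OF k(1)] U_sets[OF \<mu>] by (intro M.finite_measure_mono) auto
    then show ?thesis using k(2) by linarith
  qed
  then have "measure (\<mu> n) (- (\<Union>x\<in>z ` {..<K}. ball x r)) \<le> \<epsilon>" for n
    using compl[OF \<mu>, of n K] by (simp add: U_def less_imp_le diff_le_eq add.commute) (smt (verit))
  then show "\<exists>F. finite F \<and> (\<forall>n. measure (\<mu> n) (- (\<Union>x\<in>F. ball x r)) \<le> \<epsilon>)"
    by (intro exI[of _ "z ` {..<K}"]) auto
qed

section \<open>Tightness of couplings\<close>

lemma couplingsD:
  fixes \<mu> \<nu> :: "'b::polish_space measure"
  assumes "\<pi> \<in> couplings \<mu> \<nu>"
  shows "\<pi> \<in> prob_measures" "distr \<pi> borel fst = \<mu>" "distr \<pi> borel snd = \<nu>"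
  using assms by (auto simp: couplings_def)

lemma borel_measurable_fst_snd [measurable]:
  "fst \<in> (borel :: ('b::second_countable_topology \<times> 'c::second_countable_topology) measure) \<rightarrow>\<^sub>M borel"
  "snd \<in> (borel :: ('b::second_countable_topology \<times> 'c::second_countable_topology) measure) \<rightarrow>\<^sub>M borel"
  by (auto simp flip: borel_prod)

text \<open>A point outside all product balls has a coordinate outside the balls of half the radius,
  since the product distance is at most the sum of the coordinate distances. Each marginal then pays
  \<open>\<epsilon> / 2\<close>.\<close>

lemma couplings_tight_by_balls:
  fixes \<mu> \<nu> :: "nat \<Rightarrow> 'b::polish_space measure"
  assumes \<pi>: "\<And>n. \<pi> n \<in> couplings (\<mu> n) (\<nu> n)" and \<mu>: "tight_by_balls \<mu>" and \<nu>: "tight_by_balls \<nu>"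
  shows "tight_by_balls \<pi>"
  unfolding tight_by_balls_def
proof (intro allI impI)
  fix r \<epsilon> :: real assume r: "0 < r" and \<epsilon>: "0 < \<epsilon>"
  obtain F where F: "finite F" "\<And>n. measure (\<mu> n) (- (\<Union>x\<in>F. ball x (r/2))) \<le> \<epsilon>/2"
    using \<mu> r \<epsilon> unfolding tight_by_balls_def by (meson half_gt_zero)
  obtain H where H: "finite H" "\<And>n. measure (\<nu> n) (- (\<Union>x\<in>H. ball x (r/2))) \<le> \<epsilon>/2"
    using \<nu> r \<epsilon> unfolding tight_by_balls_def by (meson half_gt_zero)
  let ?A = "- (\<Union>x\<in>F. ball x (r/2))" and ?B = "- (\<Union>x\<in>H. ball x (r/2))"
  have AB: "?A \<in> sets borel" "?B \<in> sets borel"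
    by (intro borel_comp borel_open open_UN; simp)+
  have sub: "- (\<Union>p\<in>F \<times> H. ball p r) \<subseteq> (fst -` ?A) \<union> (snd -` ?B)"
  proof
    fix p assume p: "p \<in> - (\<Union>p\<in>F \<times> H. ball p r)"
    show "p \<in> (fst -` ?A) \<union> (snd -` ?B)"
    proof (rule ccontr)
      assume "\<not> ?thesis"
      then obtain x y where xy: "x \<in> F" "dist x (fst p) < r/2" "y \<in> H" "dist y (snd p) < r/2" by auto
      have "dist (x, y) p \<le> dist x (fst p) + dist y (snd p)"
        by (cases p) (simp add: dist_Pair_Pair sqrt_sum_squares_le_sum)
      then have "p \<in> ball (x, y) r" using xy by simp
      then show False using p xy by auto
    qed
  qed
  have "measure (\<pi> n) (- (\<Union>p\<in>F \<times> H. ball p r)) \<le> \<epsilon>" for n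
  proof -
    note pn = couplingsD[OF \<pi>[of n]]
    interpret prob_space "\<pi> n" by (rule prob_measuresD[OF pn(1)])
    note s = prob_measuresD(2,3)[OF pn(1)]
    have m: "fst \<in> \<pi> n \<rightarrow>\<^sub>M borel" "snd \<in> \<pi> n \<rightarrow>\<^sub>M borel"
      using s(1) by (simp_all cong: measurable_cong_sets)
    have ms: "fst -` ?A \<in> sets (\<pi> n)" "snd -` ?B \<in> sets (\<pi> n)"
      using measurable_sets[OF m(1) AB(1)] measurable_sets[OF m(2) AB(2)] s(2) by auto
    have "measure (\<pi> n) (fst -` ?A) = measure (\<mu> n) ?A"
      unfolding pn(2)[symmetric] using m(1) AB s(2) by (simp add: measure_distr)
    moreover have "measure (\<pi> n) (snd -` ?B) = measure (\<nu> n) ?B"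
      unfolding pn(3)[symmetric] using m(2) AB s(2) by (simp add: measure_distr)
    moreover have "measure (\<pi> n) (- (\<Union>p\<in>F \<times> H. ball p r)) \<le> measure (\<pi> n) ((fst -` ?A) \<union> (snd -` ?B))"
      using sub ms by (intro finite_measure_mono) auto
    moreover have "measure (\<pi> n) ((fst -` ?A) \<union> (snd -` ?B)) \<le> measure (\<pi> n) (fst -` ?A) + measure (\<pi> n) (snd -` ?B)"
      using ms by (rule measure_Un_le)
    ultimately show ?thesis using F(2)[of n] H(2)[of n] by linarith
  qed
  then show "\<exists>F. finite F \<and> (\<forall>n. measure (\<pi> n) (- (\<Union>x\<in>F. ball x r)) \<le> \<epsilon>)"
    using F(1) H(1) by (intro exI[of _ "F \<times> H"]) auto
qed

section \<open>Laplace bounds from the large deviation principle\<close>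

text \<open>Turns the statement about extended logarithms into a plain exponential bound. Sets of
  mass 0, whose logarithm is minus infinity, satisfy it trivially.\<close>

lemma LDP_closed_upper:
  assumes ldp: "large_deviation_principle \<gamma> I" and A: "closed A"
    and b: "\<And>y. y \<in> A \<Longrightarrow> ennreal b \<le> I y" and \<delta>: "0 < \<delta>" and b0: "0 \<le> b"
  shows "\<forall>\<^sub>F k in sequentially. measure (\<gamma> k) A \<le> exp (- (real k * (b - \<delta>)))"
proof -
  let ?u = "\<lambda>k. ereal (1 / real k) * ext_ln (measure (\<gamma> k) A)"
  have "limsup ?u \<le> - enn2ereal (INF x\<in>closure A. I x)"
    by (rule conjunct2[OF bspec[OF conjunct2[OF ldp[unfolded large_deviation_principle_def]] borel_closed[OF A]]])
  also have "\<dots> \<le> - ereal b"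
  proof -
    have "ennreal b \<le> (INF x\<in>closure A. I x)" using b A by (intro INF_greatest) (simp add: closure_closed)
    then have "ereal b \<le> enn2ereal (INF x\<in>closure A. I x)"
      using enn2ereal_ennreal[OF b0] by (simp add: less_eq_ennreal.rep_eq)
    then show ?thesis by (rule ereal_minus_le_minus[THEN iffD2])
  qed
  also have "\<dots> < ereal (- (b - \<delta>))" using \<delta> by simp
  finally have "\<forall>\<^sub>F k in sequentially. ?u k < ereal (- (b - \<delta>))" by (rule Limsup_lessD)
  then show ?thesis using eventually_gt_at_top[of 0]
  proof eventually_elim
    fix k :: nat assume u: "?u k < ereal (- (b - \<delta>))" and k: "0 < k"
    show "measure (\<gamma> k) A \<le> exp (- (real k * (b - \<delta>)))"
    proof (cases "measure (\<gamma> k) A = 0")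
      case False
      then have m: "0 < measure (\<gamma> k) A" by (simp add: zero_less_measure_iff)
      have "1 / real k * ln (measure (\<gamma> k) A) < - (b - \<delta>)" using u False by (simp add: ext_ln_def)
      then have "ln (measure (\<gamma> k) A) < - (real k * (b - \<delta>))" using k by (simp add: field_simps)
      then have "exp (ln (measure (\<gamma> k) A)) < exp (- (real k * (b - \<delta>)))" by (subst exp_less_cancel_iff)
      then show ?thesis using m by simp
    qed simp
  qed
qed

lemma LDP_open_lower:
  assumes ldp: "large_deviation_principle \<gamma> I" and A: "open A" "y \<in> A"
    and b: "I y = ennreal b" "0 \<le> b" and \<delta>: "0 < \<delta>"
  shows "\<forall>\<^sub>F k in sequentially. exp (- (real k * (b + \<delta>))) \<le> measure (\<gamma> k) A"
proof -
  let ?u = "\<lambda>k. ereal (1 / real k) * ext_ln (measure (\<gamma> k) A)"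
  have "ereal (- (b + \<delta>)) < - ereal b" using \<delta> by simp
  also have "\<dots> \<le> - enn2ereal (INF x\<in>interior A. I x)"
  proof -
    have "(INF x\<in>interior A. I x) \<le> ennreal b" using A b by (intro INF_lower2[of y]) (auto simp: interior_open)
    then have "enn2ereal (INF x\<in>interior A. I x) \<le> ereal b"
      using enn2ereal_ennreal[OF b(2)] by (simp add: less_eq_ennreal.rep_eq)
    then show ?thesis by (rule ereal_minus_le_minus[THEN iffD2])
  qed
  also have "\<dots> \<le> liminf ?u"
    by (rule conjunct1[OF bspec[OF conjunct2[OF ldp[unfolded large_deviation_principle_def]] borel_open[OF A(1)]]])
  finally have "\<forall>\<^sub>F k in sequentially. ereal (- (b + \<delta>)) < ?u k" by (rule less_LiminfD)
  then show ?thesis using eventually_gt_at_top[of 0]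
  proof eventually_elim
    fix k :: nat assume u: "ereal (- (b + \<delta>)) < ?u k" and k: "0 < k"
    have nz: "measure (\<gamma> k) A \<noteq> 0"
    proof
      assume "measure (\<gamma> k) A = 0"
      then have "?u k = - \<infinity>" using k by (simp add: ext_ln_def)
      then show False using u by simp
    qed
    then have m: "0 < measure (\<gamma> k) A" by (simp add: zero_less_measure_iff)
    have "- (b + \<delta>) < 1 / real k * ln (measure (\<gamma> k) A)" using u nz by (simp add: ext_ln_def)
    then have "- (real k * (b + \<delta>)) < ln (measure (\<gamma> k) A)" using k by (simp add: field_simps)
    then have "exp (- (real k * (b + \<delta>))) < exp (ln (measure (\<gamma> k) A))" by (subst exp_less_cancel_iff)
    then show "exp (- (real k * (b + \<delta>))) \<le> measure (\<gamma> k) A" using m by simp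
  qed
qed

text \<open>Upper half of Varadhan's lemma when the test function stays below the rate, so that the
  exponential growth rate is at most 0. On the level set where \<open>\<phi>\<close> is at least
  \<open>i * \<delta>\<close> the rate is at least that large too, and the growth of the integrand
  is compensated by the decay of the mass.\<close>

lemma LDP_exp_integral_upper:
  fixes \<phi> :: "'b::polish_space \<Rightarrow> real"
  assumes ldp: "large_deviation_principle \<gamma> I" and \<gamma>: "\<And>k. 1 \<le> k \<Longrightarrow> \<gamma> k \<in> prob_measures"
    and \<phi>: "continuous_on UNIV \<phi>" "\<And>y. 0 \<le> \<phi> y" "\<And>y. \<phi> y \<le> m" "\<And>y. ennreal (\<phi> y) \<le> I y"
    and \<epsilon>: "0 < \<epsilon>"
  shows "\<forall>\<^sub>F k in sequentially. (\<integral>y. exp (real k * \<phi> y) \<partial>\<gamma> k) \<le> exp (real k * \<epsilon>)"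
proof -
  \<comment> \<open>Three \<delta> are spent: one for the width of a layer, one for the slack in the
    large deviation bound, one for absorbing the number of layers into
    \<open>exp (k * \<delta>)\<close>.\<close>
  define \<delta> where "\<delta> = \<epsilon> / 4"
  have \<delta>: "0 < \<delta>" "\<epsilon> = 4 * \<delta>" using \<epsilon> by (auto simp: \<delta>_def)
  define N where "N = nat \<lceil>m / \<delta>\<rceil>"
  define A where "A i = {y. real i * \<delta> \<le> \<phi> y}" for i
  have Acl: "closed (A i)" for i
    unfolding A_def by (intro closed_Collect_le continuous_intros \<phi>)
  have "\<forall>\<^sub>F k in sequentially. measure (\<gamma> k) (A i) \<le> exp (- (real k * (real i * \<delta> - \<delta>)))" for i
  proof (rule LDP_closed_upper[OF ldp Acl _ \<delta>(1)])
    show "ennreal (real i * \<delta>) \<le> I y" if "y \<in> A i" for y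
      using that order_trans[OF ennreal_leI \<phi>(4)] by (auto simp: A_def)
  qed (use \<delta> in simp)
  then have ev1: "\<forall>\<^sub>F k in sequentially. \<forall>i\<in>{..N}. measure (\<gamma> k) (A i) \<le> exp (- (real k * (real i * \<delta> - \<delta>)))"
    by (intro eventually_ball_finite) auto
  have ev2: "\<forall>\<^sub>F k in sequentially. real (Suc N) \<le> exp (real k * \<delta>)"
  proof -
    have "filterlim (\<lambda>k. exp (real k * \<delta>)) at_top sequentially"
      using \<delta>(1) by real_asymp
    then show ?thesis by (simp add: filterlim_at_top)
  qed
  show ?thesis using ev1 ev2 eventually_ge_at_top[of 1]
  proof eventually_elim
    fix k :: nat assume 1: "\<forall>i\<in>{..N}. measure (\<gamma> k) (A i) \<le> exp (- (real k * (real i * \<delta> - \<delta>)))"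
      and 2: "real (Suc N) \<le> exp (real k * \<delta>)" and k: "1 \<le> k"
    note p = prob_measuresD[OF \<gamma>[OF k]]
    interpret prob_space "\<gamma> k" by (rule p)
    have As: "A i \<in> sets (\<gamma> k)" for i using Acl p(2) by (simp add: borel_closed)
    have bound: "exp (real k * \<phi> y) \<le> (\<Sum>i\<le>N. exp (real k * (real (Suc i) * \<delta>)) * indicator (A i) y)" for y
    proof -
      \<comment> \<open>The layer of \<open>y\<close>: its value lies between
        \<open>i * \<delta>\<close> and \<open>Suc i * \<delta>\<close>.\<close>
      define i where "i = nat \<lfloor>\<phi> y / \<delta>\<rfloor>"
      have q: "0 \<le> \<phi> y / \<delta>" using \<phi>(2) \<delta>(1) by simp
      have i1: "real i \<le> \<phi> y / \<delta>" "\<phi> y / \<delta> < real (Suc i)"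
        using q by (simp_all add: i_def) linarith
      have i2: "real i * \<delta> \<le> \<phi> y" "\<phi> y \<le> real (Suc i) * \<delta>"
        using i1 \<delta>(1) by (auto simp: field_simps)
      have "\<phi> y / \<delta> \<le> m / \<delta>" using \<phi>(3) \<delta>(1) by (simp add: divide_right_mono)
      then have iN: "i \<le> N" unfolding i_def N_def by (meson floor_le_ceiling floor_mono nat_mono order_trans)
      have "exp (real k * \<phi> y) \<le> exp (real k * (real (Suc i) * \<delta>)) * indicator (A i) y"
        using i2 by (auto simp: A_def intro: mult_left_mono)
      also have "\<dots> \<le> (\<Sum>i\<le>N. exp (real k * (real (Suc i) * \<delta>)) * indicator (A i) y)"
        using iN by (intro member_le_sum) auto
      finally show ?thesis .
    qed
    have im: "integrable (\<gamma> k) (\<lambda>y. exp (real k * \<phi> y))"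
    proof (rule integrable_bounded_prob[OF \<gamma>[OF k]])
      show "(\<lambda>y. exp (real k * \<phi> y)) \<in> borel_measurable borel"
        by (intro borel_measurable_continuous_onI continuous_intros \<phi>)
      show "\<bar>exp (real k * \<phi> y)\<bar> \<le> exp (real k * m)" for y
        using \<phi>(3) by (simp add: mult_left_mono)
    qed
    have "(\<integral>y. exp (real k * \<phi> y) \<partial>\<gamma> k) \<le> (\<integral>y. (\<Sum>i\<le>N. exp (real k * (real (Suc i) * \<delta>)) * indicator (A i) y) \<partial>\<gamma> k)"
      using As bound im
      by (intro integral_mono Bochner_Integration.integrable_sum integrable_mult_right integrable_real_indicator)
         (auto simp: less_top[symmetric])
    also have "\<dots> = (\<Sum>i\<le>N. exp (real k * (real (Suc i) * \<delta>)) * measure (\<gamma> k) (A i))"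
    proof (subst Bochner_Integration.integral_sum)
      show "integrable (\<gamma> k) (\<lambda>y. exp (real k * (real (Suc i) * \<delta>)) * indicator (A i) y)" for i
        using As by (intro integrable_mult_right integrable_real_indicator) (auto simp: less_top[symmetric])
    qed (use p(3) in simp)
    also have "\<dots> \<le> (\<Sum>i\<le>N. exp (real k * (real (Suc i) * \<delta>)) * exp (- (real k * (real i * \<delta> - \<delta>))))"
      using 1 by (intro sum_mono mult_left_mono) auto
    also have "\<dots> = (\<Sum>i\<le>N. exp (real k * (2 * \<delta>)))"
      by (intro sum.cong) (simp_all add: exp_add[symmetric] algebra_simps)
    also have "\<dots> = real (Suc N) * exp (real k * (2 * \<delta>))" by simp
    also have "\<dots> \<le> exp (real k * \<delta>) * exp (real k * (2 * \<delta>))" using 2 by (intro mult_right_mono) auto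
    also have "\<dots> = exp (real k * (3 * \<delta>))" by (simp add: exp_add[symmetric] algebra_simps)
    also have "\<dots> \<le> exp (real k * \<epsilon>)" using \<delta> by (simp add: mult_left_mono)
    finally show "(\<integral>y. exp (real k * \<phi> y) \<partial>\<gamma> k) \<le> exp (real k * \<epsilon>)" .
  qed
qed

text \<open>The construction of \<open>joint_law\<close> with two possibly different spaces.
  Resampling needs it with pairs \<open>(x, y)\<close> as base points.\<close>

definition kernel_law :: "'b::second_countable_topology measure \<Rightarrow> ('b \<Rightarrow> 'c::second_countable_topology measure) \<Rightarrow> ('b \<times> 'c) measure"
  where "kernel_law \<mu> \<kappa> = \<mu> \<bind> (\<lambda>x. \<kappa> x \<bind> (\<lambda>y. return borel (x, y)))"

lemma joint_law_eq_kernel_law: "joint_law \<mu> \<kappa> = kernel_law \<mu> \<kappa>"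
  by (simp add: joint_law_def kernel_law_def)

lemma kernel_return_measurable:
  fixes \<kappa> :: "'b::second_countable_topology \<Rightarrow> 'c::second_countable_topology measure"
  assumes \<kappa>: "\<kappa> \<in> borel \<rightarrow>\<^sub>M prob_algebra borel"
  shows "(\<lambda>x. \<kappa> x \<bind> (\<lambda>y. return borel (x, y))) \<in> borel \<rightarrow>\<^sub>M prob_algebra (borel :: ('b \<times> 'c) measure)"
proof -
  note [measurable] = \<kappa>
  show ?thesis
    unfolding borel_prod[symmetric]
    by (intro measurable_bind_prob_space2[where N = borel]) measurable
qed

lemma kernel_law_in_prob_measures:
  fixes \<kappa> :: "'b::second_countable_topology \<Rightarrow> 'c::second_countable_topology measure"
  assumes \<mu>: "\<mu> \<in> prob_measures" and \<kappa>: "\<kappa> \<in> borel \<rightarrow>\<^sub>M prob_algebra borel"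
  shows "kernel_law \<mu> \<kappa> \<in> prob_measures"
proof -
  note [measurable] = kernel_return_measurable[OF \<kappa>]
  have "(\<lambda>M. M \<bind> (\<lambda>x. \<kappa> x \<bind> (\<lambda>y. return borel (x, y))))
      \<in> prob_algebra borel \<rightarrow>\<^sub>M prob_algebra (borel :: ('b \<times> 'c) measure)"
    by (intro measurable_bind_prob_space2[where N = borel]) measurable
  from measurable_space[OF this \<mu>] show ?thesis
    by (simp add: kernel_law_def)
qed

lemma kernel_in_prob_measures:
  assumes \<kappa>: "\<kappa> \<in> borel \<rightarrow>\<^sub>M prob_algebra borel"
  shows "\<kappa> x \<in> prob_measures"
  using measurable_space[OF \<kappa>, of x] by simp

lemma nn_integral_kernel_law:
  fixes \<kappa> :: "'b::second_countable_topology \<Rightarrow> 'c::second_countable_topology measure"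
  assumes \<mu>: "\<mu> \<in> prob_measures" and \<kappa>: "\<kappa> \<in> borel \<rightarrow>\<^sub>M prob_algebra borel"
    and f: "f \<in> borel_measurable (borel :: ('b \<times> 'c) measure)"
  shows "(\<integral>\<^sup>+z. f z \<partial>kernel_law \<mu> \<kappa>) = (\<integral>\<^sup>+x. \<integral>\<^sup>+y. f (x, y) \<partial>\<kappa> x \<partial>\<mu>)"
proof -
  have s: "sets \<mu> = sets borel" by (rule prob_measuresD[OF \<mu>])
  have "(\<integral>\<^sup>+z. f z \<partial>kernel_law \<mu> \<kappa>) = (\<integral>\<^sup>+x. \<integral>\<^sup>+z. f z \<partial>(\<kappa> x \<bind> (\<lambda>y. return borel (x, y))) \<partial>\<mu>)"
    unfolding kernel_law_def
    by (rule nn_integral_bind[OF f])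
       (use measurable_prob_algebraD[OF kernel_return_measurable[OF \<kappa>]] s in \<open>simp cong: measurable_cong_sets\<close>)
  also have "\<dots> = (\<integral>\<^sup>+x. \<integral>\<^sup>+y. f (x, y) \<partial>\<kappa> x \<partial>\<mu>)"
  proof (rule nn_integral_cong)
    fix x
    have m: "(\<lambda>y. return borel (x, y)) \<in> \<kappa> x \<rightarrow>\<^sub>M subprob_algebra (borel :: ('b \<times> 'c) measure)"
    proof -
      have "(\<lambda>y. return borel (x, y)) \<in> borel \<rightarrow>\<^sub>M subprob_algebra (borel :: ('b \<times> 'c) measure)"
        unfolding borel_prod[symmetric] by measurable
      then show ?thesis using prob_measuresD(2)[OF kernel_in_prob_measures[OF \<kappa>]] by (simp cong: measurable_cong_sets)
    qed
    show "(\<integral>\<^sup>+z. f z \<partial>(\<kappa> x \<bind> (\<lambda>y. return borel (x, y)))) = (\<integral>\<^sup>+y. f (x, y) \<partial>\<kappa> x)"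
      by (subst nn_integral_bind[OF f m]) (simp add: nn_integral_return f)
  qed
  finally show ?thesis .
qed

lemma nn_integral_kernel_measurable:
  fixes \<kappa> :: "'b::second_countable_topology \<Rightarrow> 'c::second_countable_topology measure"
  assumes \<kappa>: "\<kappa> \<in> borel \<rightarrow>\<^sub>M prob_algebra borel"
    and "f \<in> borel_measurable (borel :: ('b \<times> 'c) measure)"
  shows "(\<lambda>x. \<integral>\<^sup>+y. f (x, y) \<partial>\<kappa> x) \<in> borel_measurable borel"
  using assms(2) measurable_prob_algebraD[OF \<kappa>] unfolding borel_prod[symmetric]
  by (intro nn_integral_measurable_subprob_algebra2[where N=borel]) auto

section \<open>Lower bound for the scaled entropy\<close>

lemma integral_couplings_fst:
  fixes f :: "'b::polish_space \<Rightarrow> real"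
  assumes "\<pi> \<in> couplings \<mu> \<nu>" "f \<in> borel_measurable borel"
  shows "(\<integral>z. f (fst z) \<partial>\<pi>) = (\<integral>x. f x \<partial>\<mu>)"
proof -
  have m: "fst \<in> \<pi> \<rightarrow>\<^sub>M borel"
    using prob_measuresD(2)[OF couplingsD(1)[OF assms(1)]] by (simp cong: measurable_cong_sets)
  show ?thesis unfolding couplingsD(2)[OF assms(1), symmetric] by (rule integral_distr[OF m assms(2), symmetric])
qed

text \<open>The error \<open>e\<close> depends on neither \<pi> nor its second marginal: it is the
  integral of the normalised log-Laplace transform \<open>\<Lambda> k\<close>, a function of the
  first coordinate, whose law is always \<open>\<mu>\<^sub>0\<close>. Pointwise convergence of
  \<open>\<Lambda> k\<close> to 0 comes from the large deviation principle, and the bound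
  \<open>m\<close> on \<open>\<phi>\<close> dominates.\<close>

lemma S_cost_lower_bound:
  fixes \<mu>\<^sub>0 :: "'b::polish_space measure" and \<phi> :: "'b \<times> 'b \<Rightarrow> real"
  assumes kernel: "\<And>k. 1 \<le> k \<Longrightarrow> \<rho> k \<in> borel \<rightarrow>\<^sub>M prob_algebra borel"
    and ldp: "\<And>x. large_deviation_principle (\<lambda>k. \<rho> k x) (\<lambda>y. c (x, y))"
    and \<mu>0: "\<mu>\<^sub>0 \<in> prob_measures"
    and \<phi>: "continuous_on UNIV \<phi>" "\<And>z. 0 \<le> \<phi> z" "\<And>z. \<phi> z \<le> m" "\<And>z. ennreal (\<phi> z) \<le> c z"
  obtains e :: "nat \<Rightarrow> real" where "e \<longlonglongrightarrow> 0"
    "\<And>k \<pi> \<nu>. 1 \<le> k \<Longrightarrow> \<pi> \<in> couplings \<mu>\<^sub>0 \<nu> \<Longrightarrow> ereal ((\<integral>z. \<phi> z \<partial>\<pi>) - e k) \<le> S_cost \<rho> \<mu>\<^sub>0 k \<pi>"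
proof -
  interpret M0: prob_space \<mu>\<^sub>0 by (rule prob_measuresD[OF \<mu>0])
  have [measurable]: "\<phi> \<in> borel_measurable borel" by (rule borel_measurable_continuous_onI[OF \<phi>(1)])
  have m0: "0 \<le> m" using \<phi>(2,3) order_trans by blast
  have \<phi>x: "continuous_on UNIV (\<lambda>y. \<phi> (x, y))" for x
    by (rule continuous_on_compose2[OF \<phi>(1)]) (auto intro!: continuous_intros)
  have \<rho>p: "\<rho> k x \<in> prob_measures" if "1 \<le> k" for k x
    by (rule kernel_in_prob_measures[OF kernel[OF that]])
  have mexp: "(\<lambda>y. exp (real k * \<phi> (x, y))) \<in> borel_measurable borel" for k x
    by (intro borel_measurable_continuous_onI continuous_intros \<phi>x)
  have bexp: "\<bar>exp (real k * \<phi> z)\<bar> \<le> exp (real k * m)" for k z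
    using \<phi>(3) by (simp add: mult_left_mono)
  define Z where "Z k x = (\<integral>y. exp (real k * \<phi> (x, y)) \<partial>\<rho> k x)" for k x
  \<comment> \<open>Index 0 is set to 0 because nothing is assumed about \<open>\<rho> 0\<close>;
    this keeps \<open>\<Lambda>\<close> measurable and bounded for all indices.\<close>
  define \<Lambda> where "\<Lambda> k x = (if 1 \<le> k then ln (Z k x) / real k else 0)" for k x
  have Zint: "integrable (\<rho> k x) (\<lambda>y. exp (real k * \<phi> (x, y)))" if "1 \<le> k" for k x
    by (rule integrable_bounded_prob[OF \<rho>p[OF that] mexp bexp])
  have Z_nn: "(\<integral>\<^sup>+y. ennreal (exp (real k * \<phi> (x, y))) \<partial>\<rho> k x) = ennreal (Z k x)" if "1 \<le> k" for k x
    unfolding Z_def by (rule nn_integral_eq_integral[OF Zint[OF that]]) simp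
  have Z1: "1 \<le> Z k x" and Zm: "Z k x \<le> exp (real k * m)" if "1 \<le> k" for k x
  proof -
    interpret prob_space "\<rho> k x" by (rule prob_measuresD[OF \<rho>p[OF that]])
    have "(\<integral>y. 1 \<partial>\<rho> k x) \<le> Z k x" unfolding Z_def using \<phi>(2) by (intro integral_mono Zint that) auto
    then show "1 \<le> Z k x" by (simp add: prob_space)
    have "Z k x \<le> (\<integral>y. exp (real k * m) \<partial>\<rho> k x)" unfolding Z_def using \<phi>(3) by (intro integral_mono Zint that) (auto simp: mult_left_mono)
    then show "Z k x \<le> exp (real k * m)" by (simp add: prob_space)
  qed
  have \<Lambda>0: "0 \<le> \<Lambda> k x" for k x using Z1[of k x] by (auto simp: \<Lambda>_def)
  have \<Lambda>_le: "\<Lambda> k x \<le> b" if "Z k x \<le> exp (real k * b)" "1 \<le> k" for k x b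
  proof -
    have "ln (Z k x) \<le> ln (exp (real k * b))" using that Z1[OF that(2), of x] by (subst ln_le_cancel_iff) auto
    then show ?thesis using that(2) by (simp add: \<Lambda>_def field_simps)
  qed
  have \<Lambda>m: "\<Lambda> k x \<le> m" for k x
    using \<Lambda>_le[OF Zm] m0 by (cases "1 \<le> k") (auto simp: \<Lambda>_def)
  have Zmeas: "Z k \<in> borel_measurable borel" if "1 \<le> k" for k
  proof -
    have [measurable]: "(\<lambda>x. \<integral>\<^sup>+y. ennreal (exp (real k * \<phi> (x, y))) \<partial>\<rho> k x) \<in> borel_measurable borel"
      by (rule nn_integral_kernel_measurable[OF kernel[OF that]]) measurable
    have "(\<lambda>x. enn2real (\<integral>\<^sup>+y. ennreal (exp (real k * \<phi> (x, y))) \<partial>\<rho> k x)) \<in> borel_measurable borel"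
      by measurable
    moreover have "enn2real (\<integral>\<^sup>+y. ennreal (exp (real k * \<phi> (x, y))) \<partial>\<rho> k x) = Z k x" for x
      unfolding Z_nn[OF that] using Z1[OF that, of x] by simp
    ultimately show ?thesis by simp
  qed
  have \<Lambda>meas[measurable]: "\<Lambda> k \<in> borel_measurable borel" for k
  proof (cases "1 \<le> k")
    case True
    note [measurable] = Zmeas[OF True]
    show ?thesis using True by (simp add: \<Lambda>_def[abs_def])
  next
    case False
    then show ?thesis by (simp add: \<Lambda>_def[abs_def])
  qed
  have \<Lambda>lim: "(\<lambda>k. \<Lambda> k x) \<longlonglongrightarrow> 0" for x
  proof (rule order_tendstoI)
    fix a :: real assume "0 < a"
    then have a2: "0 < a / 2" by simp
    have "\<forall>\<^sub>F k in sequentially. Z k x \<le> exp (real k * (a / 2))"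
      unfolding Z_def by (rule LDP_exp_integral_upper[OF ldp \<rho>p \<phi>x \<phi>(2) \<phi>(3) \<phi>(4) a2])
    then show "\<forall>\<^sub>F k in sequentially. \<Lambda> k x < a" using eventually_ge_at_top[of 1]
    proof eventually_elim
      fix k assume "Z k x \<le> exp (real k * (a / 2))" "1 \<le> k"
      from \<Lambda>_le[OF this] show "\<Lambda> k x < a" using a2 by simp
    qed
  qed (auto intro!: always_eventually less_le_trans[OF _ \<Lambda>0])
  define e where "e k = (\<integral>x. \<Lambda> k x \<partial>\<mu>\<^sub>0)" for k
  have \<Lambda>meas0: "\<Lambda> k \<in> borel_measurable \<mu>\<^sub>0" for k
    using \<Lambda>meas prob_measuresD(2)[OF \<mu>0] by (simp cong: measurable_cong_sets)
  have "e \<longlonglongrightarrow> (\<integral>x. 0 \<partial>\<mu>\<^sub>0)"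
    unfolding e_def
  proof (rule integral_dominated_convergence[where w="\<lambda>_. m"])
    show "AE x in \<mu>\<^sub>0. norm (\<Lambda> k x) \<le> m" for k using \<Lambda>0 \<Lambda>m by simp
  qed (use \<Lambda>lim \<Lambda>meas0 in auto)
  then have e0: "e \<longlonglongrightarrow> 0" by simp
  have "ereal ((\<integral>z. \<phi> z \<partial>\<pi>) - e k) \<le> S_cost \<rho> \<mu>\<^sub>0 k \<pi>"
    if k: "1 \<le> k" and \<pi>: "\<pi> \<in> couplings \<mu>\<^sub>0 \<nu>" for k \<pi> \<nu>
  proof -
    let ?R = "joint_law \<mu>\<^sub>0 (\<rho> k)"
    have R: "?R \<in> prob_measures" by (rule joint_law_in_prob_measures[OF \<mu>0 kernel[OF k]])
    note \<pi>p = couplingsD(1)[OF \<pi>]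
    \<comment> \<open>Subtracting the log-Laplace transform in each fibre makes the conditional
      integral of \<open>exp \<psi>\<close> equal to 1 for every \<open>x\<close>. In
      \<open>rel_entropy_ge\<close> the last two terms then cancel.\<close>
    define \<psi> where "\<psi> z = real k * \<phi> z - real k * \<Lambda> k (fst z)" for z
    have \<psi>m[measurable]: "\<psi> \<in> borel_measurable borel"
      unfolding \<psi>_def by measurable
    have \<psi>b: "\<bar>\<psi> z\<bar> \<le> real k * m" for z
    proof -
      have "\<bar>\<phi> z - \<Lambda> k (fst z)\<bar> \<le> m" using \<phi>(2,3)[of z] \<Lambda>0[of k "fst z"] \<Lambda>m[of k "fst z"] by (auto simp: abs_le_iff)
      then have "real k * \<bar>\<phi> z - \<Lambda> k (fst z)\<bar> \<le> real k * m" by (intro mult_left_mono) auto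
      then show ?thesis by (simp add: \<psi>_def abs_mult flip: right_diff_distrib)
    qed
    have one: "(\<integral>\<^sup>+z. ennreal (exp (\<psi> z)) \<partial>?R) = 1"
    proof -
      have "(\<integral>\<^sup>+z. ennreal (exp (\<psi> z)) \<partial>?R) = (\<integral>\<^sup>+x. \<integral>\<^sup>+y. ennreal (exp (\<psi> (x, y))) \<partial>\<rho> k x \<partial>\<mu>\<^sub>0)"
        unfolding joint_law_eq_kernel_law by (rule nn_integral_kernel_law[OF \<mu>0 kernel[OF k]]) measurable
      also have "\<dots> = (\<integral>\<^sup>+x. 1 \<partial>\<mu>\<^sub>0)"
      proof (rule nn_integral_cong)
        fix x
        have m1: "(\<lambda>y. ennreal (exp (real k * \<phi> (x, y)))) \<in> borel_measurable (\<rho> k x)"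
          using measurable_compose[OF mexp measurable_ennreal]
          unfolding measurable_cong_sets[OF prob_measuresD(2)[OF \<rho>p[OF k]] refl] .
        have "(\<integral>\<^sup>+y. ennreal (exp (\<psi> (x, y))) \<partial>\<rho> k x)
            = (\<integral>\<^sup>+y. ennreal (exp (real k * \<phi> (x, y))) * ennreal (exp (- (real k * \<Lambda> k x))) \<partial>\<rho> k x)"
          by (intro nn_integral_cong) (simp add: \<psi>_def exp_diff exp_minus divide_inverse flip: ennreal_mult)
        also have "\<dots> = ennreal (Z k x) * ennreal (exp (- (real k * \<Lambda> k x)))"
          unfolding nn_integral_multc[OF m1] Z_nn[OF k] ..
        also have "\<dots> = 1"
          using Z1[OF k, of x] k by (simp add: \<Lambda>_def exp_minus flip: ennreal_mult)
        finally show "(\<integral>\<^sup>+y. ennreal (exp (\<psi> (x, y))) \<partial>\<rho> k x) = 1" .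
      qed
      also have "\<dots> = 1" by (simp add: M0.emeasure_space_1)
      finally show ?thesis .
    qed
    have "(\<integral>z. exp (\<psi> z) \<partial>?R) = enn2real (\<integral>\<^sup>+z. ennreal (exp (\<psi> z)) \<partial>?R)"
    proof (rule integral_eq_nn_integral)
      have "(\<lambda>z. exp (\<psi> z)) \<in> borel_measurable borel" by measurable
      then show "(\<lambda>z. exp (\<psi> z)) \<in> borel_measurable ?R" using prob_measuresD(2)[OF R] by (simp cong: measurable_cong_sets)
    qed simp
    then have i1: "(\<integral>z. exp (\<psi> z) \<partial>?R) = 1" unfolding one by simp
    have "\<psi> \<in> borel_measurable ?R" using \<psi>m prob_measuresD(2)[OF R] by (simp cong: measurable_cong_sets)
    from rel_entropy_ge[OF prob_measuresD(1)[OF R] prob_measuresD(1)[OF \<pi>p] _ this \<psi>b]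
    have H: "ereal (\<integral>z. \<psi> z \<partial>\<pi>) \<le> rel_entropy \<pi> ?R"
      unfolding i1 using prob_measuresD(2)[OF R] prob_measuresD(2)[OF \<pi>p] by simp
    have i\<phi>: "integrable \<pi> \<phi>" using \<phi>(2,3) by (intro integrable_bounded_prob[OF \<pi>p, where B=m]) auto
    have i\<Lambda>: "integrable \<pi> (\<lambda>z. \<Lambda> k (fst z))"
      using \<Lambda>0 \<Lambda>m by (intro integrable_bounded_prob[OF \<pi>p, where B=m]) auto
    have "(\<integral>z. \<psi> z \<partial>\<pi>) = real k * ((\<integral>z. \<phi> z \<partial>\<pi>) - e k)"
      unfolding \<psi>_def e_def integral_couplings_fst[OF \<pi> \<Lambda>meas, symmetric]
      using i\<phi> i\<Lambda> by (simp add: right_diff_distrib)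
    then have "ereal (real k * ((\<integral>z. \<phi> z \<partial>\<pi>) - e k)) \<le> rel_entropy \<pi> ?R" using H by simp
    then have "ereal (1 / real k) * ereal (real k * ((\<integral>z. \<phi> z \<partial>\<pi>) - e k)) \<le> S_cost \<rho> \<mu>\<^sub>0 k \<pi>"
      unfolding S_cost_def using k by (intro ereal_mult_left_mono) auto
    then show ?thesis using k by simp
  qed
  then show ?thesis by (rule that[OF e0])
qed

section \<open>Upper bound: recovery sequences\<close>

lemma diagonal_null_sequence:
  fixes b :: "nat \<Rightarrow> nat \<Rightarrow> real"
  assumes b: "\<And>j. b j \<longlonglongrightarrow> 0" and b0: "\<And>j k. 0 \<le> b j k"
  obtains J :: "nat \<Rightarrow> nat" where "filterlim J at_top sequentially" "(\<lambda>k. b (J k) k) \<longlonglongrightarrow> 0"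
proof -
  have "\<exists>N. \<forall>k\<ge>N. b j k \<le> 1 / real (Suc j)" for j
  proof -
    have "\<forall>\<^sub>F k in sequentially. b j k < 1 / real (Suc j)" by (rule order_tendstoD(2)[OF b]) simp
    then show ?thesis by (auto simp: eventually_sequentially intro: less_imp_le)
  qed
  then obtain N where N: "\<And>j k. N j \<le> k \<Longrightarrow> b j k \<le> 1 / real (Suc j)" by metis
  \<comment> \<open>Dominates the threshold \<open>N j\<close>; the summand \<open>j\<close> ensures
    that only finitely many \<open>j\<close> have \<open>M j\<close> below a given
    \<open>k\<close>.\<close>
  define M where "M j = j + (\<Sum>i\<le>j. N i)" for j
  have Mj: "j \<le> M j" for j by (simp add: M_def)
  have MN: "N j \<le> M j" for j
  proof -
    have "N j \<le> (\<Sum>i\<le>j. N i)" by (intro member_le_sum) auto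
    then show ?thesis by (simp add: M_def)
  qed
  \<comment> \<open>The largest row whose threshold has been passed at time \<open>k\<close>. The
    alternative \<open>j = 0\<close> keeps the set nonempty for small \<open>k\<close>.\<close>
  define J where "J k = (GREATEST j. j = 0 \<or> M j \<le> k)" for k
  have J: "J k = 0 \<or> M (J k) \<le> k" "\<And>j. M j \<le> k \<Longrightarrow> j \<le> J k" for k
  proof -
    have bd: "\<forall>y. y = 0 \<or> M y \<le> k \<longrightarrow> y \<le> k" using Mj order_trans by blast
    show "J k = 0 \<or> M (J k) \<le> k" unfolding J_def by (rule GreatestI_nat[where k=0, OF _ bd[rule_format]]) auto
    show "j \<le> J k" if "M j \<le> k" for j unfolding J_def by (rule Greatest_le_nat[OF _ bd[rule_format]]) (use that in auto)
  qed
  have lim: "filterlim J at_top sequentially"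
    unfolding filterlim_at_top eventually_sequentially using J(2) by (meson order_trans)
  have up: "b (J k) k \<le> 1 / real (Suc (J k))" if "M 0 \<le> k" for k
  proof (rule N)
    show "N (J k) \<le> k" using J(1)[of k] MN[of "J k"] that by (auto intro: order_trans)
  qed
  have "(\<lambda>k. b (J k) k) \<longlonglongrightarrow> 0"
  proof (rule tendsto_sandwich[of "\<lambda>_. 0"])
    show "\<forall>\<^sub>F k in sequentially. b (J k) k \<le> 1 / real (Suc (J k))"
      using up by (auto simp: eventually_sequentially)
    have "(\<lambda>j. 1 / real (Suc j)) \<longlonglongrightarrow> 0" by real_asymp
    then show "(\<lambda>k. 1 / real (Suc (J k))) \<longlonglongrightarrow> 0" using lim by (rule filterlim_compose)
  qed (use b0 in auto)
  then show ?thesis by (rule that[OF lim])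
qed


text \<open>Given \<open>(x, y) \<sim> \<pi>\<close>, the second coordinate is resampled from \<open>\<rho> k x\<close> conditioned on the ball
  \<open>ball y \<delta>\<close>, provided that this ball carries at least the mass predicted by the large deviation
  lower bound, and from \<open>\<rho> k x\<close> itself otherwise. The entropy is computed for the triple
  \<open>((x, y), y')\<close> and can only decrease when \<open>y\<close> is forgotten.\<close>

lemma conditioned_kernel:
  fixes \<mu>\<^sub>0 :: "'b::polish_space measure"
  assumes kernel: "\<kappa> \<in> borel \<rightarrow>\<^sub>M prob_algebra borel" and k: "1 \<le> (k::nat)"
    and c_meas: "c \<in> borel_measurable borel"
    and \<pi>: "\<pi> \<in> couplings \<mu>\<^sub>0 \<nu>" and \<delta>: "0 < \<delta>"
  defines "good \<equiv> \<lambda>p. c p < top \<and> exp (- (real k * (enn2real (c p) + \<delta>))) \<le> measure (\<kappa> (fst p)) (ball (snd p) \<delta>)"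
  obtains \<pi>' where "\<pi>' \<in> prob_measures" "distr \<pi>' borel fst = \<mu>\<^sub>0"
    "rel_entropy \<pi>' (joint_law \<mu>\<^sub>0 \<kappa>) \<le> enn2ereal (ennreal (real k) * ((\<integral>\<^sup>+z. c z \<partial>\<pi>) + ennreal \<delta>))"
    "\<And>f C B. C-lipschitz_on UNIV f \<Longrightarrow> (\<And>z. \<bar>f z\<bar> \<le> B) \<Longrightarrow>
      \<bar>(\<integral>z. f z \<partial>\<pi>') - (\<integral>z. f z \<partial>\<pi>)\<bar> \<le> C * \<delta> + 2 * B * measure \<pi> {p. \<not> good p}"
    "{p. \<not> good p} \<in> sets borel"
proof -
  note \<pi>p = couplingsD(1)[OF \<pi>]
  interpret P: prob_space \<pi> by (rule prob_measuresD[OF \<pi>p])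
  note [measurable] = c_meas
  have spi: "sets \<pi> = sets borel" by (rule prob_measuresD[OF \<pi>p])
  have m\<pi>: "f \<in> borel_measurable \<pi>" if "f \<in> borel_measurable borel" for f :: "'b \<times> 'b \<Rightarrow> ennreal"
    using that spi measurable_cong_sets by blast
  define \<kappa>' where "\<kappa>' p = \<kappa> (fst p)" for p :: "'b \<times> 'b"
  have \<kappa>': "\<kappa>' \<in> borel \<rightarrow>\<^sub>M prob_algebra borel"
    unfolding \<kappa>'_def by (rule measurable_compose[OF borel_measurable_fst_snd(1) kernel])
  have \<kappa>p: "\<kappa>' p \<in> prob_measures" for p by (rule kernel_in_prob_measures[OF \<kappa>'])
  define g where "g p = measure (\<kappa>' p) (ball (snd p) \<delta>)" for p
  \<comment> \<open>The centre of the ball moves with \<open>p\<close>. Writing its mass as a kernel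
    integral of a jointly measurable function yields measurability of \<open>g\<close>.\<close>
  have g_nn: "(\<integral>\<^sup>+y. indicator {z. dist (snd (fst z)) (snd z) < \<delta>} (p, y) \<partial>\<kappa>' p) = ennreal (g p)" for p
  proof -
    interpret prob_space "\<kappa>' p" by (rule prob_measuresD[OF \<kappa>p])
    have "(\<integral>\<^sup>+y. indicator {z. dist (snd (fst z)) (snd z) < \<delta>} (p, y) \<partial>\<kappa>' p) = (\<integral>\<^sup>+y. indicator (ball (snd p) \<delta>) y \<partial>\<kappa>' p)"
      by (intro nn_integral_cong) (auto simp: indicator_def)
    also have "\<dots> = emeasure (\<kappa>' p) (ball (snd p) \<delta>)"
      using prob_measuresD(2)[OF \<kappa>p[of p]] by (intro nn_integral_indicator) simp
    finally show ?thesis by (simp add: g_def emeasure_eq_measure)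
  qed
  have ball_m[measurable]: "{z :: ('b \<times> 'b) \<times> 'b. dist (snd (fst z)) (snd z) < \<delta>} \<in> sets borel"
    by (intro borel_open open_Collect_less continuous_intros)
  have g_m[measurable]: "g \<in> borel_measurable borel"
  proof -
    have [measurable]: "(\<lambda>p. \<integral>\<^sup>+y. indicator {z. dist (snd (fst z)) (snd z) < \<delta>} (p, y) \<partial>\<kappa>' p) \<in> borel_measurable borel"
      by (rule nn_integral_kernel_measurable[OF \<kappa>']) measurable
    have "(\<lambda>p. enn2real (\<integral>\<^sup>+y. indicator {z. dist (snd (fst z)) (snd z) < \<delta>} (p, y) \<partial>\<kappa>' p)) \<in> borel_measurable borel"
      by measurable
    then show ?thesis unfolding g_nn by (simp add: g_def[abs_def])
  qed
  have good_def': "good p \<longleftrightarrow> c p < top \<and> exp (- (real k * (enn2real (c p) + \<delta>))) \<le> g p" for p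
    by (simp add: good_def g_def \<kappa>'_def)
  have good_m[measurable]: "{p. good p} \<in> sets borel"
  proof -
    have "Measurable.pred borel good" unfolding good_def'[abs_def] by measurable
    then show ?thesis by (simp add: pred_def)
  qed
  have bad: "{p. \<not> good p} \<in> sets borel"
    using borel_comp[OF good_m] by (simp add: Collect_neg_eq)
  have good_pos: "0 < g p" if "good p" for p
    using that exp_gt_zero less_le_trans unfolding good_def' by blast
  \<comment> \<open>Density of the conditioned kernel with respect to the unconditioned one: the
    normalised indicator of the ball at good pairs, 1 elsewhere.\<close>
  define w where "w z = (if good (fst z) then indicator {z. dist (snd (fst z)) (snd z) < \<delta>} z / g (fst z) else 1)" for z :: "('b \<times> 'b) \<times> 'b"
  have w0: "0 \<le> w z" for z by (simp add: w_def g_def)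
  have w_m[measurable]: "w \<in> borel_measurable borel"
  proof -
    have [measurable]: "Measurable.pred borel good" using good_m by (simp add: pred_def)
    show ?thesis unfolding w_def by measurable
  qed
  \<comment> \<open>Reference law of the triple: a pair drawn from \<pi> together with a fresh
    sample from the kernel at its first coordinate.\<close>
  define R where "R = kernel_law \<pi> \<kappa>'"
  have R: "R \<in> prob_measures" unfolding R_def by (rule kernel_law_in_prob_measures[OF \<pi>p \<kappa>'])
  have sR: "sets R = sets borel" by (rule prob_measuresD[OF R])
  have mR: "f \<in> R \<rightarrow>\<^sub>M N" if "f \<in> borel \<rightarrow>\<^sub>M N" for f and N :: "'x measure"
    using that sR measurable_cong_sets by blast
  have nnR: "(\<integral>\<^sup>+z. f z \<partial>R) = (\<integral>\<^sup>+p. \<integral>\<^sup>+y. f (p, y) \<partial>\<kappa>' p \<partial>\<pi>)" if "f \<in> borel_measurable borel" for f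
    unfolding R_def by (rule nn_integral_kernel_law[OF \<pi>p \<kappa>' that])
  \<comment> \<open>both conditional integrals only see whether \<open>y\<close> lies in the ball\<close>
  have inner: "(\<integral>\<^sup>+y. ennreal (h (w (p, y))) \<partial>\<kappa>' p) = ennreal (h (1 / g p) * g p + h 0 * (1 - g p))"
    if gp: "good p" and h: "0 \<le> h (1 / g p)" "0 \<le> h 0" for p and h :: "real \<Rightarrow> real"
  proof -
    interpret K: prob_space "\<kappa>' p" by (rule prob_measuresD[OF \<kappa>p])
    have b: "ball (snd p) \<delta> \<in> sets (\<kappa>' p)" using prob_measuresD(2)[OF \<kappa>p] by simp
    have sp: "space (\<kappa>' p) = UNIV" by (rule prob_measuresD[OF \<kappa>p])
    have b': "- ball (snd p) \<delta> \<in> sets (\<kappa>' p)" using sets.compl_sets[OF b] sp by (simp add: Compl_eq_Diff_UNIV)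
    have "(\<integral>\<^sup>+y. ennreal (h (w (p, y))) \<partial>\<kappa>' p) =
        (\<integral>\<^sup>+y. ennreal (h (1 / g p)) * indicator (ball (snd p) \<delta>) y + ennreal (h 0) * indicator (- ball (snd p) \<delta>) y \<partial>\<kappa>' p)"
      using gp by (intro nn_integral_cong) (auto simp: w_def indicator_def)
    also have "\<dots> = ennreal (h (1 / g p)) * emeasure (\<kappa>' p) (ball (snd p) \<delta>) + ennreal (h 0) * emeasure (\<kappa>' p) (- ball (snd p) \<delta>)"
      using b b' by (simp add: nn_integral_add nn_integral_cmult)
    also have "emeasure (\<kappa>' p) (- ball (snd p) \<delta>) = ennreal (1 - g p)"
      using K.prob_compl[OF b] by (simp add: sp g_def K.emeasure_eq_measure Compl_eq_Diff_UNIV)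
    also have "emeasure (\<kappa>' p) (ball (snd p) \<delta>) = ennreal (g p)" by (simp add: g_def K.emeasure_eq_measure)
    also have "ennreal (h (1 / g p)) * ennreal (g p) + ennreal (h 0) * ennreal (1 - g p) = ennreal (h (1 / g p) * g p + h 0 * (1 - g p))"
    proof -
      have "0 \<le> g p" "g p \<le> 1" by (auto simp: g_def)
      then show ?thesis using h by (simp add: ennreal_plus ennreal_mult)
    qed
    finally show ?thesis .
  qed
  have inner1: "(\<integral>\<^sup>+y. ennreal (w (p, y)) \<partial>\<kappa>' p) = 1" for p
  proof (cases "good p")
    case True
    then show ?thesis using inner[OF True, of "\<lambda>t. t"] good_pos[OF True] by simp
  next
    case False
    interpret K: prob_space "\<kappa>' p" by (rule prob_measuresD[OF \<kappa>p])
    show ?thesis using False by (simp add: w_def K.emeasure_space_1)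
  qed
  define Q where "Q = density R (\<lambda>z. ennreal (w z))"
  have nnQ: "(\<integral>\<^sup>+z. f z \<partial>Q) = (\<integral>\<^sup>+p. \<integral>\<^sup>+y. ennreal (w (p, y)) * f (p, y) \<partial>\<kappa>' p \<partial>\<pi>)" if [measurable]: "f \<in> borel_measurable borel" for f
  proof -
    have "(\<integral>\<^sup>+z. f z \<partial>Q) = (\<integral>\<^sup>+z. ennreal (w z) * f z \<partial>R)"
      unfolding Q_def by (rule nn_integral_density; rule mR; measurable)
    also have "\<dots> = (\<integral>\<^sup>+p. \<integral>\<^sup>+y. ennreal (w (p, y)) * f (p, y) \<partial>\<kappa>' p \<partial>\<pi>)"
      by (rule nnR) measurable
    finally show ?thesis .
  qed
  have sQ: "sets Q = sets borel" by (simp add: Q_def sR)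
  have spQ: "space Q = UNIV" using sets_eq_imp_space_eq[OF sQ] by simp
  have mQ: "f \<in> Q \<rightarrow>\<^sub>M N" if "f \<in> borel \<rightarrow>\<^sub>M N" for f and N :: "'x measure"
    using that sQ measurable_cong_sets by blast
  have nnQ_fst: "(\<integral>\<^sup>+z. f (fst z) \<partial>Q) = (\<integral>\<^sup>+p. f p \<partial>\<pi>)" if [measurable]: "f \<in> borel_measurable borel" for f
  proof -
    have "(\<integral>\<^sup>+z. f (fst z) \<partial>Q) = (\<integral>\<^sup>+p. \<integral>\<^sup>+y. ennreal (w (p, y)) * f p \<partial>\<kappa>' p \<partial>\<pi>)"
      by (subst nnQ) auto
    also have "\<dots> = (\<integral>\<^sup>+p. f p \<partial>\<pi>)"
    proof (rule nn_integral_cong)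
      fix p
      have "(\<lambda>y. ennreal (w (p, y))) \<in> borel_measurable borel"
        by (rule measurable_compose[OF _ measurable_compose[OF w_m measurable_ennreal]])
          (intro borel_measurable_continuous_onI continuous_intros)
      then have "(\<lambda>y. ennreal (w (p, y))) \<in> borel_measurable (\<kappa>' p)"
        using prob_measuresD(2)[OF \<kappa>p] measurable_cong_sets by blast
      then show "(\<integral>\<^sup>+y. ennreal (w (p, y)) * f p \<partial>\<kappa>' p) = f p" by (simp add: nn_integral_multc inner1)
    qed
    finally show ?thesis .
  qed
  have Q: "Q \<in> prob_measures"
  proof (rule prob_measuresI[OF _ sQ], rule prob_spaceI)
    have "emeasure Q (space Q) = (\<integral>\<^sup>+z. 1 \<partial>Q)" by simp
    also have "\<dots> = (\<integral>\<^sup>+p. 1 \<partial>\<pi>)" by (rule nnQ_fst) simp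
    finally show "emeasure Q (space Q) = 1" by (simp add: P.emeasure_space_1)
  qed
  interpret Q: prob_space Q by (rule prob_measuresD[OF Q])
  have distr_fst: "distr Q borel fst = \<pi>"
  proof (rule measure_eqI)
    fix A assume "A \<in> sets (distr Q borel fst)"
    then have A[measurable]: "A \<in> sets borel" by simp
    have "emeasure (distr Q borel fst) A = (\<integral>\<^sup>+z. indicator A (fst z) \<partial>Q)"
      using mQ[OF borel_measurable_fst_snd(1)] measurable_sets[OF mQ[OF borel_measurable_fst_snd(1)] A]
      by (subst emeasure_distr) (auto simp flip: nn_integral_indicator intro!: nn_integral_cong simp: indicator_def)
    also have "\<dots> = (\<integral>\<^sup>+p. indicator A p \<partial>\<pi>)" by (rule nnQ_fst) simp
    finally show "emeasure (distr Q borel fst) A = emeasure \<pi> A" using A spi by simp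
  qed (simp add: spi)
  have H: "rel_entropy Q R \<le> enn2ereal (ennreal (real k) * ((\<integral>\<^sup>+z. c z \<partial>\<pi>) + ennreal \<delta>))"
  proof -
    have "rel_entropy Q R = enn2ereal (\<integral>\<^sup>+z. ennreal (ent (w z)) \<partial>R)"
      unfolding Q_def by (rule rel_entropy_density[OF prob_measuresD(1)[OF R] mR[OF w_m] w0]) (use Q.prob_space_axioms Q_def in simp)
    also have "(\<integral>\<^sup>+z. ennreal (ent (w z)) \<partial>R) = (\<integral>\<^sup>+p. \<integral>\<^sup>+y. ennreal (ent (w (p, y))) \<partial>\<kappa>' p \<partial>\<pi>)"
      by (rule nnR) measurable
    also have "\<dots> \<le> (\<integral>\<^sup>+p. ennreal (real k) * (c p + ennreal \<delta>) \<partial>\<pi>)"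
    proof (rule nn_integral_mono)
      fix p
      show "(\<integral>\<^sup>+y. ennreal (ent (w (p, y))) \<partial>\<kappa>' p) \<le> ennreal (real k) * (c p + ennreal \<delta>)"
      proof (cases "good p")
        case True
        have g: "0 < g p" by (rule good_pos[OF True])
        have "(\<integral>\<^sup>+y. ennreal (ent (w (p, y))) \<partial>\<kappa>' p) = ennreal (ent (1 / g p) * g p + ent 0 * (1 - g p))"
          using g by (intro inner True ent_nonneg) auto
        also have "ent (1 / g p) * g p + ent 0 * (1 - g p) = - ln (g p)"
          using g by (simp add: ent_def ln_div field_simps)
        \<comment> \<open>The entropy of a law conditioned on an event is minus the logarithm of the
          probability of the event, and goodness of \<open>p\<close> bounds exactly this
          quantity.\<close>
        also have "\<dots> \<le> real k * (enn2real (c p) + \<delta>)"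
        proof -
          have "ln (exp (- (real k * (enn2real (c p) + \<delta>)))) \<le> ln (g p)"
            using True g by (subst ln_le_cancel_iff) (auto simp: good_def')
          then show ?thesis by simp
        qed
        also have "ennreal (real k * (enn2real (c p) + \<delta>)) = ennreal (real k) * (ennreal (enn2real (c p)) + ennreal \<delta>)"
          using \<delta> by (simp add: ennreal_mult ennreal_plus)
        also have "ennreal (enn2real (c p)) = c p" using True by (simp add: good_def')
        finally show ?thesis by (simp add: ennreal_leI)
      qed (simp add: w_def ent_def)
    qed
    also have "\<dots> = ennreal (real k) * ((\<integral>\<^sup>+z. c z \<partial>\<pi>) + ennreal \<delta>)"
      using m\<pi>[OF c_meas] by (simp add: nn_integral_cmult nn_integral_add P.emeasure_space_1)
    finally show ?thesis by (simp add: less_eq_ennreal.rep_eq)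
  qed
  \<comment> \<open>Forgets the original \<open>y\<close>. It sends \<open>R\<close> to the joint
    law, since only the first coordinate of the pair enters the kernel, and it cannot increase the
    entropy.\<close>
  define T where "T z = (fst (fst z), snd z)" for z :: "('b \<times> 'b) \<times> 'b"
  have T[measurable]: "T \<in> borel \<rightarrow>\<^sub>M borel"
    unfolding T_def by (intro borel_measurable_continuous_onI continuous_intros)
  have distr_T_R: "distr R borel T = joint_law \<mu>\<^sub>0 \<kappa>"
  proof (rule measure_eqI)
    have \<mu>0: "\<mu>\<^sub>0 \<in> prob_measures"
      unfolding couplingsD(2)[OF \<pi>, symmetric]
      using borel_measurable_fst_snd(1) spi by (intro prob_measuresI P.prob_space_distr) (simp_all cong: measurable_cong_sets)
    show "sets (distr R borel T) = sets (joint_law \<mu>\<^sub>0 \<kappa>)"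
      using prob_measuresD(2)[OF joint_law_in_prob_measures[OF \<mu>0 kernel]] by simp
    fix A assume "A \<in> sets (distr R borel T)"
    then have A[measurable]: "A \<in> sets borel" by simp
    have "emeasure (distr R borel T) A = (\<integral>\<^sup>+z. indicator A (T z) \<partial>R)"
      using mR[OF T] measurable_sets[OF mR[OF T] A]
      by (subst emeasure_distr) (auto simp flip: nn_integral_indicator intro!: nn_integral_cong simp: indicator_def)
    also have "\<dots> = (\<integral>\<^sup>+p. \<integral>\<^sup>+y. indicator A (fst p, y) \<partial>\<kappa> (fst p) \<partial>\<pi>)"
      by (subst nnR) (auto simp: T_def \<kappa>'_def)
    also have "\<dots> = (\<integral>\<^sup>+x. \<integral>\<^sup>+y. indicator A (x, y) \<partial>\<kappa> x \<partial>\<mu>\<^sub>0)"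
    proof -
      have km: "(\<lambda>x. \<integral>\<^sup>+y. indicator A (x, y) \<partial>\<kappa> x) \<in> borel_measurable borel"
        by (rule nn_integral_kernel_measurable[OF kernel]) simp
      have "fst \<in> \<pi> \<rightarrow>\<^sub>M borel" using borel_measurable_fst_snd(1) spi measurable_cong_sets by blast
      from nn_integral_distr[OF this, of "\<lambda>x. \<integral>\<^sup>+y. indicator A (x, y) \<partial>\<kappa> x"] km show ?thesis
        unfolding couplingsD(2)[OF \<pi>] using prob_measuresD(2)[OF \<mu>0] by (simp cong: measurable_cong_sets)
    qed
    also have "\<dots> = (\<integral>\<^sup>+z. indicator A z \<partial>joint_law \<mu>\<^sub>0 \<kappa>)"
      unfolding joint_law_eq_kernel_law by (rule nn_integral_kernel_law[OF \<mu>0 kernel, symmetric]) simp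
    also have "\<dots> = emeasure (joint_law \<mu>\<^sub>0 \<kappa>) A"
      using A prob_measuresD(2)[OF joint_law_in_prob_measures[OF \<mu>0 kernel]] by simp
    finally show "emeasure (distr R borel T) A = emeasure (joint_law \<mu>\<^sub>0 \<kappa>) A" .
  qed
  define \<pi>' where "\<pi>' = distr Q borel T"
  have 1: "\<pi>' \<in> prob_measures" unfolding \<pi>'_def by (intro prob_measuresI Q.prob_space_distr mQ T) simp
  have 2: "distr \<pi>' borel fst = \<mu>\<^sub>0"
  proof -
    have "distr \<pi>' borel fst = distr Q borel (fst \<circ> T)"
      unfolding \<pi>'_def by (rule distr_distr[OF borel_measurable_fst_snd(1) mQ[OF T]])
    also have "\<dots> = distr (distr Q borel fst) borel fst"
      by (subst distr_distr[OF borel_measurable_fst_snd(1) mQ[OF borel_measurable_fst_snd(1)]]) (simp add: T_def comp_def)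
    also have "\<dots> = \<mu>\<^sub>0" unfolding distr_fst by (rule couplingsD(2)[OF \<pi>])
    finally show ?thesis .
  qed
  have 3: "rel_entropy \<pi>' (joint_law \<mu>\<^sub>0 \<kappa>) \<le> enn2ereal (ennreal (real k) * ((\<integral>\<^sup>+z. c z \<partial>\<pi>) + ennreal \<delta>))"
  proof -
    have "rel_entropy \<pi>' (joint_law \<mu>\<^sub>0 \<kappa>) \<le> rel_entropy Q R"
      unfolding \<pi>'_def distr_T_R[symmetric]
      by (rule rel_entropy_distr_le[OF prob_measuresD(1)[OF R] Q.prob_space_axioms _ mR[OF T]]) (simp add: sQ sR)
    then show ?thesis using H by (rule order_trans)
  qed
  \<comment> \<open>The density vanishes outside the ball at good pairs, so there the new second
    coordinate is within \<open>\<delta>\<close> of the old one; \<open>Q\<close> thus couples the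
    laws \<pi>' and \<pi>.\<close>
  have AEw: "AE z in Q. good (fst z) \<longrightarrow> dist (snd (fst z)) (snd z) < \<delta>"
    unfolding Q_def AE_density[OF mR[OF measurable_compose[OF w_m measurable_ennreal]]]
    by (auto simp: w_def indicator_def intro!: AE_I2 split: if_splits)
  have 4: "\<bar>(\<integral>z. f z \<partial>\<pi>') - (\<integral>z. f z \<partial>\<pi>)\<bar> \<le> C * \<delta> + 2 * B * measure \<pi> {p. \<not> good p}"
    if lip: "C-lipschitz_on UNIV f" and B: "\<And>z. \<bar>f z\<bar> \<le> B" for f :: "'b \<times> 'b \<Rightarrow> real" and C B
  proof -
    have fm: "f \<in> borel_measurable borel" by (rule lipschitz_on_borel_measurable[OF lip])
    have C0: "0 \<le> C" by (rule lipschitz_on_nonneg[OF lip])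
    have e1: "(\<integral>z. f z \<partial>\<pi>') = (\<integral>z. f (T z) \<partial>Q)" unfolding \<pi>'_def by (rule integral_distr[OF mQ[OF T] fm])
    have e2: "(\<integral>z. f z \<partial>\<pi>) = (\<integral>z. f (fst z) \<partial>Q)"
      by (subst distr_fst[symmetric]) (rule integral_distr[OF mQ[OF borel_measurable_fst_snd(1)] fm])
    have i1: "integrable Q (\<lambda>z. f (T z))"
      using B by (intro Q.integrable_const_bound[of _ B] mQ measurable_compose[OF T fm]) auto
    have i2: "integrable Q (\<lambda>z. f (fst z))"
      using B by (intro Q.integrable_const_bound[of _ B] mQ measurable_compose[OF borel_measurable_fst_snd(1) fm]) auto
    let ?bad = "fst -` {p. \<not> good p} :: (('b \<times> 'b) \<times> 'b) set"
    have bQ: "?bad \<in> sets Q"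
      using measurable_sets[OF mQ[OF borel_measurable_fst_snd(1)] bad] spQ by simp
    have mb: "measure Q ?bad = measure \<pi> {p. \<not> good p}"
      unfolding distr_fst[symmetric] using bad spQ by (subst measure_distr[OF mQ[OF borel_measurable_fst_snd(1)]]) auto
    have i3: "integrable Q (\<lambda>z. C * \<delta> + 2 * B * indicator ?bad z)"
      using bQ by (intro Bochner_Integration.integrable_add integrable_mult_right integrable_real_indicator) (auto simp: less_top[symmetric])
    have "\<bar>(\<integral>z. f z \<partial>\<pi>') - (\<integral>z. f z \<partial>\<pi>)\<bar> = \<bar>\<integral>z. f (T z) - f (fst z) \<partial>Q\<bar>"
      unfolding e1 e2 using i1 i2 by simp
    also have "\<dots> \<le> (\<integral>z. \<bar>f (T z) - f (fst z)\<bar> \<partial>Q)"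
      using integral_norm_bound[of Q "\<lambda>z. f (T z) - f (fst z)"] by simp
    also have "\<dots> \<le> (\<integral>z. C * \<delta> + 2 * B * indicator ?bad z \<partial>Q)"
    proof (rule integral_mono_AE)
      show "AE z in Q. \<bar>f (T z) - f (fst z)\<bar> \<le> C * \<delta> + 2 * B * indicator ?bad z" using AEw
      proof eventually_elim
        fix z assume z: "good (fst z) \<longrightarrow> dist (snd (fst z)) (snd z) < \<delta>"
        show "\<bar>f (T z) - f (fst z)\<bar> \<le> C * \<delta> + 2 * B * indicator ?bad z"
        proof (cases "good (fst z)")
          case True
          have "\<bar>f (T z) - f (fst z)\<bar> \<le> C * dist (T z) (fst z)"
            using lipschitz_onD[OF lip, of "T z" "fst z"] by (simp add: dist_real_def)
          also have "dist (T z) (fst z) = dist (snd (fst z)) (snd z)"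
            by (cases z; cases "fst z") (simp add: T_def dist_Pair_Pair dist_commute)
          also have "C * \<dots> \<le> C * \<delta>" using z True C0 by (intro mult_left_mono) auto
          finally show ?thesis using True by simp
        next
          case False
          have "\<bar>f (T z) - f (fst z)\<bar> \<le> 2 * B" using B[of "T z"] B[of "fst z"] by linarith
          then show ?thesis using False C0 \<delta> by (simp add: add_increasing)
        qed
      qed
    qed (use i1 i2 i3 in auto)
    also have "\<dots> = C * \<delta> + 2 * B * measure Q ?bad"
    proof -
      have "integrable Q (\<lambda>z. 2 * B * indicator ?bad z)"
        using bQ by (intro integrable_mult_right integrable_real_indicator) (auto simp: less_top[symmetric])
      then show ?thesis using bQ spQ Q.prob_space by simp
    qed
    finally show ?thesis unfolding mb .
  qed
  show ?thesis by (rule that[OF 1 2 3 4 bad])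
qed


text \<open>For a fixed radius the bad pairs lose all \<pi>-mass as \<open>k\<close> grows, but at a
  speed that depends on the radius. A diagonal choice of radii tending to 0 keeps the bad mass
  negligible, and then \<open>conditioned_kernel\<close> controls cost and distance to \<pi> at
  once.\<close>

lemma recovery_sequence:
  fixes \<mu>\<^sub>0 :: "'b::polish_space measure"
  assumes kernel: "\<And>k. 1 \<le> k \<Longrightarrow> \<rho> k \<in> borel \<rightarrow>\<^sub>M prob_algebra borel"
    and ldp: "\<And>x. large_deviation_principle (\<lambda>k. \<rho> k x) (\<lambda>y. c (x, y))"
    and c: "lower_semicontinuous c"
    and \<pi>: "\<pi> \<in> couplings \<mu>\<^sub>0 \<nu>" and fin: "(\<integral>\<^sup>+z. c z \<partial>\<pi>) < top"
  obtains \<pi>' where "\<And>k. \<pi>' k \<in> prob_measures" "\<And>k. distr (\<pi>' k) borel fst = \<mu>\<^sub>0"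
    "lipschitz_tendsto \<pi>' \<pi>"
    "\<And>\<epsilon>. 0 < \<epsilon> \<Longrightarrow> \<forall>\<^sub>F k in sequentially. S_cost \<rho> \<mu>\<^sub>0 k (\<pi>' k) \<le> enn2ereal ((\<integral>\<^sup>+z. c z \<partial>\<pi>) + ennreal \<epsilon>)"
proof -
  note \<pi>p = couplingsD(1)[OF \<pi>]
  interpret P: prob_space \<pi> by (rule prob_measuresD[OF \<pi>p])
  have spi: "sets \<pi> = sets borel" and sppi: "space \<pi> = UNIV" by (rule prob_measuresD[OF \<pi>p])+
  have cm: "c \<in> borel_measurable borel" by (rule borel_measurable_lower_semicontinuous[OF c])
  then have cm\<pi>: "c \<in> borel_measurable \<pi>" using spi measurable_cong_sets by blast
  define good where "good k \<delta> p \<longleftrightarrow> c p < top \<and> exp (- (real k * (enn2real (c p) + \<delta>))) \<le> measure (\<rho> k (fst p)) (ball (snd p) \<delta>)" for k :: nat and \<delta> p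
  define b where "b j k = (if 1 \<le> k then measure \<pi> {p. \<not> good k (1 / real (Suc j)) p} else 0)" for j k :: nat
  \<comment> \<open>Bundles the conclusions of \<open>conditioned_kernel\<close> so that one measure
    per \<open>k\<close> and \<open>\<delta>\<close> can be chosen before the radius is tied to
    \<open>k\<close>.\<close>
  define near where "near k \<delta> \<pi>' \<longleftrightarrow> \<pi>' \<in> prob_measures \<and> distr \<pi>' borel fst = \<mu>\<^sub>0 \<and>
      rel_entropy \<pi>' (joint_law \<mu>\<^sub>0 (\<rho> k)) \<le> enn2ereal (ennreal (real k) * ((\<integral>\<^sup>+z. c z \<partial>\<pi>) + ennreal \<delta>)) \<and>
      (\<forall>f C B. C-lipschitz_on UNIV f \<longrightarrow> (\<forall>z. \<bar>f z\<bar> \<le> B) \<longrightarrow>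
        \<bar>(\<integral>z. f z \<partial>\<pi>') - (\<integral>z. f z \<partial>\<pi>)\<bar> \<le> C * \<delta> + 2 * B * measure \<pi> {p. \<not> good k \<delta> p}) \<and>
      {p. \<not> good k \<delta> p} \<in> sets borel" for k \<delta> \<pi>'
  have ex_near: "\<exists>\<pi>'. near k \<delta> \<pi>'" if k: "1 \<le> k" and \<delta>: "0 < \<delta>" for k \<delta>
  proof (rule conditioned_kernel[OF kernel[OF k] k cm \<pi> \<delta>, folded good_def])
    fix \<pi>'
    assume H: "\<pi>' \<in> prob_measures" "distr \<pi>' borel fst = \<mu>\<^sub>0"
      "rel_entropy \<pi>' (joint_law \<mu>\<^sub>0 (\<rho> k)) \<le> enn2ereal (ennreal (real k) * ((\<integral>\<^sup>+z. c z \<partial>\<pi>) + ennreal \<delta>))"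
      "\<And>f C B. C-lipschitz_on UNIV f \<Longrightarrow> (\<And>z. \<bar>f z\<bar> \<le> B) \<Longrightarrow>
        \<bar>(\<integral>z. f z \<partial>\<pi>') - (\<integral>z. f z \<partial>\<pi>)\<bar> \<le> C * \<delta> + 2 * B * measure \<pi> {p. \<not> good k \<delta> p}"
      "{p. \<not> good k \<delta> p} \<in> sets borel"
    have "near k \<delta> \<pi>'" unfolding near_def by (intro conjI allI impI H) (assumption | erule spec)+
    then show ?thesis by blast
  qed
  define \<sigma> where "\<sigma> k \<delta> = (SOME \<pi>'. near k \<delta> \<pi>')" for k \<delta>
  have near: "near k \<delta> (\<sigma> k \<delta>)" if "1 \<le> k" "0 < \<delta>" for k \<delta>
    unfolding \<sigma>_def by (rule someI_ex[OF ex_near[OF that]])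
  have \<sigma>: "\<sigma> k \<delta> \<in> prob_measures" "distr (\<sigma> k \<delta>) borel fst = \<mu>\<^sub>0"
    "rel_entropy (\<sigma> k \<delta>) (joint_law \<mu>\<^sub>0 (\<rho> k)) \<le> enn2ereal (ennreal (real k) * ((\<integral>\<^sup>+z. c z \<partial>\<pi>) + ennreal \<delta>))"
    "{p. \<not> good k \<delta> p} \<in> sets borel" if "1 \<le> k" "0 < \<delta>" for k \<delta>
    using near[OF that] unfolding near_def by simp_all
  have \<sigma>_close: "\<bar>(\<integral>z. f z \<partial>\<sigma> k \<delta>) - (\<integral>z. f z \<partial>\<pi>)\<bar> \<le> C * \<delta> + 2 * B * measure \<pi> {p. \<not> good k \<delta> p}"
    if "1 \<le> k" "0 < \<delta>" "C-lipschitz_on UNIV f" "\<forall>z. \<bar>f z\<bar> \<le> B" for k \<delta> f C B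
    using near[OF that(1,2)] that(3,4) unfolding near_def by simp
  \<comment> \<open>Finite total cost makes \<open>c\<close> finite almost everywhere. At such a
    pair the large deviation lower bound for the ball around \<open>y\<close> makes the pair good
    for all large \<open>k\<close>, and dominated convergence finishes.\<close>
  have b_lim: "b j \<longlonglongrightarrow> 0" for j
  proof -
    let ?\<delta> = "1 / real (Suc j)"
    have "AE p in \<pi>. c p \<noteq> \<infinity>" using fin by (intro nn_integral_noteq_infinite cm\<pi>) auto
    then have AE: "AE p in \<pi>. (\<lambda>k. if 1 \<le> k then indicat_real {p. \<not> good k ?\<delta> p} p else 0) \<longlonglongrightarrow> 0"
    proof eventually_elim
      fix p assume cp: "c p \<noteq> \<infinity>"
      then have cp': "c p = ennreal (enn2real (c p))" "c p < top" by (auto simp: top.not_eq_extremum)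
      have "\<forall>\<^sub>F k in sequentially. exp (- (real k * (enn2real (c p) + ?\<delta>))) \<le> measure (\<rho> k (fst p)) (ball (snd p) ?\<delta>)"
        by (rule LDP_open_lower[OF ldp, of _ "snd p"]) (use cp' in auto)
      then have "\<forall>\<^sub>F k in sequentially. (if 1 \<le> k then indicat_real {p. \<not> good k ?\<delta> p} p else 0) = 0"
        by eventually_elim (use cp' in \<open>auto simp: good_def\<close>)
      then show "(\<lambda>k. if 1 \<le> k then indicat_real {p. \<not> good k ?\<delta> p} p else 0) \<longlonglongrightarrow> 0"
        by (rule tendsto_eventually)
    qed
    have m: "(\<lambda>p. if 1 \<le> k then indicat_real {p. \<not> good k ?\<delta> p} p else 0) \<in> borel_measurable \<pi>" for k
      using \<sigma>(4)[of k ?\<delta>] spi by (cases "1 \<le> k") auto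
    have "(\<lambda>k. \<integral>p. (if 1 \<le> k then indicat_real {p. \<not> good k ?\<delta> p} p else 0) \<partial>\<pi>) \<longlonglongrightarrow> (\<integral>p. 0 \<partial>\<pi>)"
      by (rule integral_dominated_convergence[where w="\<lambda>_. 1"]) (use m AE in \<open>auto simp: indicator_def\<close>)
    moreover have "(\<integral>p. (if 1 \<le> k then indicat_real {p. \<not> good k ?\<delta> p} p else 0) \<partial>\<pi>) = b j k" for k
      using \<sigma>(4)[of k ?\<delta>] spi sppi by (cases "1 \<le> k") (auto simp: b_def)
    ultimately show ?thesis by simp
  qed
  obtain J :: "nat \<Rightarrow> nat" where J: "filterlim J at_top sequentially" "(\<lambda>k. b (J k) k) \<longlonglongrightarrow> 0"
    by (rule diagonal_null_sequence[of b, OF b_lim]) (auto simp: b_def)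
  define d where "d k = 1 / real (Suc (J k))" for k
  have d0: "0 < d k" for k by (simp add: d_def)
  have "(\<lambda>j. 1 / real (Suc j)) \<longlonglongrightarrow> 0" by real_asymp
  then have dlim: "d \<longlonglongrightarrow> 0" unfolding d_def using J(1) by (rule filterlim_compose)
  \<comment> \<open>Index 0 receives \<pi> itself, a filler that already has the right first
    marginal.\<close>
  define \<pi>' where "\<pi>' k = (if 1 \<le> k then \<sigma> k (d k) else \<pi>)" for k
  have 1: "\<pi>' k \<in> prob_measures" for k using \<sigma>(1)[of k "d k"] d0 \<pi>p by (simp add: \<pi>'_def)
  have 2: "distr (\<pi>' k) borel fst = \<mu>\<^sub>0" for k using \<sigma>(2)[of k "d k"] d0 couplingsD(2)[OF \<pi>] by (simp add: \<pi>'_def)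
  have 3: "lipschitz_tendsto \<pi>' \<pi>"
    unfolding lipschitz_tendsto_def
  proof (intro allI impI)
    fix f :: "'b \<times> 'b \<Rightarrow> real" and C assume lip: "C-lipschitz_on UNIV f" and "bounded (range f)"
    then obtain B where B: "\<forall>z. \<bar>f z\<bar> \<le> B" by (auto simp: bounded_iff)
    have "(\<lambda>k. C * d k + 2 * B * b (J k) k) \<longlonglongrightarrow> C * 0 + 2 * B * 0"
      by (intro tendsto_intros dlim J(2))
    then have l: "(\<lambda>k. C * d k + 2 * B * b (J k) k) \<longlonglongrightarrow> 0" by simp
    have "(\<lambda>k. (\<integral>z. f z \<partial>\<pi>' k) - (\<integral>z. f z \<partial>\<pi>)) \<longlonglongrightarrow> 0"
    proof (rule Lim_null_comparison[OF _ l])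
      show "\<forall>\<^sub>F k in sequentially. norm ((\<integral>z. f z \<partial>\<pi>' k) - (\<integral>z. f z \<partial>\<pi>)) \<le> C * d k + 2 * B * b (J k) k"
        using eventually_ge_at_top[of 1]
      proof eventually_elim
        fix k :: nat assume k: "1 \<le> k"
        show "norm ((\<integral>z. f z \<partial>\<pi>' k) - (\<integral>z. f z \<partial>\<pi>)) \<le> C * d k + 2 * B * b (J k) k"
          using \<sigma>_close[OF k d0 lip B, of k] k by (simp add: \<pi>'_def b_def d_def)
      qed
    qed
    then show "(\<lambda>k. \<integral>z. f z \<partial>\<pi>' k) \<longlonglongrightarrow> (\<integral>z. f z \<partial>\<pi>)" by (simp add: LIM_zero_iff)
  qed
  have 4: "\<forall>\<^sub>F k in sequentially. S_cost \<rho> \<mu>\<^sub>0 k (\<pi>' k) \<le> enn2ereal ((\<integral>\<^sup>+z. c z \<partial>\<pi>) + ennreal \<epsilon>)"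
    if "0 < \<epsilon>" for \<epsilon>
  proof -
    have "\<forall>\<^sub>F k in sequentially. d k < \<epsilon>" using that by (rule order_tendstoD(2)[OF dlim])
    then show ?thesis using eventually_ge_at_top[of 1]
    proof eventually_elim
      fix k :: nat assume dk: "d k < \<epsilon>" and k: "1 \<le> k"
      obtain v where v: "(\<integral>\<^sup>+z. c z \<partial>\<pi>) = ennreal v" "0 \<le> v" using fin by (cases "\<integral>\<^sup>+z. c z \<partial>\<pi>") auto
      have "rel_entropy (\<pi>' k) (joint_law \<mu>\<^sub>0 (\<rho> k)) \<le> enn2ereal (ennreal (real k) * (ennreal v + ennreal (d k)))"
        using \<sigma>(3)[OF k d0, of k] k unfolding v by (simp add: \<pi>'_def)
      also have "\<dots> = ereal (real k * (v + d k))"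
        using v(2) d0[of k] by (simp add: enn2ereal_ennreal flip: ennreal_plus ennreal_mult)
      finally have "S_cost \<rho> \<mu>\<^sub>0 k (\<pi>' k) \<le> ereal (1 / real k) * ereal (real k * (v + d k))"
        unfolding S_cost_def using k by (intro ereal_mult_left_mono) auto
      also have "\<dots> = ereal (v + d k)" using k by simp
      also have "\<dots> \<le> ereal (v + \<epsilon>)" using dk by simp
      also have "\<dots> = enn2ereal ((\<integral>\<^sup>+z. c z \<partial>\<pi>) + ennreal \<epsilon>)"
        unfolding v using v(2) that by (simp add: enn2ereal_ennreal flip: ennreal_plus)
      finally show "S_cost \<rho> \<mu>\<^sub>0 k (\<pi>' k) \<le> enn2ereal ((\<integral>\<^sup>+z. c z \<partial>\<pi>) + ennreal \<epsilon>)" .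
    qed
  qed
  show ?thesis by (rule that[OF 1 2 3 4])
qed

section \<open>Convergence of infima and minimizers\<close>

text \<open>Unlike \<open>limitin_narrow_topology\<close>, this asks nothing of the individual
  terms: the sequences of target marginals are unconstrained at index 0.\<close>

lemma limitin_narrow_topologyD:
  fixes f :: "'b::topological_space \<Rightarrow> real"
  assumes L: "limitin narrow_topology \<mu> \<nu> sequentially" and f: "continuous_on UNIV f" "bounded (range f)"
  shows "(\<lambda>k. \<integral>x. f x \<partial>\<mu> k) \<longlonglongrightarrow> (\<integral>x. f x \<partial>\<nu>)"
proof (rule topological_tendstoI)
  fix U assume U: "open U" "(\<integral>x. f x \<partial>\<nu>) \<in> U"
  have "openin narrow_topology {\<mu> \<in> prob_measures. (\<integral>x. f x \<partial>\<mu>) \<in> U}"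
    unfolding narrow_topology_def by (rule topology_generated_by_Basis) (use f U in blast)
  moreover have "\<nu> \<in> prob_measures" using L by (simp add: limitin_def topspace_narrow_topology)
  ultimately show "\<forall>\<^sub>F k in sequentially. (\<integral>x. f x \<partial>\<mu> k) \<in> U"
    using L U unfolding limitin_def by (auto elim!: allE eventually_mono)
qed

text \<open>A cluster point gives no convergent subsequence directly, but one test function at a
  time is close infinitely often. The later inequalities each involve only one.\<close>

lemma seq_limit_point_integral_frequently:
  fixes f :: "'b::topological_space \<Rightarrow> real"
  assumes L: "seq_limit_point narrow_topology \<mu> \<nu>" and f: "continuous_on UNIV f" "bounded (range f)" and e: "0 < e"
  shows "\<exists>\<^sub>F k in sequentially. \<bar>(\<integral>x. f x \<partial>\<mu> k) - (\<integral>x. f x \<partial>\<nu>)\<bar> < e"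
proof -
  let ?U = "ball (\<integral>x. f x \<partial>\<nu>) e"
  have "openin narrow_topology {\<mu> \<in> prob_measures. (\<integral>x. f x \<partial>\<mu>) \<in> ?U}"
    unfolding narrow_topology_def by (rule topology_generated_by_Basis) (use f in blast)
  moreover have "\<nu> \<in> prob_measures" using L by (simp add: seq_limit_point_def topspace_narrow_topology)
  ultimately have "\<exists>\<^sub>F k in sequentially. \<mu> k \<in> {\<mu> \<in> prob_measures. (\<integral>x. f x \<partial>\<mu>) \<in> ?U}"
    using L e unfolding seq_limit_point_def by auto
  then show ?thesis by (rule frequently_elim1) (auto simp: dist_real_def abs_minus_commute)
qed

lemma integral_couplings_snd:
  fixes f :: "'b::polish_space \<Rightarrow> real"
  assumes "\<pi> \<in> couplings \<mu> \<nu>" "f \<in> borel_measurable borel"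
  shows "(\<integral>z. f (snd z) \<partial>\<pi>) = (\<integral>x. f x \<partial>\<nu>)"
proof -
  have m: "snd \<in> \<pi> \<rightarrow>\<^sub>M borel"
    using prob_measuresD(2)[OF couplingsD(1)[OF assms(1)]] by (simp cong: measurable_cong_sets)
  show ?thesis unfolding couplingsD(3)[OF assms(1), symmetric] by (rule integral_distr[OF m assms(2), symmetric])
qed

lemma couplingsI_integral:
  fixes \<mu> \<nu> :: "'b::polish_space measure"
  assumes \<pi>: "\<pi> \<in> prob_measures" and \<mu>: "\<mu> \<in> prob_measures" and \<nu>: "\<nu> \<in> prob_measures"
    and fst: "\<And>f :: 'b \<Rightarrow> real. continuous_on UNIV f \<Longrightarrow> bounded (range f) \<Longrightarrow> (\<integral>z. f (fst z) \<partial>\<pi>) = (\<integral>x. f x \<partial>\<mu>)"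
    and snd: "\<And>f :: 'b \<Rightarrow> real. continuous_on UNIV f \<Longrightarrow> bounded (range f) \<Longrightarrow> (\<integral>z. f (snd z) \<partial>\<pi>) = (\<integral>x. f x \<partial>\<nu>)"
  shows "\<pi> \<in> couplings \<mu> \<nu>"
proof -
  interpret prob_space \<pi> by (rule prob_measuresD[OF \<pi>])
  have m: "fst \<in> \<pi> \<rightarrow>\<^sub>M borel" "snd \<in> \<pi> \<rightarrow>\<^sub>M borel"
    using prob_measuresD(2)[OF \<pi>] by (simp_all cong: measurable_cong_sets)
  have p: "distr \<pi> borel fst \<in> prob_measures" "distr \<pi> borel snd \<in> prob_measures"
    using m by (auto intro!: prob_measuresI prob_space_distr)
  have "distr \<pi> borel fst = \<mu>"
    by (rule prob_measures_eqI[OF p(1) \<mu>])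
       (use fst in \<open>simp add: integral_distr[OF m(1) borel_measurable_continuous_onI]\<close>)
  moreover have "distr \<pi> borel snd = \<nu>"
    by (rule prob_measures_eqI[OF p(2) \<nu>])
       (use snd in \<open>simp add: integral_distr[OF m(2) borel_measurable_continuous_onI]\<close>)
  ultimately show ?thesis using \<pi> by (simp add: couplings_def)
qed

text \<open>Convergent marginals are tight, hence so are the couplings. Functions of one coordinate
  are continuous on the product, so the marginals survive in the limit.\<close>

lemma couplings_convergent_subsequence:
  fixes \<mu>\<^sub>0 \<mu>\<^sub>1 :: "'b::polish_space measure"
  assumes \<mu>0: "\<mu>\<^sub>0 \<in> prob_measures" and \<mu>1: "\<mu>\<^sub>1 \<in> prob_measures"
    and \<nu>: "\<And>n. \<nu> n \<in> prob_measures"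
    and conv: "\<And>f :: 'b \<Rightarrow> real. continuous_on UNIV f \<Longrightarrow> bounded (range f) \<Longrightarrow> (\<lambda>n. \<integral>x. f x \<partial>\<nu> n) \<longlonglongrightarrow> (\<integral>x. f x \<partial>\<mu>\<^sub>1)"
    and \<pi>: "\<And>n. \<pi> n \<in> couplings \<mu>\<^sub>0 (\<nu> n)"
  obtains r \<sigma> where "strict_mono r" "\<sigma> \<in> couplings \<mu>\<^sub>0 \<mu>\<^sub>1" "lipschitz_tendsto (\<lambda>n. \<pi> (r n)) \<sigma>"
proof -
  have "lipschitz_tendsto \<nu> \<mu>\<^sub>1"
    unfolding lipschitz_tendsto_def using conv lipschitz_on_continuous_on by blast
  then have t1: "tight_by_balls \<nu>" by (rule lipschitz_tendsto_tight_by_balls[OF \<nu> \<mu>1])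
  have "lipschitz_tendsto (\<lambda>_. \<mu>\<^sub>0) \<mu>\<^sub>0" unfolding lipschitz_tendsto_def by simp
  then have t0: "tight_by_balls (\<lambda>_::nat. \<mu>\<^sub>0)" by (rule lipschitz_tendsto_tight_by_balls[OF \<mu>0 \<mu>0])
  have \<pi>p: "\<pi> n \<in> prob_measures" for n by (rule couplingsD(1)[OF \<pi>])
  obtain r \<sigma> where r: "strict_mono r" and \<sigma>: "\<sigma> \<in> prob_measures" and l: "lipschitz_tendsto (\<lambda>n. \<pi> (r n)) \<sigma>"
    by (rule tight_by_balls_convergent_subsequence[OF \<pi>p couplings_tight_by_balls[OF \<pi> t0 t1]])
  have cb: "continuous_on UNIV (\<lambda>z. f (g z))" "bounded (range (\<lambda>z. f (g z)))"
    if "continuous_on UNIV f" "bounded (range f)" "continuous_on UNIV g" for f :: "'b \<Rightarrow> real" and g :: "'b \<times> 'b \<Rightarrow> 'b"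
    using that by (auto intro: continuous_on_compose2 bounded_subset[OF that(2)])
  have "\<sigma> \<in> couplings \<mu>\<^sub>0 \<mu>\<^sub>1"
  proof (rule couplingsI_integral[OF \<sigma> \<mu>0 \<mu>1])
    fix f :: "'b \<Rightarrow> real" assume f: "continuous_on UNIV f" "bounded (range f)"
    note fm = borel_measurable_continuous_onI[OF f(1)]
    have "(\<lambda>n. \<integral>z. f (fst z) \<partial>\<pi> (r n)) \<longlonglongrightarrow> (\<integral>z. f (fst z) \<partial>\<sigma>)"
      by (rule lipschitz_tendsto_continuous[OF \<pi>p \<sigma> l cb[OF f continuous_on_fst[OF continuous_on_id]]])
    then show "(\<integral>z. f (fst z) \<partial>\<sigma>) = (\<integral>x. f x \<partial>\<mu>\<^sub>0)"
      unfolding integral_couplings_fst[OF \<pi> fm] by (simp add: LIMSEQ_const_iff)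
    have "(\<lambda>n. \<integral>z. f (snd z) \<partial>\<pi> (r n)) \<longlonglongrightarrow> (\<integral>z. f (snd z) \<partial>\<sigma>)"
      by (rule lipschitz_tendsto_continuous[OF \<pi>p \<sigma> l cb[OF f continuous_on_snd[OF continuous_on_id]]])
    moreover have "(\<lambda>n. \<integral>z. f (snd z) \<partial>\<pi> (r n)) \<longlonglongrightarrow> (\<integral>x. f x \<partial>\<mu>\<^sub>1)"
      unfolding integral_couplings_snd[OF \<pi> fm] using LIMSEQ_subseq_LIMSEQ[OF conv[OF f] r] by (simp add: comp_def)
    ultimately show "(\<integral>z. f (snd z) \<partial>\<sigma>) = (\<integral>x. f x \<partial>\<mu>\<^sub>1)" by (rule LIMSEQ_unique)
  qed
  then show ?thesis by (rule that[OF r _ l])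
qed

text \<open>Reduces a bound on the transport cost to bounded continuous minorants of
  \<open>c\<close>, the functions for which \<open>S_cost_lower_bound\<close> is available and along
  which narrow limits pass. Testing one nonnegative minorant also shows that \<open>a\<close> is
  nonnegative.\<close>

lemma nn_integral_lsc_le:
  fixes c :: "'b::metric_space \<Rightarrow> ennreal"
  assumes c: "lower_semicontinuous c" and \<pi>: "\<pi> \<in> prob_measures"
    and le: "\<And>(\<phi> :: 'b \<Rightarrow> real) m. continuous_on UNIV \<phi> \<Longrightarrow> (\<And>z. 0 \<le> \<phi> z) \<Longrightarrow> (\<And>z. \<phi> z \<le> m)
      \<Longrightarrow> (\<And>z. ennreal (\<phi> z) \<le> c z) \<Longrightarrow> bounded (range \<phi>) \<Longrightarrow> (\<integral>z. \<phi> z \<partial>\<pi>) \<le> a"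
  shows "0 \<le> a" "(\<integral>\<^sup>+z. c z \<partial>\<pi>) \<le> ennreal a"
proof -
  obtain \<phi> :: "nat \<Rightarrow> 'b \<Rightarrow> real" where \<phi>: "\<And>n x. 0 \<le> \<phi> n x" "\<And>n x. \<phi> n x \<le> real n"
    "\<And>n. (real n)-lipschitz_on UNIV (\<phi> n)"
    "\<And>x. incseq (\<lambda>n. \<phi> n x)" "\<And>x. (SUP n. ennreal (\<phi> n x)) = c x"
    using lower_semicontinuous_Lipschitz_approx[OF c] by metis
  have cont: "continuous_on UNIV (\<phi> n)" for n using \<phi>(3) by (rule lipschitz_on_continuous_on)
  have bd: "\<bar>\<phi> n z\<bar> \<le> real n" for n z using \<phi>(1,2)[of n z] by simp
  have m: "\<phi> n \<in> borel_measurable borel" for n by (rule borel_measurable_continuous_onI[OF cont])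
  have le': "(\<integral>z. \<phi> n z \<partial>\<pi>) \<le> a" for n
  proof (rule le[OF cont \<phi>(1) \<phi>(2)])
    show "ennreal (\<phi> n z) \<le> c z" for z unfolding \<phi>(5)[symmetric] by (rule SUP_upper) simp
    show "bounded (range (\<phi> n))" using bd by (auto simp: bounded_iff)
  qed
  have "0 \<le> (\<integral>z. \<phi> 0 z \<partial>\<pi>)" using \<phi>(1) by simp
  then show "0 \<le> a" using le'[of 0] by linarith
  have "(\<integral>\<^sup>+z. c z \<partial>\<pi>) = (SUP n. \<integral>\<^sup>+z. ennreal (\<phi> n z) \<partial>\<pi>)"
    unfolding \<phi>(5)[symmetric]
  proof (rule nn_integral_monotone_convergence_SUP)
    show "incseq (\<lambda>i x. ennreal (\<phi> i x))"
      using \<phi>(4) by (auto simp: incseq_def le_fun_def intro!: ennreal_leI)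
    show "\<And>i. (\<lambda>x. ennreal (\<phi> i x)) \<in> borel_measurable \<pi>"
      using m prob_measuresD(2)[OF \<pi>] by (simp cong: measurable_cong_sets)
  qed
  also have "\<dots> \<le> ennreal a"
  proof (rule SUP_least)
    fix n
    have "(\<integral>\<^sup>+z. ennreal (\<phi> n z) \<partial>\<pi>) = ennreal (\<integral>z. \<phi> n z \<partial>\<pi>)"
      using \<phi>(1) by (intro nn_integral_eq_integral integrable_bounded_prob[OF \<pi> m bd]) auto
    then show "(\<integral>\<^sup>+z. ennreal (\<phi> n z) \<partial>\<pi>) \<le> ennreal a" using le'[of n] by (simp add: ennreal_leI)
  qed
  finally show "(\<integral>\<^sup>+z. c z \<partial>\<pi>) \<le> ennreal a" .
qed

lemma MK_solutionI:
  assumes "\<pi> \<in> couplings \<mu> \<nu>" "(\<integral>\<^sup>+z. c z \<partial>\<pi>) \<le> MK_inf c \<mu> \<nu>"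
  shows "MK_solution c \<mu> \<nu> \<pi>"
proof -
  have "\<not> (\<integral>\<^sup>+z. c z \<partial>\<sigma>) < (\<integral>\<^sup>+z. c z \<partial>\<pi>)" if "\<sigma> \<in> couplings \<mu> \<nu>" for \<sigma>
  proof -
    have "MK_inf c \<mu> \<nu> \<le> (\<integral>\<^sup>+z. c z \<partial>\<sigma>)" unfolding MK_inf_def using that by (rule INF_lower)
    then show ?thesis using assms(2) by (simp add: not_less)
  qed
  then show ?thesis using assms(1) by (auto simp: MK_solution_def is_arg_min_def)
qed

text \<open>Direct method: compactness of the couplings and lower semicontinuity of the cost. An
  actual optimizer is needed as the input of \<open>recovery_sequence\<close>.\<close>

lemma MK_solution_exists:
  fixes \<mu>\<^sub>0 \<mu>\<^sub>1 :: "'b::polish_space measure"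
  assumes c: "lower_semicontinuous c" and \<mu>0: "\<mu>\<^sub>0 \<in> prob_measures" and \<mu>1: "\<mu>\<^sub>1 \<in> prob_measures"
    and fin: "MK_inf c \<mu>\<^sub>0 \<mu>\<^sub>1 < top"
  obtains \<pi> where "\<pi> \<in> couplings \<mu>\<^sub>0 \<mu>\<^sub>1" "(\<integral>\<^sup>+z. c z \<partial>\<pi>) \<le> MK_inf c \<mu>\<^sub>0 \<mu>\<^sub>1"
proof -
  obtain v where v: "MK_inf c \<mu>\<^sub>0 \<mu>\<^sub>1 = ennreal v" "0 \<le> v" using fin by (cases "MK_inf c \<mu>\<^sub>0 \<mu>\<^sub>1") auto
  have "\<exists>\<pi>\<in>couplings \<mu>\<^sub>0 \<mu>\<^sub>1. (\<integral>\<^sup>+z. c z \<partial>\<pi>) < ennreal (v + 1 / real (Suc n))" for n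
  proof -
    have "MK_inf c \<mu>\<^sub>0 \<mu>\<^sub>1 < ennreal (v + 1 / real (Suc n))"
      unfolding v(1) using v(2) by (intro ennreal_lessI) (auto intro: add_nonneg_pos)
    then show ?thesis unfolding MK_inf_def by (simp add: INF_less_iff)
  qed
  then obtain \<pi> where \<pi>: "\<And>n. \<pi> n \<in> couplings \<mu>\<^sub>0 \<mu>\<^sub>1" "\<And>n. (\<integral>\<^sup>+z. c z \<partial>\<pi> n) < ennreal (v + 1 / real (Suc n))"
    by metis
  obtain r \<sigma> where r: "strict_mono r" and \<sigma>: "\<sigma> \<in> couplings \<mu>\<^sub>0 \<mu>\<^sub>1" and l: "lipschitz_tendsto (\<lambda>n. \<pi> (r n)) \<sigma>"
    by (rule couplings_convergent_subsequence[OF \<mu>0 \<mu>1 \<mu>1 _ \<pi>(1)]) auto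
  have "(\<integral>\<^sup>+z. c z \<partial>\<sigma>) \<le> ennreal v"
  proof (rule nn_integral_lsc_le(2)[OF c couplingsD(1)[OF \<sigma>]])
    fix \<phi> :: "'b \<times> 'b \<Rightarrow> real" and m
    assume \<phi>: "continuous_on UNIV \<phi>" "\<And>z. 0 \<le> \<phi> z" "\<And>z. \<phi> z \<le> m" "\<And>z. ennreal (\<phi> z) \<le> c z" "bounded (range \<phi>)"
    note \<pi>p = couplingsD(1)[OF \<pi>(1)]
    have le: "(\<integral>z. \<phi> z \<partial>\<pi> n) \<le> v + 1 / real (Suc n)" for n
    proof -
      have "ennreal (\<integral>z. \<phi> z \<partial>\<pi> n) = (\<integral>\<^sup>+z. ennreal (\<phi> z) \<partial>\<pi> n)"
        using \<phi> by (intro nn_integral_eq_integral[symmetric] integrable_bounded_prob[OF \<pi>p, where B=m] borel_measurable_continuous_onI) auto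
      also have "\<dots> \<le> (\<integral>\<^sup>+z. c z \<partial>\<pi> n)" by (intro nn_integral_mono \<phi>(4))
      also have "\<dots> \<le> ennreal (v + 1 / real (Suc n))" using \<pi>(2)[of n] by simp
      finally show ?thesis using v(2) by (subst (asm) ennreal_le_iff) auto
    qed
    have "(\<lambda>n. \<integral>z. \<phi> z \<partial>\<pi> (r n)) \<longlonglongrightarrow> (\<integral>z. \<phi> z \<partial>\<sigma>)"
      by (rule lipschitz_tendsto_continuous[OF \<pi>p couplingsD(1)[OF \<sigma>] l \<phi>(1,5)])
    moreover have "(\<lambda>n. v + 1 / real (Suc (r n))) \<longlonglongrightarrow> v"
    proof -
      have "(\<lambda>n. v + 1 / real (Suc n)) \<longlonglongrightarrow> v" by real_asymp
      from LIMSEQ_subseq_LIMSEQ[OF this r] show ?thesis by (simp add: comp_def)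
    qed
    ultimately show "(\<integral>z. \<phi> z \<partial>\<sigma>) \<le> v" by (rule LIMSEQ_le) (use le in blast)
  qed
  then show ?thesis using that[OF \<sigma>] v(1) by simp
qed

text \<open>If the infima stayed below some level \<open>b\<close> infinitely often, couplings with
  scaled entropy below \<open>b\<close> would have a limit in the couplings of
  \<open>\<mu>\<^sub>0\<close> and \<open>\<mu>\<^sub>1\<close>, whose transport cost would be at
  most \<open>b\<close> by the uniform lower bound, although \<open>b\<close> is below the optimal
  cost.\<close>

lemma S_inf_lower_limit:
  fixes \<mu>\<^sub>0 \<mu>\<^sub>1 :: "'b::polish_space measure"
  assumes kernel: "\<And>k. 1 \<le> k \<Longrightarrow> \<rho> k \<in> borel \<rightarrow>\<^sub>M prob_algebra borel"
    and ldp: "\<And>x. large_deviation_principle (\<lambda>k. \<rho> k x) (\<lambda>y. c (x, y))"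
    and c: "lower_semicontinuous c" and \<mu>0: "\<mu>\<^sub>0 \<in> prob_measures" and \<mu>1: "\<mu>\<^sub>1 \<in> prob_measures"
    and \<nu>: "\<And>k. 1 \<le> k \<Longrightarrow> \<nu> k \<in> prob_measures"
    and conv: "limitin narrow_topology \<nu> \<mu>\<^sub>1 sequentially"
    and a: "a < enn2ereal (MK_inf c \<mu>\<^sub>0 \<mu>\<^sub>1)"
  shows "\<forall>\<^sub>F k in sequentially. a < S_inf \<rho> \<mu>\<^sub>0 k (\<nu> k)"
proof -
  \<comment> \<open>A real level strictly in between also covers an infinite optimal cost.\<close>
  obtain b where b: "a < ereal b" "ereal b < enn2ereal (MK_inf c \<mu>\<^sub>0 \<mu>\<^sub>1)" using ereal_dense2[OF a] by blast
  have "\<forall>\<^sub>F k in sequentially. 1 \<le> k \<longrightarrow> ereal b \<le> S_inf \<rho> \<mu>\<^sub>0 k (\<nu> k)"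
  proof (rule ccontr)
    assume "\<not> ?thesis"
    from not_eventually_sequentiallyD[OF this] obtain s :: "nat \<Rightarrow> nat" where s: "strict_mono s"
      "\<And>n. \<not> (1 \<le> s n \<longrightarrow> ereal b \<le> S_inf \<rho> \<mu>\<^sub>0 (s n) (\<nu> (s n)))" by auto
    then have s1: "1 \<le> s n" and sb: "S_inf \<rho> \<mu>\<^sub>0 (s n) (\<nu> (s n)) < ereal b" for n by (auto simp: not_le)
    have "\<exists>\<pi>\<in>couplings \<mu>\<^sub>0 (\<nu> (s n)). S_cost \<rho> \<mu>\<^sub>0 (s n) \<pi> < ereal b" for n
      using sb[of n] unfolding S_inf_def by (simp add: INF_less_iff)
    then obtain \<pi> where \<pi>: "\<And>n. \<pi> n \<in> couplings \<mu>\<^sub>0 (\<nu> (s n))" "\<And>n. S_cost \<rho> \<mu>\<^sub>0 (s n) (\<pi> n) < ereal b" by metis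
    have conv': "(\<lambda>n. \<integral>x. f x \<partial>\<nu> (s n)) \<longlonglongrightarrow> (\<integral>x. f x \<partial>\<mu>\<^sub>1)"
      if "continuous_on UNIV f" "bounded (range f)" for f :: "'b \<Rightarrow> real"
      using LIMSEQ_subseq_LIMSEQ[OF limitin_narrow_topologyD[OF conv that] s(1)] by (simp add: comp_def)
    obtain r \<sigma> where r: "strict_mono r" and \<sigma>: "\<sigma> \<in> couplings \<mu>\<^sub>0 \<mu>\<^sub>1" and l: "lipschitz_tendsto (\<lambda>n. \<pi> (r n)) \<sigma>"
      by (rule couplings_convergent_subsequence[OF \<mu>0 \<mu>1 \<nu>[OF s1] conv' \<pi>(1)])
    have le: "(\<integral>z. \<phi> z \<partial>\<sigma>) \<le> b"
      if \<phi>: "continuous_on UNIV \<phi>" "\<And>z. 0 \<le> \<phi> z" "\<And>z. \<phi> z \<le> m" "\<And>z. ennreal (\<phi> z) \<le> c z" "bounded (range \<phi>)"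
      for \<phi> :: "'b \<times> 'b \<Rightarrow> real" and m
    proof -
      obtain e where e: "e \<longlonglongrightarrow> 0"
        "\<And>k \<pi> \<nu>. 1 \<le> k \<Longrightarrow> \<pi> \<in> couplings \<mu>\<^sub>0 \<nu> \<Longrightarrow> ereal ((\<integral>z. \<phi> z \<partial>\<pi>) - e k) \<le> S_cost \<rho> \<mu>\<^sub>0 k \<pi>"
        by (rule S_cost_lower_bound[OF kernel ldp \<mu>0 \<phi>(1,2,3,4)]) blast+
      have "(\<integral>z. \<phi> z \<partial>\<pi> n) \<le> b + e (s n)" for n
        using order_le_less_trans[OF e(2)[OF s1 \<pi>(1)] \<pi>(2), of n] by simp
      then have "\<exists>N. \<forall>n\<ge>N. (\<integral>z. \<phi> z \<partial>\<pi> (r n)) \<le> b + e (s (r n))" by blast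
      moreover have "(\<lambda>n. \<integral>z. \<phi> z \<partial>\<pi> (r n)) \<longlonglongrightarrow> (\<integral>z. \<phi> z \<partial>\<sigma>)"
        by (rule lipschitz_tendsto_continuous[OF couplingsD(1)[OF \<pi>(1)] couplingsD(1)[OF \<sigma>] l \<phi>(1,5)])
      moreover have "(\<lambda>n. b + e (s (r n))) \<longlonglongrightarrow> b + 0"
        using LIMSEQ_subseq_LIMSEQ[OF e(1) strict_mono_o[OF s(1) r]] by (intro tendsto_intros) (simp add: comp_def)
      ultimately show ?thesis using LIMSEQ_le by fastforce
    qed
    note B = nn_integral_lsc_le[OF c couplingsD(1)[OF \<sigma>], of b]
    have "0 \<le> b" "(\<integral>\<^sup>+z. c z \<partial>\<sigma>) \<le> ennreal b" by (rule B; (rule le; assumption))+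
    moreover have "MK_inf c \<mu>\<^sub>0 \<mu>\<^sub>1 \<le> (\<integral>\<^sup>+z. c z \<partial>\<sigma>)" unfolding MK_inf_def using \<sigma> by (rule INF_lower)
    ultimately have "enn2ereal (MK_inf c \<mu>\<^sub>0 \<mu>\<^sub>1) \<le> ereal b"
      using enn2ereal_ennreal[of b] by (metis less_eq_ennreal.rep_eq order_trans)
    then show False using b(2) by simp
  qed
  then show ?thesis using eventually_ge_at_top[of 1]
    by eventually_elim (use b(1) in auto)
qed

text \<open>Expresses the marginal constraints as equations between masses of sets. In this form
  they visibly survive midpoints and setwise limits, as \<open>rel_entropy_minimizer\<close>
  demands.\<close>

lemma couplings_iff_measure:
  fixes \<mu> \<nu> :: "'b::polish_space measure"
  assumes \<pi>: "\<pi> \<in> prob_measures" and \<mu>: "\<mu> \<in> prob_measures" and \<nu>: "\<nu> \<in> prob_measures"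
  shows "\<pi> \<in> couplings \<mu> \<nu> \<longleftrightarrow>
    (\<forall>A\<in>sets borel. measure \<pi> (fst -` A) = measure \<mu> A \<and> measure \<pi> (snd -` A) = measure \<nu> A)"
proof -
  interpret P: prob_space \<pi> by (rule prob_measuresD[OF \<pi>])
  have m: "fst \<in> \<pi> \<rightarrow>\<^sub>M borel" "snd \<in> \<pi> \<rightarrow>\<^sub>M borel"
    using prob_measuresD(2)[OF \<pi>] by (simp_all cong: measurable_cong_sets)
  have *: "distr \<pi> borel g = \<kappa> \<longleftrightarrow> (\<forall>A\<in>sets borel. measure \<pi> (g -` A) = measure \<kappa> A)"
    if g: "g \<in> \<pi> \<rightarrow>\<^sub>M borel" and \<kappa>: "\<kappa> \<in> prob_measures" for g and \<kappa> :: "'b measure"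
  proof -
    interpret K: prob_space \<kappa> by (rule prob_measuresD[OF \<kappa>])
    interpret D: prob_space "distr \<pi> borel g" by (rule P.prob_space_distr[OF g])
    have d: "measure (distr \<pi> borel g) A = measure \<pi> (g -` A)" if "A \<in> sets borel" for A
      using that prob_measuresD(3)[OF \<pi>] by (simp add: measure_distr[OF g])
    show ?thesis
    proof
      assume "\<forall>A\<in>sets borel. measure \<pi> (g -` A) = measure \<kappa> A"
      then show "distr \<pi> borel g = \<kappa>"
        by (intro measure_eqI) (simp_all add: D.emeasure_eq_measure K.emeasure_eq_measure d prob_measuresD(2)[OF \<kappa>])
    qed (use d in auto)
  qed
  show ?thesis
    unfolding couplings_def using \<pi> *[OF m(1) \<mu>] *[OF m(2) \<nu>] by auto
qed

lemma S_inf_eq_solution: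
  assumes "S_solution \<rho> \<mu>\<^sub>0 k \<nu> \<pi>"
  shows "\<pi> \<in> couplings \<mu>\<^sub>0 \<nu>" "S_cost \<rho> \<mu>\<^sub>0 k \<pi> = S_inf \<rho> \<mu>\<^sub>0 k \<nu>"
proof -
  show \<pi>: "\<pi> \<in> couplings \<mu>\<^sub>0 \<nu>" using assms by (simp add: S_solution_def is_arg_min_def)
  have "S_cost \<rho> \<mu>\<^sub>0 k \<pi> \<le> S_cost \<rho> \<mu>\<^sub>0 k \<sigma>" if "\<sigma> \<in> couplings \<mu>\<^sub>0 \<nu>" for \<sigma>
    using assms that by (auto simp: S_solution_def is_arg_min_def not_less)
  then show "S_cost \<rho> \<mu>\<^sub>0 k \<pi> = S_inf \<rho> \<mu>\<^sub>0 k \<nu>"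
    unfolding S_inf_def using \<pi> by (intro antisym INF_greatest INF_lower)
qed

text \<open>The positive factor \<open>1 / k\<close> does not affect minimizers, so the problem is
  that of \<open>rel_entropy_minimizer\<close> for the class of couplings. Finiteness of the infimum
  provides a coupling of finite entropy.\<close>

lemma S_solution_ex1:
  fixes \<mu>\<^sub>0 \<nu> :: "'b::polish_space measure"
  assumes k: "1 \<le> k" and kernel: "\<rho> k \<in> borel \<rightarrow>\<^sub>M prob_algebra borel"
    and \<mu>0: "\<mu>\<^sub>0 \<in> prob_measures" and \<nu>: "\<nu> \<in> prob_measures" and fin: "S_inf \<rho> \<mu>\<^sub>0 k \<nu> < \<infinity>"
  shows "\<exists>!\<pi>. S_solution \<rho> \<mu>\<^sub>0 k \<nu> \<pi>"
proof -
  define R where "R = joint_law \<mu>\<^sub>0 (\<rho> k)"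
  have R: "R \<in> prob_measures" unfolding R_def by (rule joint_law_in_prob_measures[OF \<mu>0 kernel])
  note sR = prob_measuresD(2)[OF R]
  let ?K = "couplings \<mu>\<^sub>0 \<nu>"
  have scale: "S_cost \<rho> \<mu>\<^sub>0 k \<pi> \<le> S_cost \<rho> \<mu>\<^sub>0 k \<sigma> \<longleftrightarrow> rel_entropy \<pi> R \<le> rel_entropy \<sigma> R" for \<pi> \<sigma>
    unfolding S_cost_def R_def[symmetric] using k by (subst ereal_mult_le_mult_iff) auto
  have sol: "S_solution \<rho> \<mu>\<^sub>0 k \<nu> \<pi> \<longleftrightarrow> \<pi> \<in> ?K \<and> rel_entropy \<pi> R = (INF \<pi>\<in>?K. rel_entropy \<pi> R)" for \<pi>
  proof -
    have "S_solution \<rho> \<mu>\<^sub>0 k \<nu> \<pi> \<longleftrightarrow> \<pi> \<in> ?K \<and> (\<forall>\<sigma>\<in>?K. rel_entropy \<pi> R \<le> rel_entropy \<sigma> R)"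
      unfolding S_solution_def is_arg_min_def scale[symmetric] by (auto simp: not_less)
    also have "\<dots> \<longleftrightarrow> \<pi> \<in> ?K \<and> rel_entropy \<pi> R = (INF \<pi>\<in>?K. rel_entropy \<pi> R)"
      by (metis INF_greatest INF_lower antisym)
    finally show ?thesis .
  qed
  have dens_prob: "density R (\<lambda>x. ennreal (h x)) \<in> prob_measures"
    if "prob_space (density R (\<lambda>x. ennreal (h x)))" for h
    using that sR by (intro prob_measuresI) simp_all
  have vim: "fst -` A \<in> sets R" "snd -` A \<in> sets R" if "A \<in> sets borel" for A :: "'b set"
    using measurable_sets[OF borel_measurable_fst_snd(1) that] measurable_sets[OF borel_measurable_fst_snd(2) that] sR by auto
  have "\<exists>!P. P \<in> ?K \<and> rel_entropy P R = (INF P\<in>?K. rel_entropy P R)"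
  proof (rule rel_entropy_minimizer[OF prob_measuresD(1)[OF R]])
    show "prob_space P" "sets P = sets R" if "P \<in> ?K" for P
      using prob_measuresD[OF couplingsD(1)[OF that]] sR by auto
  next
    fix f g :: "'b \<times> 'b \<Rightarrow> real"
    assume f: "f \<in> borel_measurable R" and g: "g \<in> borel_measurable R" and f0: "\<And>x. 0 \<le> f x" and g0: "\<And>x. 0 \<le> g x"
      and Kf: "density R (\<lambda>x. ennreal (f x)) \<in> ?K" and Kg: "density R (\<lambda>x. ennreal (g x)) \<in> ?K"
    note pf = couplingsD(1)[OF Kf] and pg = couplingsD(1)[OF Kg]
    note If = prob_density_integrable(1)[OF prob_measuresD(1)[OF pf] f f0]
      and Ig = prob_density_integrable(1)[OF prob_measuresD(1)[OF pg] g g0]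
    have m0: "0 \<le> (f x + g x) / 2" for x using f0[of x] g0[of x] by simp
    have Im: "integrable R (\<lambda>x. (f x + g x) / 2)" using If Ig by auto
    have mm: "measure (density R (\<lambda>x. ennreal ((f x + g x) / 2))) A
        = (measure (density R (\<lambda>x. ennreal (f x))) A + measure (density R (\<lambda>x. ennreal (g x))) A) / 2"
      if A: "A \<in> sets R" for A
    proof -
      have "(\<integral>x. indicator A x * ((f x + g x) / 2) \<partial>R) = (\<integral>x. (indicator A x * f x + indicator A x * g x) / 2 \<partial>R)"
        by (intro Bochner_Integration.integral_cong) (auto simp: algebra_simps add_divide_distrib)
      also have "\<dots> = ((\<integral>x. indicator A x * f x \<partial>R) + (\<integral>x. indicator A x * g x \<partial>R)) / 2"
        using integrable_mult_indicator[OF A If] integrable_mult_indicator[OF A Ig] by simp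
      finally show ?thesis
        by (simp add: measure_density_real[OF A Im m0] measure_density_real[OF A If f0] measure_density_real[OF A Ig g0])
    qed
    have pm: "prob_space (density R (\<lambda>x. ennreal ((f x + g x) / 2)))"
    proof (rule prob_spaceI)
      have "measure (density R (\<lambda>x. ennreal ((f x + g x) / 2))) (space R) = 1"
        using prob_space.prob_space[OF prob_measuresD(1)[OF pf]] prob_space.prob_space[OF prob_measuresD(1)[OF pg]]
        by (simp add: mm)
      then show "emeasure (density R (\<lambda>x. ennreal ((f x + g x) / 2))) (space (density R (\<lambda>x. ennreal ((f x + g x) / 2)))) = 1"
        by (cases "emeasure (density R (\<lambda>x. ennreal ((f x + g x) / 2))) (space R)") (auto simp: measure_def)
    qed
    show "density R (\<lambda>x. ennreal ((f x + g x) / 2)) \<in> ?K"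
      unfolding couplings_iff_measure[OF dens_prob[OF pm] \<mu>0 \<nu>]
      using Kf[unfolded couplings_iff_measure[OF pf \<mu>0 \<nu>]] Kg[unfolded couplings_iff_measure[OF pg \<mu>0 \<nu>]]
      by (simp add: mm vim)
  next
    fix f :: "nat \<Rightarrow> 'b \<times> 'b \<Rightarrow> real" and g :: "'b \<times> 'b \<Rightarrow> real"
    assume Kf: "\<And>n. density R (\<lambda>x. ennreal (f n x)) \<in> ?K"
      and lim: "\<And>A. A \<in> sets R \<Longrightarrow> (\<lambda>n. measure (density R (\<lambda>x. ennreal (f n x))) A) \<longlonglongrightarrow> measure (density R (\<lambda>x. ennreal (g x))) A"
      and pg: "prob_space (density R (\<lambda>x. ennreal (g x)))"
    have Kf': "measure (density R (\<lambda>x. ennreal (f n x))) (fst -` A) = measure \<mu>\<^sub>0 A"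
      "measure (density R (\<lambda>x. ennreal (f n x))) (snd -` A) = measure \<nu> A" if "A \<in> sets borel" for n A
      using Kf[of n] that unfolding couplings_iff_measure[OF couplingsD(1)[OF Kf] \<mu>0 \<nu>] by auto
    show "density R (\<lambda>x. ennreal (g x)) \<in> ?K"
      unfolding couplings_iff_measure[OF dens_prob[OF pg] \<mu>0 \<nu>]
    proof (intro ballI conjI)
      fix A :: "'b set" assume A: "A \<in> sets borel"
      show "measure (density R (\<lambda>x. ennreal (g x))) (fst -` A) = measure \<mu>\<^sub>0 A"
        using lim[OF vim(1)[OF A]] by (simp add: Kf'[OF A] LIMSEQ_const_iff)
      show "measure (density R (\<lambda>x. ennreal (g x))) (snd -` A) = measure \<nu> A"
        using lim[OF vim(2)[OF A]] by (simp add: Kf'[OF A] LIMSEQ_const_iff)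
    qed
  next
    obtain \<pi> where \<pi>: "\<pi> \<in> ?K" "S_cost \<rho> \<mu>\<^sub>0 k \<pi> < \<infinity>"
      using fin unfolding S_inf_def INF_less_iff by blast
    have "rel_entropy \<pi> R \<noteq> \<infinity>"
    proof
      assume "rel_entropy \<pi> R = \<infinity>"
      then have "S_cost \<rho> \<mu>\<^sub>0 k \<pi> = \<infinity>" unfolding S_cost_def R_def[symmetric] using k by simp
      then show False using \<pi>(2) by simp
    qed
    then have "rel_entropy \<pi> R < \<infinity>" by simp
    then show "(INF P\<in>?K. rel_entropy P R) < \<infinity>" using \<pi>(1) unfolding INF_less_iff by blast
  qed
  then show ?thesis unfolding sol .
qed

text \<open>Every inequality needed of \<pi> concerns a single test function, so it can be read off
  at one suitable index \<open>k\<close> up to an arbitrary error. The equalities of marginals and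
  the cost bound are obtained in this way, without extracting a subsequence.\<close>

lemma S_solution_limit_point:
  fixes \<mu>\<^sub>0 \<mu>\<^sub>1 :: "'b::polish_space measure"
  assumes kernel: "\<And>k. 1 \<le> k \<Longrightarrow> \<rho> k \<in> borel \<rightarrow>\<^sub>M prob_algebra borel"
    and ldp: "\<And>x. large_deviation_principle (\<lambda>k. \<rho> k x) (\<lambda>y. c (x, y))"
    and c: "lower_semicontinuous c" and \<mu>0: "\<mu>\<^sub>0 \<in> prob_measures" and \<mu>1: "\<mu>\<^sub>1 \<in> prob_measures"
    and conv: "limitin narrow_topology \<nu> \<mu>\<^sub>1 sequentially"
    and lim: "(\<lambda>k. S_inf \<rho> \<mu>\<^sub>0 k (\<nu> k)) \<longlonglongrightarrow> enn2ereal (MK_inf c \<mu>\<^sub>0 \<mu>\<^sub>1)"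
    and fin: "MK_inf c \<mu>\<^sub>0 \<mu>\<^sub>1 < \<infinity>"
    and sol: "\<forall>\<^sub>F k in sequentially. S_solution \<rho> \<mu>\<^sub>0 k (\<nu> k) (\<pi>_hat k)"
    and pt: "seq_limit_point narrow_topology \<pi>_hat \<pi>"
  shows "MK_solution c \<mu>\<^sub>0 \<mu>\<^sub>1 \<pi>"
proof -
  have \<pi>: "\<pi> \<in> prob_measures" using pt by (simp add: seq_limit_point_def topspace_narrow_topology)
  obtain v where v: "MK_inf c \<mu>\<^sub>0 \<mu>\<^sub>1 = ennreal v" "0 \<le> v" using fin by (cases "MK_inf c \<mu>\<^sub>0 \<mu>\<^sub>1") auto
  \<comment> \<open>Closeness holds infinitely often; any condition \<open>P\<close> that holds
    eventually can be added at the same index.\<close>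
  have near: "\<exists>k. P k \<and> S_solution \<rho> \<mu>\<^sub>0 k (\<nu> k) (\<pi>_hat k) \<and> \<bar>(\<integral>z. f z \<partial>\<pi>_hat k) - (\<integral>z. f z \<partial>\<pi>)\<bar> < e"
    if f: "continuous_on UNIV f" "bounded (range f)" and e: "0 < e" and P: "\<forall>\<^sub>F k in sequentially. P k"
    for f :: "'b \<times> 'b \<Rightarrow> real" and e P
  proof -
    have "\<exists>\<^sub>F k in sequentially. \<bar>(\<integral>z. f z \<partial>\<pi>_hat k) - (\<integral>z. f z \<partial>\<pi>)\<bar> < e
        \<and> (P k \<and> S_solution \<rho> \<mu>\<^sub>0 k (\<nu> k) (\<pi>_hat k))"
      by (rule frequently_eventually_frequently[OF seq_limit_point_integral_frequently[OF pt f e] eventually_conj[OF P sol]])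
    then show ?thesis by (auto dest: frequently_ex)
  qed
  have cb: "continuous_on UNIV (\<lambda>z. f (g z))" "bounded (range (\<lambda>z. f (g z)))"
    if "continuous_on UNIV f" "bounded (range f)" "continuous_on UNIV g" for f :: "'b \<Rightarrow> real" and g :: "'b \<times> 'b \<Rightarrow> 'b"
    using that by (auto intro: continuous_on_compose2 bounded_subset[OF that(2)])
  have cpl: "\<pi> \<in> couplings \<mu>\<^sub>0 \<mu>\<^sub>1"
  proof (rule couplingsI_integral[OF \<pi> \<mu>0 \<mu>1])
    fix f :: "'b \<Rightarrow> real" assume f: "continuous_on UNIV f" "bounded (range f)"
    note fm = borel_measurable_continuous_onI[OF f(1)]
    have "\<bar>(\<integral>z. f (fst z) \<partial>\<pi>) - (\<integral>x. f x \<partial>\<mu>\<^sub>0)\<bar> \<le> 0 + e" if e: "0 < e" for e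
    proof -
      obtain k where k: "S_solution \<rho> \<mu>\<^sub>0 k (\<nu> k) (\<pi>_hat k)" "\<bar>(\<integral>z. f (fst z) \<partial>\<pi>_hat k) - (\<integral>z. f (fst z) \<partial>\<pi>)\<bar> < e"
        using near[OF cb[OF f continuous_on_fst[OF continuous_on_id]] e, of "\<lambda>_. True"] by auto
      show ?thesis using k(2) unfolding integral_couplings_fst[OF S_inf_eq_solution(1)[OF k(1)] fm] by (simp add: abs_minus_commute)
    qed
    then have "\<bar>(\<integral>z. f (fst z) \<partial>\<pi>) - (\<integral>x. f x \<partial>\<mu>\<^sub>0)\<bar> \<le> 0" by (rule field_le_epsilon)
    then show "(\<integral>z. f (fst z) \<partial>\<pi>) = (\<integral>x. f x \<partial>\<mu>\<^sub>0)" by simp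
    have "\<bar>(\<integral>z. f (snd z) \<partial>\<pi>) - (\<integral>x. f x \<partial>\<mu>\<^sub>1)\<bar> \<le> 0 + e" if e: "0 < e" for e
    proof -
      have e2: "0 < e / 2" using e by simp
      have "\<forall>\<^sub>F k in sequentially. \<bar>(\<integral>x. f x \<partial>\<nu> k) - (\<integral>x. f x \<partial>\<mu>\<^sub>1)\<bar> < e / 2"
        using tendstoD[OF limitin_narrow_topologyD[OF conv f] e2] by (simp add: dist_real_def)
      from near[OF cb[OF f continuous_on_snd[OF continuous_on_id]] e2 this]
      obtain k where k: "\<bar>(\<integral>x. f x \<partial>\<nu> k) - (\<integral>x. f x \<partial>\<mu>\<^sub>1)\<bar> < e / 2"
        "S_solution \<rho> \<mu>\<^sub>0 k (\<nu> k) (\<pi>_hat k)" "\<bar>(\<integral>z. f (snd z) \<partial>\<pi>_hat k) - (\<integral>z. f (snd z) \<partial>\<pi>)\<bar> < e / 2" by auto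
      show ?thesis using k(1,3) unfolding integral_couplings_snd[OF S_inf_eq_solution(1)[OF k(2)] fm] by linarith
    qed
    then have "\<bar>(\<integral>z. f (snd z) \<partial>\<pi>) - (\<integral>x. f x \<partial>\<mu>\<^sub>1)\<bar> \<le> 0" by (rule field_le_epsilon)
    then show "(\<integral>z. f (snd z) \<partial>\<pi>) = (\<integral>x. f x \<partial>\<mu>\<^sub>1)" by simp
  qed
  have "(\<integral>\<^sup>+z. c z \<partial>\<pi>) \<le> ennreal v"
  proof (rule nn_integral_lsc_le(2)[OF c \<pi>])
    fix \<phi> :: "'b \<times> 'b \<Rightarrow> real" and m
    assume \<phi>: "continuous_on UNIV \<phi>" "\<And>z. 0 \<le> \<phi> z" "\<And>z. \<phi> z \<le> m" "\<And>z. ennreal (\<phi> z) \<le> c z" "bounded (range \<phi>)"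
    obtain e where e: "e \<longlonglongrightarrow> 0"
      "\<And>k \<pi> \<nu>. 1 \<le> k \<Longrightarrow> \<pi> \<in> couplings \<mu>\<^sub>0 \<nu> \<Longrightarrow> ereal ((\<integral>z. \<phi> z \<partial>\<pi>) - e k) \<le> S_cost \<rho> \<mu>\<^sub>0 k \<pi>"
      by (rule S_cost_lower_bound[OF kernel ldp \<mu>0 \<phi>(1,2,3,4)]) blast+
    show "(\<integral>z. \<phi> z \<partial>\<pi>) \<le> v"
    \<comment> \<open>One third of the error each for the uniform error \<open>e k\<close>, for the
      convergence of the infima and for the closeness of the integrals of
      \<open>\<phi>\<close>.\<close>
    proof (rule field_le_epsilon)
      fix \<epsilon> :: real assume "0 < \<epsilon>"
      then have \<epsilon>: "0 < \<epsilon> / 3" by simp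
      have 1: "\<forall>\<^sub>F k in sequentially. e k < \<epsilon> / 3" by (rule order_tendstoD(2)[OF e(1) \<epsilon>])
      have "enn2ereal (MK_inf c \<mu>\<^sub>0 \<mu>\<^sub>1) < ereal (v + \<epsilon> / 3)" unfolding v(1) enn2ereal_ennreal[OF v(2)] using \<epsilon> by simp
      then have 2: "\<forall>\<^sub>F k in sequentially. S_inf \<rho> \<mu>\<^sub>0 k (\<nu> k) < ereal (v + \<epsilon> / 3)" by (rule order_tendstoD(2)[OF lim])
      from near[OF \<phi>(1,5) \<epsilon> eventually_conj[OF eventually_conj[OF 1 2] eventually_ge_at_top[of 1]]]
      obtain k where k: "e k < \<epsilon> / 3" "S_inf \<rho> \<mu>\<^sub>0 k (\<nu> k) < ereal (v + \<epsilon> / 3)" "1 \<le> k"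
        "S_solution \<rho> \<mu>\<^sub>0 k (\<nu> k) (\<pi>_hat k)" "\<bar>(\<integral>z. \<phi> z \<partial>\<pi>_hat k) - (\<integral>z. \<phi> z \<partial>\<pi>)\<bar> < \<epsilon> / 3" by auto
      have "ereal ((\<integral>z. \<phi> z \<partial>\<pi>_hat k) - e k) < ereal (v + \<epsilon> / 3)"
        using e(2)[OF k(3) S_inf_eq_solution(1)[OF k(4)]] k(2) unfolding S_inf_eq_solution(2)[OF k(4)] by (rule order_le_less_trans)
      then have "(\<integral>z. \<phi> z \<partial>\<pi>_hat k) - e k < v + \<epsilon> / 3" by simp
      then show "(\<integral>z. \<phi> z \<partial>\<pi>) \<le> v + \<epsilon>" using k(1,5) by linarith
    qed
  qed
  then show ?thesis using cpl v(1) by (intro MK_solutionI) simp_all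
qed

theorem theorem3p3:
  fixes c :: "'a::polish_space \<times> 'a \<Rightarrow> ennreal"
    and \<rho> :: "nat \<Rightarrow> 'a \<Rightarrow> 'a measure"
    and \<mu>\<^sub>0 \<mu>\<^sub>1 :: "'a measure"
  assumes c_lsc: "lower_semicontinuous c"
    and kernel: "\<And>k. k \<ge> 1 \<Longrightarrow> \<rho> k \<in> borel \<rightarrow>\<^sub>M prob_algebra borel"
    and LDP: "\<And>x. large_deviation_principle (\<lambda>k. \<rho> k x) (\<lambda>y. c (x, y))"
    and c_coercive: "\<And>x. coercive (\<lambda>y. c (x, y))"
    and \<mu>\<^sub>0: "\<mu>\<^sub>0 \<in> prob_measures"
    and \<mu>\<^sub>1: "\<mu>\<^sub>1 \<in> prob_measures"
  shows
    "(\<exists>\<nu> :: nat \<Rightarrow> 'a measure.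
        (\<forall>k\<ge>1. \<nu> k \<in> prob_measures) \<and>
        limitin narrow_topology \<nu> \<mu>\<^sub>1 sequentially \<and>
        (\<lambda>k. S_inf \<rho> \<mu>\<^sub>0 k (\<nu> k)) \<longlonglongrightarrow> enn2ereal (MK_inf c \<mu>\<^sub>0 \<mu>\<^sub>1)) \<and>
     (\<forall>\<nu> :: nat \<Rightarrow> 'a measure.
        (\<forall>k\<ge>1. \<nu> k \<in> prob_measures) \<longrightarrow>
        limitin narrow_topology \<nu> \<mu>\<^sub>1 sequentially \<longrightarrow>
        (\<lambda>k. S_inf \<rho> \<mu>\<^sub>0 k (\<nu> k)) \<longlonglongrightarrow> enn2ereal (MK_inf c \<mu>\<^sub>0 \<mu>\<^sub>1) \<longrightarrow>
        MK_inf c \<mu>\<^sub>0 \<mu>\<^sub>1 < \<infinity> \<longrightarrow>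
        (\<forall>\<^sub>F k in sequentially. \<exists>!\<pi>. S_solution \<rho> \<mu>\<^sub>0 k (\<nu> k) \<pi>) \<and>
        (\<forall>\<pi>_hat :: nat \<Rightarrow> ('a \<times> 'a) measure.
           (\<forall>\<^sub>F k in sequentially. S_solution \<rho> \<mu>\<^sub>0 k (\<nu> k) (\<pi>_hat k)) \<longrightarrow>
           (\<forall>\<pi>. seq_limit_point narrow_topology \<pi>_hat \<pi> \<longrightarrow> MK_solution c \<mu>\<^sub>0 \<mu>\<^sub>1 \<pi>) \<and>
           (\<forall>\<pi>. MK_solution c \<mu>\<^sub>0 \<mu>\<^sub>1 \<pi> \<and> (\<forall>\<pi>'. MK_solution c \<mu>\<^sub>0 \<mu>\<^sub>1 \<pi>' \<longrightarrow> \<pi>' = \<pi>) \<longrightarrow>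
              limitin narrow_topology \<pi>_hat \<pi> sequentially)))"
proof (intro conjI allI impI)
  show "\<exists>\<nu> :: nat \<Rightarrow> 'a measure.
      (\<forall>k\<ge>1. \<nu> k \<in> prob_measures) \<and>
      limitin narrow_topology \<nu> \<mu>\<^sub>1 sequentially \<and>
      (\<lambda>k. S_inf \<rho> \<mu>\<^sub>0 k (\<nu> k)) \<longlonglongrightarrow> enn2ereal (MK_inf c \<mu>\<^sub>0 \<mu>\<^sub>1)"
  proof (cases "MK_inf c \<mu>\<^sub>0 \<mu>\<^sub>1 < top")
    case False
    \<comment> \<open>With infinite optimal cost the constant sequence serves: the lower bound alone
      forces the infima to infinity.\<close>
    then have top: "MK_inf c \<mu>\<^sub>0 \<mu>\<^sub>1 = top" by (simp add: not_less top_unique)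
    have lim: "limitin narrow_topology (\<lambda>_. \<mu>\<^sub>1) \<mu>\<^sub>1 sequentially"
      by (subst limitin_narrow_topology) (auto intro: \<mu>\<^sub>1)
    have "(\<lambda>k. S_inf \<rho> \<mu>\<^sub>0 k \<mu>\<^sub>1) \<longlonglongrightarrow> enn2ereal (MK_inf c \<mu>\<^sub>0 \<mu>\<^sub>1)"
    proof (rule order_tendstoI)
      fix a assume a: "a < enn2ereal (MK_inf c \<mu>\<^sub>0 \<mu>\<^sub>1)"
      show "\<forall>\<^sub>F k in sequentially. a < S_inf \<rho> \<mu>\<^sub>0 k \<mu>\<^sub>1"
        by (rule S_inf_lower_limit[OF kernel LDP c_lsc \<mu>\<^sub>0 \<mu>\<^sub>1 \<mu>\<^sub>1 lim a])
    qed (simp add: top)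
    then show ?thesis using \<mu>\<^sub>1 lim by (intro exI[of _ "\<lambda>_. \<mu>\<^sub>1"]) simp
  next
    case True
    then obtain v where v: "MK_inf c \<mu>\<^sub>0 \<mu>\<^sub>1 = ennreal v" "0 \<le> v" by (cases "MK_inf c \<mu>\<^sub>0 \<mu>\<^sub>1") auto
    obtain \<pi> where \<pi>: "\<pi> \<in> couplings \<mu>\<^sub>0 \<mu>\<^sub>1" "(\<integral>\<^sup>+z. c z \<partial>\<pi>) \<le> MK_inf c \<mu>\<^sub>0 \<mu>\<^sub>1"
      by (rule MK_solution_exists[OF c_lsc \<mu>\<^sub>0 \<mu>\<^sub>1 True])
    have \<pi>fin: "(\<integral>\<^sup>+z. c z \<partial>\<pi>) < top" using \<pi>(2) True by (rule order_le_less_trans)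
    obtain \<pi>' where \<pi>': "\<And>k. \<pi>' k \<in> prob_measures" "\<And>k. distr (\<pi>' k) borel fst = \<mu>\<^sub>0"
      and lip: "lipschitz_tendsto \<pi>' \<pi>"
      and cost: "\<And>\<epsilon>. 0 < \<epsilon> \<Longrightarrow> \<forall>\<^sub>F k in sequentially. S_cost \<rho> \<mu>\<^sub>0 k (\<pi>' k) \<le> enn2ereal ((\<integral>\<^sup>+z. c z \<partial>\<pi>) + ennreal \<epsilon>)"
      by (rule recovery_sequence[OF kernel LDP c_lsc \<pi>(1) \<pi>fin]) blast+
    \<comment> \<open>The target marginals are whatever the recovery sequence produces. They
      converge to \<open>\<mu>\<^sub>1\<close> because the couplings converge to \<pi>, and each
      recovery coupling competes in its own problem.\<close>
    define \<nu> where "\<nu> k = distr (\<pi>' k) borel snd" for k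
    have cpl: "\<pi>' k \<in> couplings \<mu>\<^sub>0 (\<nu> k)" for k using \<pi>' by (simp add: couplings_def \<nu>_def)
    have \<nu>: "\<nu> k \<in> prob_measures" for k
      unfolding \<nu>_def using prob_measuresD(1,2)[OF \<pi>'(1)]
      by (intro prob_measuresI prob_space.prob_space_distr) (simp_all cong: measurable_cong_sets)
    have lim: "limitin narrow_topology \<nu> \<mu>\<^sub>1 sequentially"
    proof (subst limitin_narrow_topology[OF \<nu> \<mu>\<^sub>1], intro allI impI, elim conjE)
      fix f :: "'a \<Rightarrow> real" assume f: "continuous_on UNIV f" "bounded (range f)"
      have "(\<lambda>k. \<integral>z. f (snd z) \<partial>\<pi>' k) \<longlonglongrightarrow> (\<integral>z. f (snd z) \<partial>\<pi>)"
      proof (rule lipschitz_tendsto_continuous[OF \<pi>'(1) couplingsD(1)[OF \<pi>(1)] lip])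
        show "continuous_on UNIV (\<lambda>z :: 'a \<times> 'a. f (snd z))"
          by (rule continuous_on_compose2[OF f(1)]) (auto intro: continuous_intros)
        show "bounded (range (\<lambda>z :: 'a \<times> 'a. f (snd z)))" by (rule bounded_subset[OF f(2)]) auto
      qed
      then show "(\<lambda>k. \<integral>x. f x \<partial>\<nu> k) \<longlonglongrightarrow> (\<integral>x. f x \<partial>\<mu>\<^sub>1)"
        unfolding integral_couplings_snd[OF cpl borel_measurable_continuous_onI[OF f(1)]]
          integral_couplings_snd[OF \<pi>(1) borel_measurable_continuous_onI[OF f(1)]] .
    qed
    have "(\<lambda>k. S_inf \<rho> \<mu>\<^sub>0 k (\<nu> k)) \<longlonglongrightarrow> enn2ereal (MK_inf c \<mu>\<^sub>0 \<mu>\<^sub>1)"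
    proof (rule order_tendstoI)
      fix a assume a: "a < enn2ereal (MK_inf c \<mu>\<^sub>0 \<mu>\<^sub>1)"
      show "\<forall>\<^sub>F k in sequentially. a < S_inf \<rho> \<mu>\<^sub>0 k (\<nu> k)"
        by (rule S_inf_lower_limit[OF kernel LDP c_lsc \<mu>\<^sub>0 \<mu>\<^sub>1 \<nu> lim a])
    next
      fix a assume "enn2ereal (MK_inf c \<mu>\<^sub>0 \<mu>\<^sub>1) < a"
      then have "ereal v < a" using v by (simp add: enn2ereal_ennreal)
      then obtain b where b: "ereal v < ereal b" "ereal b < a" using ereal_dense2 by blast
      then have "0 < b - v" by simp
      from cost[OF this] show "\<forall>\<^sub>F k in sequentially. S_inf \<rho> \<mu>\<^sub>0 k (\<nu> k) < a"
      proof (rule eventually_mono)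
        fix k assume 1: "S_cost \<rho> \<mu>\<^sub>0 k (\<pi>' k) \<le> enn2ereal ((\<integral>\<^sup>+z. c z \<partial>\<pi>) + ennreal (b - v))"
        have "(\<integral>\<^sup>+z. c z \<partial>\<pi>) + ennreal (b - v) \<le> ennreal v + ennreal (b - v)"
          using \<pi>(2) v(1) by (intro add_right_mono) simp
        also have "\<dots> = ennreal b" using v(2) \<open>0 < b - v\<close> by (simp flip: ennreal_plus)
        finally have "enn2ereal ((\<integral>\<^sup>+z. c z \<partial>\<pi>) + ennreal (b - v)) \<le> ereal b"
          using enn2ereal_ennreal[of b] v(2) \<open>0 < b - v\<close> by (simp add: less_eq_ennreal.rep_eq)
        moreover have "S_inf \<rho> \<mu>\<^sub>0 k (\<nu> k) \<le> S_cost \<rho> \<mu>\<^sub>0 k (\<pi>' k)"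
          unfolding S_inf_def using cpl by (rule INF_lower)
        ultimately show "S_inf \<rho> \<mu>\<^sub>0 k (\<nu> k) < a" using 1 b(2) by (meson order_le_less_trans order_trans)
      qed
    qed
    then show ?thesis using \<nu> lim by blast
  qed
next
  fix \<nu> :: "nat \<Rightarrow> 'a measure"
  assume \<nu>: "\<forall>k\<ge>1. \<nu> k \<in> prob_measures"
    and lim: "(\<lambda>k. S_inf \<rho> \<mu>\<^sub>0 k (\<nu> k)) \<longlonglongrightarrow> enn2ereal (MK_inf c \<mu>\<^sub>0 \<mu>\<^sub>1)"
    and fin: "MK_inf c \<mu>\<^sub>0 \<mu>\<^sub>1 < \<infinity>"
  have "enn2ereal (MK_inf c \<mu>\<^sub>0 \<mu>\<^sub>1) < \<infinity>" using fin by (cases "MK_inf c \<mu>\<^sub>0 \<mu>\<^sub>1") (auto simp: enn2ereal_ennreal)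
  from order_tendstoD(2)[OF lim this] eventually_ge_at_top[of 1]
  show "\<forall>\<^sub>F k in sequentially. \<exists>!\<pi>. S_solution \<rho> \<mu>\<^sub>0 k (\<nu> k) \<pi>"
  proof eventually_elim
    fix k :: nat assume "S_inf \<rho> \<mu>\<^sub>0 k (\<nu> k) < \<infinity>" "1 \<le> k"
    then show "\<exists>!\<pi>. S_solution \<rho> \<mu>\<^sub>0 k (\<nu> k) \<pi>" using \<nu> kernel \<mu>\<^sub>0 by (intro S_solution_ex1) auto
  qed
next
  fix \<nu> \<pi>_hat \<pi>
  assume *: "limitin narrow_topology \<nu> \<mu>\<^sub>1 sequentially"
    "(\<lambda>k. S_inf \<rho> \<mu>\<^sub>0 k (\<nu> k)) \<longlonglongrightarrow> enn2ereal (MK_inf c \<mu>\<^sub>0 \<mu>\<^sub>1)" "MK_inf c \<mu>\<^sub>0 \<mu>\<^sub>1 < \<infinity>"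
    "\<forall>\<^sub>F k in sequentially. S_solution \<rho> \<mu>\<^sub>0 k (\<nu> k) (\<pi>_hat k)" "seq_limit_point narrow_topology \<pi>_hat \<pi>"
  show "MK_solution c \<mu>\<^sub>0 \<mu>\<^sub>1 \<pi>"
    by (rule S_solution_limit_point[OF kernel LDP c_lsc \<mu>\<^sub>0 \<mu>\<^sub>1 *])
next
  fix \<nu> \<pi>_hat \<pi>
  assume \<nu>: "\<forall>k\<ge>1. \<nu> k \<in> prob_measures"
    and conv: "limitin narrow_topology \<nu> \<mu>\<^sub>1 sequentially"
    and lim: "(\<lambda>k. S_inf \<rho> \<mu>\<^sub>0 k (\<nu> k)) \<longlonglongrightarrow> enn2ereal (MK_inf c \<mu>\<^sub>0 \<mu>\<^sub>1)"
    and fin: "MK_inf c \<mu>\<^sub>0 \<mu>\<^sub>1 < \<infinity>"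
    and sol: "\<forall>\<^sub>F k in sequentially. S_solution \<rho> \<mu>\<^sub>0 k (\<nu> k) (\<pi>_hat k)"
    and uniq: "MK_solution c \<mu>\<^sub>0 \<mu>\<^sub>1 \<pi> \<and> (\<forall>\<pi>'. MK_solution c \<mu>\<^sub>0 \<mu>\<^sub>1 \<pi>' \<longrightarrow> \<pi>' = \<pi>)"
  have \<pi>: "\<pi> \<in> prob_measures"
    using uniq by (auto simp: MK_solution_def is_arg_min_def couplings_def)
  \<comment> \<open>If the solutions left \<open>U\<close> infinitely often, compactness would give
    a cluster point along such indices. It would be optimal, hence equal to \<pi> by uniqueness, and
    the subsequence would have to enter \<open>U\<close>.\<close>
  have "\<forall>\<^sub>F k in sequentially. \<pi>_hat k \<in> U" if U: "openin narrow_topology U" "\<pi> \<in> U" for U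
  proof (rule ccontr)
    assume "\<not> ?thesis"
    \<comment> \<open>The eventual properties are put into the premise of the negated statement, so
      that every index of the extracted subsequence has them.\<close>
    have "\<not> (\<forall>\<^sub>F k in sequentially. 1 \<le> k \<and> S_solution \<rho> \<mu>\<^sub>0 k (\<nu> k) (\<pi>_hat k) \<longrightarrow> \<pi>_hat k \<in> U)"
    proof
      assume "\<forall>\<^sub>F k in sequentially. 1 \<le> k \<and> S_solution \<rho> \<mu>\<^sub>0 k (\<nu> k) (\<pi>_hat k) \<longrightarrow> \<pi>_hat k \<in> U"
      then have "\<forall>\<^sub>F k in sequentially. \<pi>_hat k \<in> U" using sol eventually_ge_at_top[of 1] by eventually_elim simp
      then show False using \<open>\<not> (\<forall>\<^sub>F k in sequentially. \<pi>_hat k \<in> U)\<close> by simp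
    qed
    from not_eventually_sequentiallyD[OF this] obtain s :: "nat \<Rightarrow> nat" where s: "strict_mono s"
      "\<And>n. 1 \<le> s n" "\<And>n. S_solution \<rho> \<mu>\<^sub>0 (s n) (\<nu> (s n)) (\<pi>_hat (s n))" "\<And>n. \<pi>_hat (s n) \<notin> U" by auto
    have conv': "(\<lambda>n. \<integral>x. f x \<partial>\<nu> (s n)) \<longlonglongrightarrow> (\<integral>x. f x \<partial>\<mu>\<^sub>1)"
      if "continuous_on UNIV f" "bounded (range f)" for f :: "'a \<Rightarrow> real"
      using LIMSEQ_subseq_LIMSEQ[OF limitin_narrow_topologyD[OF conv that] s(1)] by (simp add: comp_def)
    have \<nu>s: "\<nu> (s n) \<in> prob_measures" for n using \<nu> s(2) by blast
    note cpl = S_inf_eq_solution(1)[OF s(3)]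
    obtain r \<sigma> where r: "strict_mono r" and \<sigma>: "\<sigma> \<in> couplings \<mu>\<^sub>0 \<mu>\<^sub>1" and l: "lipschitz_tendsto (\<lambda>n. \<pi>_hat (s (r n))) \<sigma>"
      by (rule couplings_convergent_subsequence[OF \<mu>\<^sub>0 \<mu>\<^sub>1 \<nu>s conv' cpl])
    have L: "limitin narrow_topology (\<lambda>n. \<pi>_hat (s (r n))) \<sigma> sequentially"
      by (subst limitin_narrow_topology[OF couplingsD(1)[OF cpl] couplingsD(1)[OF \<sigma>]])
        (intro allI impI lipschitz_tendsto_continuous[OF couplingsD(1)[OF cpl] couplingsD(1)[OF \<sigma>] l], auto)
    have sr: "strict_mono (s \<circ> r)" by (rule strict_mono_o[OF s(1) r])
    have pt: "seq_limit_point narrow_topology \<pi>_hat \<sigma>"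
      unfolding seq_limit_point_def
    proof (intro conjI allI impI)
      show "\<sigma> \<in> topspace narrow_topology" using couplingsD(1)[OF \<sigma>] by (simp add: topspace_narrow_topology)
      fix V assume "openin narrow_topology V \<and> \<sigma> \<in> V"
      then have V: "\<forall>\<^sub>F n in sequentially. \<pi>_hat (s (r n)) \<in> V" using L by (auto simp: limitin_def)
      show "\<exists>\<^sub>F k in sequentially. \<pi>_hat k \<in> V"
      proof (rule ccontr)
        assume "\<not> (\<exists>\<^sub>F k in sequentially. \<pi>_hat k \<in> V)"
        then have "\<forall>\<^sub>F k in sequentially. \<pi>_hat k \<notin> V" by (simp add: frequently_def)
        from eventually_subseq[OF sr this] V have "\<forall>\<^sub>F n in sequentially. False"
          by eventually_elim simp
        then show False by simp
      qed
    qed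
    have "MK_solution c \<mu>\<^sub>0 \<mu>\<^sub>1 \<sigma>"
      by (rule S_solution_limit_point[OF kernel LDP c_lsc \<mu>\<^sub>0 \<mu>\<^sub>1 conv lim fin sol pt])
    then have "\<sigma> = \<pi>" using uniq by blast
    then have "\<forall>\<^sub>F n in sequentially. \<pi>_hat (s (r n)) \<in> U" using L U by (auto simp: limitin_def)
    then show False using s(4) by simp
  qed
  then show "limitin narrow_topology \<pi>_hat \<pi> sequentially"
    using \<pi> by (simp add: limitin_def topspace_narrow_topology)
qed

end
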